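(* Let $(R,X)$ be a finite subdivision pair, i.e. $R$ is a (colored) finite subdivision rule of some dimension $d$ and $X$ is an $R$-complex. Then the history graph $\Gamma(R,X)$ is a combinatorial subdivision rule (that is, $\Gamma(R,X)$ can be given edge labels and vertex labels from finite sets, and disjoint subgraphs $\Xi_n$, $n\ge 0$, so as to satisfy the definition of a combinatorial subdivision rule).
   Context: **Finite subdivision rules.** An almost polyhedral complex of dimension $d$ is a finite $d$-dimensional CW complex $Z$ with a fixed cell structure such that $Z$ is the union of its closed $d$-cells and, for every closed $d$-cell $\tilde s$ of $Z$, there is a CW structure $s$ on a closed $d$-disk such that the subcells of $s$ are contained in $\partial s$ and the characteristic map $\psi_s:s\to Z$, which maps onto $\tilde s$, restricts to a homeomorphism onto each open cell. A (colored) finite subdivision rule $R$ of dimension $d$ consists of: (1) an almost polyhedral complex $S_R$ of dimension $d$; (2) a finite $d$-dimensional complex $R(S_R)$ that is a subdivision of $S_R$; (3) a coloring of the cells of $S_R$, i.e. a partition of the set of cells of $S_R$ into an ideal set $I$ and a non-ideal set $N$ such that the union of the cells in $I$ is closed; (4) a subdivision map $\phi_R:R(S_R)\to S_R$, a continuous cellular map that restricts to a homeomorphism on each open cell and maps the union of all cells of $I$ into itself. Each cell of $S_R$ (with its characteristic map) is called a tile type. An $R$-complex is a $d$-dimensional CW complex $X$ that is the union of its closed $d$-cells, together with a continuous cellular map $f:X\to S_R$ (the structure map) whose restriction to each open cell is a homeomorphism. Pulling back the cell structure of $R(S_R)$ along $f$ gives a subdivision $R(X)$ of $X$, which is an $R$-complex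 with structure map $\phi_R\circ f$. Set $R^0(X)=X$ and $R^n(X)=R(R^{n-1}(X))$ for $n\ge 1$ (with structure map $\phi_R^n\circ f$). Cells of $R^n(X)$ are ideal or non-ideal according to the color of their image (tile type) in $S_R$. **History graph.** Let $\Lambda_n$ be the union of all non-ideal tiles of $R^n(X)$. Let $\Gamma_n$ be the dual graph of $\Lambda_n$: it has a vertex for each top-dimensional cell of $\Lambda_n$ and an edge for each pair of top-dimensional cells that intersect in a codimension 1 subset. The history graph $\Gamma(R,X)$ consists of: a single vertex $O$ (the origin); the disjoint union of the graphs $\Gamma_n$, $n\ge 0$ (whose edges are called horizontal); and vertical edges: if a vertex $v$ of $\Gamma_n$ corresponds to a top-dimensional cell $T$, there is an edge connecting $v$ to each vertex of $\Gamma_{n+1}$ corresponding to a top-dimensional cell contained in $R(T)$; also $O$ is connected to every vertex of $\Gamma_0$. **Labeled graphs.** A (finitely) labeled graph is a graph together with a map from its edges to a finite set of edge labels and a map from its vertices to a finite set of vertex labels; unions of open edges (with endpoints possibly missing) are also allowed as labeled graphs. A labeled graph morphism is a graph morphism that preserves labels. The open star of a vertex is the union of that vertex with all the open edges that have it as an endpoint. **Combinatorial subdivision rule.** A finitely labeled graph $\Xi$ is a combinatorial subdivision rule if it contains disjoint subgraphs $\Xi_n$ ($n\ge 0$) such that: (1) $\Xi_0$ is a single vertex. (2) Every vertex is contained in some $\Xi_n$. (3) Every vertex $v$ of $\Xi_n$ with $n>0$ is connected to a unique vertex of $\Xi_{n-1}$, called the predecessor of $v$. The predecessor of the unique vertex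 of $\Xi_0$ is defined to be itself. (4) The open stars of any two vertices with the same label are isomorphic as labeled graphs. (5) Let the predecessor map $\pi:\Xi\to\Xi$ be the graph morphism sending each vertex to its predecessor (an edge whose two endpoints have the same predecessor being sent to that vertex). The preimages under $\pi$ of any two (open) edges with the same label are isomorphic as labeled graphs, and the preimages under $\pi$ of the open stars of any two vertices with the same label are isomorphic as labeled graphs.
   Formalization: The formal theorem assumes that the number of non-ideal d-cells of X around a (d-1)-cell is finite and uniformly bounded (automatic for finite X); without such a condition the claim fails, e.g. for a locally finite tree X of unbounded valence over a circle with d = 1. *)

theory Defs
  imports "HOL-Analysis.Analysis"
begin

section \<open>CW complexes\<close>

text \<open>
  Disks are taken in the library's coordinate model of Euclidean $k$-space, in which the
  dimension is a natural number and may therefore vary from cell to cell.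
\<close>

definition open_disk :: "nat \<Rightarrow> (nat \<Rightarrow> real) set" where
  "open_disk k = {x \<in> topspace (Euclidean_space k). (\<Sum>i<k. (x i)\<^sup>2) < 1}"

definition disk_boundary :: "nat \<Rightarrow> (nat \<Rightarrow> real) set" where
  "disk_boundary k = {x \<in> topspace (Euclidean_space k). (\<Sum>i<k. (x i)\<^sup>2) = 1}"

definition closed_disk :: "nat \<Rightarrow> (nat \<Rightarrow> real) topology" where
  "closed_disk k = subtopology (Euclidean_space k) {x. (\<Sum>i<k. (x i)\<^sup>2) \<le> 1}"

text \<open>
  A space together with a decomposition into cells: \<open>cells Z k\<close> is the set of \<^emph>\<open>open\<close>
  \<open>k\<close>-cells, as subsets of the space. The corresponding closed cells are their closures.
\<close>

record 'a cell_complex =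
  cspace :: "'a topology"
  cells :: "nat \<Rightarrow> 'a set set"

definition all_cells :: "'a cell_complex \<Rightarrow> 'a set set" where
  "all_cells Z = (\<Union>k. cells Z k)"

definition closed_cell :: "'a cell_complex \<Rightarrow> 'a set \<Rightarrow> 'a set" where
  "closed_cell Z c = cspace Z closure_of c"

definition skeleton :: "'a cell_complex \<Rightarrow> nat \<Rightarrow> 'a set" where
  "skeleton Z k = (\<Union>j\<le>k. \<Union>(cells Z j))"

definition characteristic_map ::
    "'a cell_complex \<Rightarrow> nat \<Rightarrow> 'a set \<Rightarrow> ((nat \<Rightarrow> real) \<Rightarrow> 'a) \<Rightarrow> bool" where
  "characteristic_map Z k c \<psi> \<longleftrightarrow>
     continuous_map (closed_disk k) (cspace Z) \<psi> \<and>
     homeomorphic_map (subtopology (closed_disk k) (open_disk k)) (subtopology (cspace Z) c) \<psi> \<and>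
     (\<exists>F. finite F \<and> F \<subseteq> (\<Union>j<k. cells Z j) \<and> \<psi> ` disk_boundary k \<subseteq> \<Union>F)"

definition cw_complex :: "'a cell_complex \<Rightarrow> bool" where
  "cw_complex Z \<longleftrightarrow>
     Hausdorff_space (cspace Z) \<and>
     topspace (cspace Z) = \<Union>(all_cells Z) \<and>
     (\<forall>k l. \<forall>c \<in> cells Z k. \<forall>e \<in> cells Z l. c \<inter> e \<noteq> {} \<longrightarrow> k = l \<and> c = e) \<and>
     (\<forall>k. \<forall>c \<in> cells Z k. \<exists>\<psi>. characteristic_map Z k c \<psi>) \<and>
     (\<forall>A \<subseteq> topspace (cspace Z).
        (\<forall>c \<in> all_cells Z. closedin (cspace Z) (A \<inter> closed_cell Z c)) \<longrightarrow> closedin (cspace Z) A)"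

definition finite_complex :: "'a cell_complex \<Rightarrow> bool" where
  "finite_complex Z \<longleftrightarrow> finite (all_cells Z)"

definition has_dimension :: "'a cell_complex \<Rightarrow> nat \<Rightarrow> bool" where
  "has_dimension Z d \<longleftrightarrow> cells Z d \<noteq> {} \<and> (\<forall>k>d. cells Z k = {})"

definition union_of_closed_top_cells :: "'a cell_complex \<Rightarrow> nat \<Rightarrow> bool" where
  "union_of_closed_top_cells Z d \<longleftrightarrow> topspace (cspace Z) = (\<Union>c \<in> cells Z d. closed_cell Z c)"

definition cellular_map :: "'a cell_complex \<Rightarrow> 'b cell_complex \<Rightarrow> ('a \<Rightarrow> 'b) \<Rightarrow> bool" where
  "cellular_map Y Z f \<longleftrightarrow>
     continuous_map (cspace Y) (cspace Z) f \<and> (\<forall>k. f ` skeleton Y k \<subseteq> skeleton Z k)"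

text \<open>
  ``Restricts to a homeomorphism on each open cell'': every open cell is mapped
  homeomorphically onto an open cell of the target (of the same dimension).
\<close>

definition homeomorphic_on_cells :: "'a cell_complex \<Rightarrow> 'b cell_complex \<Rightarrow> ('a \<Rightarrow> 'b) \<Rightarrow> bool" where
  "homeomorphic_on_cells Y Z f \<longleftrightarrow>
     (\<forall>k. \<forall>c \<in> cells Y k. \<exists>e \<in> cells Z k.
        homeomorphic_map (subtopology (cspace Y) c) (subtopology (cspace Z) e) f)"

definition subdivision_of :: "'a cell_complex \<Rightarrow> 'a cell_complex \<Rightarrow> bool" where
  "subdivision_of Z' Z \<longleftrightarrow>
     cspace Z' = cspace Z \<and> (\<forall>c' \<in> all_cells Z'. \<exists>c \<in> all_cells Z. c' \<subseteq> c)"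

text \<open>
  Here \<open>s\<close> is a CW structure on the closed \<open>d\<close>-disk whose only cell not contained in the
  boundary sphere is the open disk itself.
\<close>

definition almost_polyhedral :: "nat \<Rightarrow> 'a cell_complex \<Rightarrow> bool" where
  "almost_polyhedral d Z \<longleftrightarrow>
     cw_complex Z \<and> finite_complex Z \<and> has_dimension Z d \<and> union_of_closed_top_cells Z d \<and>
     (\<forall>c \<in> cells Z d. \<exists>s \<psi>.
        cw_complex s \<and> cspace s = closed_disk d \<and> open_disk d \<in> cells s d \<and>
        (\<forall>e \<in> all_cells s. e = open_disk d \<or> e \<subseteq> disk_boundary d) \<and>
        characteristic_map Z d c \<psi> \<and> \<psi> ` topspace (closed_disk d) = closed_cell Z c \<and>
        homeomorphic_on_cells s Z \<psi>)"


section \<open>Finite subdivision rules\<close>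

record 's subdivision_rule =
  base :: "'s cell_complex"
  base_subdivision :: "'s cell_complex"
  ideal_cells :: "'s set set"
  subdivision_map :: "'s \<Rightarrow> 's"

definition finite_subdivision_rule :: "nat \<Rightarrow> 's subdivision_rule \<Rightarrow> bool" where
  "finite_subdivision_rule d R \<longleftrightarrow>
     almost_polyhedral d (base R) \<and>
     cw_complex (base_subdivision R) \<and> finite_complex (base_subdivision R) \<and>
     has_dimension (base_subdivision R) d \<and> subdivision_of (base_subdivision R) (base R) \<and>
     ideal_cells R \<subseteq> all_cells (base R) \<and> closedin (cspace (base R)) (\<Union>(ideal_cells R)) \<and>
     cellular_map (base_subdivision R) (base R) (subdivision_map R) \<and>
     homeomorphic_on_cells (base_subdivision R) (base R) (subdivision_map R) \<and>
     subdivision_map R ` \<Union>(ideal_cells R) \<subseteq> \<Union>(ideal_cells R)"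

definition R_complex ::
    "nat \<Rightarrow> 's subdivision_rule \<Rightarrow> 'x cell_complex \<Rightarrow> ('x \<Rightarrow> 's) \<Rightarrow> bool" where
  "R_complex d R X f \<longleftrightarrow>
     cw_complex X \<and> has_dimension X d \<and> union_of_closed_top_cells X d \<and>
     cellular_map X (base R) f \<and> homeomorphic_on_cells X (base R) f"

text \<open>
  The pulled-back cell structure. Inside an open cell \<open>c\<close> of \<open>X\<close>, on which \<open>f\<close> is injective, its
  cells are the copies of those cells \<open>e\<close> of the subdivided base that lie in the open cell
  \<open>f ` c\<close>.
\<close>

definition subdivide ::
    "'s subdivision_rule \<Rightarrow> 'x cell_complex \<Rightarrow> ('x \<Rightarrow> 's) \<Rightarrow> 'x cell_complex" where
  "subdivide R X f =
     \<lparr>cspace = cspace X,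
      cells = (\<lambda>k. {c \<inter> f -` e | c e. c \<in> all_cells X \<and> e \<in> cells (base_subdivision R) k \<and> e \<subseteq> f ` c})\<rparr>"

definition structure_map :: "'s subdivision_rule \<Rightarrow> ('x \<Rightarrow> 's) \<Rightarrow> nat \<Rightarrow> 'x \<Rightarrow> 's" where
  "structure_map R f n = (subdivision_map R ^^ n) \<circ> f"

primrec iterated_subdivision ::
    "'s subdivision_rule \<Rightarrow> 'x cell_complex \<Rightarrow> ('x \<Rightarrow> 's) \<Rightarrow> nat \<Rightarrow> 'x cell_complex" where
  "iterated_subdivision R X f 0 = X"
| "iterated_subdivision R X f (Suc n) =
     subdivide R (iterated_subdivision R X f n) (structure_map R f n)"


section \<open>The history graph\<close>

text \<open>
  Graphs are simple: an edge is the set of its two endpoints. The record itself does not demand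
  that endpoints belong to \<open>verts\<close>, so it also represents unions of vertices and open edges;
  genuine graphs are singled out by \<open>simple_graph\<close>.
\<close>

record 'v graph =
  verts :: "'v set"
  edges :: "'v set set"

definition simple_graph :: "('v, 'z) graph_scheme \<Rightarrow> bool" where
  "simple_graph G \<longleftrightarrow> (\<forall>e \<in> edges G. e \<subseteq> verts G \<and> card e = 2)"

datatype 'x history_vertex = Origin | Tile nat "'x set"

definition nonideal_tiles ::
    "nat \<Rightarrow> 's subdivision_rule \<Rightarrow> 'x cell_complex \<Rightarrow> ('x \<Rightarrow> 's) \<Rightarrow> nat \<Rightarrow> 'x set set" where
  "nonideal_tiles d R X f n =
     {T \<in> cells (iterated_subdivision R X f n) d. structure_map R f n ` T \<notin> ideal_cells R}"

text \<open>
  Intersections of closed cells are unions of cells, so an intersection has codimension 1 exactly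
  when it contains a cell of dimension \<open>d - 1\<close>.
\<close>

definition meet_in_codim_1 :: "nat \<Rightarrow> 'x cell_complex \<Rightarrow> 'x set \<Rightarrow> 'x set \<Rightarrow> bool" where
  "meet_in_codim_1 d Z T T' \<longleftrightarrow>
     (\<exists>k. d = Suc k \<and> (\<exists>g \<in> cells Z k. g \<subseteq> closed_cell Z T \<inter> closed_cell Z T'))"

definition dual_graph ::
    "nat \<Rightarrow> 's subdivision_rule \<Rightarrow> 'x cell_complex \<Rightarrow> ('x \<Rightarrow> 's) \<Rightarrow> nat \<Rightarrow> 'x history_vertex graph" where
  "dual_graph d R X f n =
     \<lparr>verts = Tile n ` nonideal_tiles d R X f n,
      edges = {{Tile n T, Tile n T'} | T T'.
        T \<in> nonideal_tiles d R X f n \<and> T' \<in> nonideal_tiles d R X f n \<and> T \<noteq> T' \<and>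
        meet_in_codim_1 d (iterated_subdivision R X f n) T T'}\<rparr>"

definition history_graph ::
    "nat \<Rightarrow> 's subdivision_rule \<Rightarrow> 'x cell_complex \<Rightarrow> ('x \<Rightarrow> 's) \<Rightarrow> 'x history_vertex graph" where
  "history_graph d R X f =
     \<lparr>verts = insert Origin (\<Union>n. verts (dual_graph d R X f n)),
      edges =
        (\<Union>n. edges (dual_graph d R X f n)) \<union>
        {{Tile n T, Tile (Suc n) T'} | n T T'.
           T \<in> nonideal_tiles d R X f n \<and> T' \<in> nonideal_tiles d R X f (Suc n) \<and> T' \<subseteq> T} \<union>
        {{Origin, v} | v. v \<in> verts (dual_graph d R X f 0)}\<rparr>"

text \<open>
  The number of non-ideal top-dimensional tiles of \<open>X\<close> around a cell of codimension 1 is bounded.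
  This holds for every finite complex. For infinite \<open>X\<close> it cannot be dispensed with: on a tree
  (\<open>d = 1\<close>) in which every vertex has finite valence but the valences are unbounded, the degrees
  in the history graph take infinitely many values, whereas in a combinatorial subdivision rule
  the degree of a vertex is determined by its label, of which there are finitely many.
\<close>

definition bounded_valence ::
    "nat \<Rightarrow> 's subdivision_rule \<Rightarrow> 'x cell_complex \<Rightarrow> ('x \<Rightarrow> 's) \<Rightarrow> bool" where
  "bounded_valence d R X f \<longleftrightarrow>
     (\<exists>K. \<forall>k. d = Suc k \<longrightarrow> (\<forall>g \<in> cells X k.
        finite {T \<in> nonideal_tiles d R X f 0. g \<subseteq> closed_cell X T} \<and>
        card {T \<in> nonideal_tiles d R X f 0. g \<subseteq> closed_cell X T} \<le> K))"

lemma finite_imp_bounded_valence: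
  assumes "finite_complex X"
  shows "bounded_valence d R X f"
proof -
  have fin: "finite (cells X d)"
    using assms unfolding finite_complex_def all_cells_def
    by (rule finite_subset[rotated]) blast
  have sub: "{T \<in> nonideal_tiles d R X f 0. g \<subseteq> closed_cell X T} \<subseteq> cells X d" for g
    by (auto simp: nonideal_tiles_def)
  show ?thesis
    unfolding bounded_valence_def
    by (intro exI[of _ "card (cells X d)"] allI impI ballI conjI finite_subset[OF sub fin] card_mono[OF fin sub])
qed


section \<open>Combinatorial subdivision rules\<close>

record ('v, 'l, 'm) labeled_graph = "'v graph" +
  vlabel :: "'v \<Rightarrow> 'l"
  elabel :: "'v set \<Rightarrow> 'm"

definition finitely_labeled :: "('v, 'l, 'm) labeled_graph \<Rightarrow> bool" where
  "finitely_labeled G \<longleftrightarrow> finite (vlabel G ` verts G) \<and> finite (elabel G ` edges G)"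

text \<open>
  Isomorphism of labeled graphs in the wide sense (unions of vertices and open edges): an endpoint
  of an edge counts only if it is among the vertices.
\<close>

definition labeled_isomorphic ::
    "('v, 'l, 'm) labeled_graph \<Rightarrow> ('w, 'l, 'm) labeled_graph \<Rightarrow> bool" where
  "labeled_isomorphic G H \<longleftrightarrow>
     (\<exists>p q. bij_betw p (verts G) (verts H) \<and> bij_betw q (edges G) (edges H) \<and>
        (\<forall>v \<in> verts G. \<forall>e \<in> edges G. v \<in> e \<longleftrightarrow> p v \<in> q e) \<and>
        (\<forall>v \<in> verts G. vlabel H (p v) = vlabel G v) \<and>
        (\<forall>e \<in> edges G. elabel H (q e) = elabel G e))"

definition open_edge ::
    "('v, 'l, 'm) labeled_graph \<Rightarrow> 'v set \<Rightarrow> ('v, 'l, 'm) labeled_graph" where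
  "open_edge G e = G\<lparr>verts := {}, edges := {e}\<rparr>"

definition open_star ::
    "('v, 'l, 'm) labeled_graph \<Rightarrow> 'v \<Rightarrow> ('v, 'l, 'm) labeled_graph" where
  "open_star G v = G\<lparr>verts := {v}, edges := {e \<in> edges G. v \<in> e}\<rparr>"

definition predecessor ::
    "('v, 'l, 'm) labeled_graph \<Rightarrow> (nat \<Rightarrow> 'v graph) \<Rightarrow> 'v \<Rightarrow> 'v" where
  "predecessor G L v =
     (if v \<in> verts (L 0) then v
      else THE u. \<exists>n. v \<in> verts (L (Suc n)) \<and> u \<in> verts (L n) \<and> {u, v} \<in> edges G)"

text \<open>
  On an edge the predecessor map \<open>\<pi>\<close> is the image \<open>\<pi> ` e\<close>, which is either a pair or a singleton
  \<open>{u}\<close>; the latter encodes that the edge is sent to the vertex \<open>u\<close>.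
\<close>

definition predecessor_preimage ::
    "('v, 'l, 'm) labeled_graph \<Rightarrow> (nat \<Rightarrow> 'v graph) \<Rightarrow> ('v, 'l, 'm) labeled_graph \<Rightarrow>
     ('v, 'l, 'm) labeled_graph" where
  "predecessor_preimage G L A = G\<lparr>
     verts := {v \<in> verts G. predecessor G L v \<in> verts A},
     edges := {e \<in> edges G. predecessor G L ` e \<in> edges A \<or>
                            (\<exists>u \<in> verts A. predecessor G L ` e = {u})}\<rparr>"

definition combinatorial_subdivision_rule ::
    "('v, 'l, 'm) labeled_graph \<Rightarrow> (nat \<Rightarrow> 'v graph) \<Rightarrow> bool" where
  "combinatorial_subdivision_rule G L \<longleftrightarrow>
     simple_graph G \<and> finitely_labeled G \<and>
     (\<forall>n. simple_graph (L n) \<and> verts (L n) \<subseteq> verts G \<and> edges (L n) \<subseteq> edges G) \<and>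
     (\<forall>m n. m \<noteq> n \<longrightarrow> verts (L m) \<inter> verts (L n) = {}) \<and>
     (\<exists>v. verts (L 0) = {v}) \<and>
     verts G \<subseteq> (\<Union>n. verts (L n)) \<and>
     (\<forall>n. \<forall>v \<in> verts (L (Suc n)). \<exists>!u. u \<in> verts (L n) \<and> {u, v} \<in> edges G) \<and>
     (\<forall>v \<in> verts G. \<forall>w \<in> verts G. vlabel G v = vlabel G w \<longrightarrow>
        labeled_isomorphic (open_star G v) (open_star G w)) \<and>
     (\<forall>e \<in> edges G. predecessor G L ` e \<in> edges G \<or> (\<exists>u \<in> verts G. predecessor G L ` e = {u})) \<and>
     (\<forall>e \<in> edges G. \<forall>e' \<in> edges G. elabel G e = elabel G e' \<longrightarrow>
        labeled_isomorphic (predecessor_preimage G L (open_edge G e))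
                           (predecessor_preimage G L (open_edge G e'))) \<and>
     (\<forall>v \<in> verts G. \<forall>w \<in> verts G. vlabel G v = vlabel G w \<longrightarrow>
        labeled_isomorphic (predecessor_preimage G L (open_star G v))
                           (predecessor_preimage G L (open_star G w)))"

definition with_labels :: "'v graph \<Rightarrow> ('v \<Rightarrow> 'l) \<Rightarrow> ('v set \<Rightarrow> 'm) \<Rightarrow> ('v, 'l, 'm) labeled_graph" where
  "with_labels G vl el = \<lparr>verts = verts G, edges = edges G, vlabel = vl, elabel = el\<rparr>"

end

theory Submission
  imports Defs "HOL-Homology.Invariance_of_Domain"
begin

text \<open>
  Lifting the chart of a tile type gives a developing map from the disk onto every closed tile of
  every \<open>R\<^sup>n(X)\<close>. The lift exists because the closures of the traces of shrinking disk
  neighbourhoods of a boundary point form a nested family with connected finite intersection,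
  hence shrink to a point. Developing maps carry the \<open>(d - 1)\<close>-cells of the disk to \<open>(d - 1)\<close>-cells,
  so the way in which two tiles touch is recorded by their types and by the pairs of
  disk faces with equal image: finitely many values. The record of two tiles determines the
  records of all pairs of their children. Label a vertex by its type, its gluing with itself
  and the number of neighbours for each record, a horizontal edge by its record, and a vertical edge
  by the type of its child. Finiteness needs a bound on the valence that survives subdivision,
  and this holds because a subdivided face is met by only one child from each side.
\<close>

text \<open>The characteristic maps that X comes with bear no relation to the structure map, and
  only the base is almost polyhedral. Hence the tiles of X are parametrised anew by lifts of base
  charts, which give every face of a tile the name of a face of one of finitely many model disks.
  Such a parametrisation is injective on each open cell of the disk, but distinct boundary faces may
  become one face of the tile. Children of one tile can touch through identified faces, which is why
  the gluing of a tile with itself belongs to its label. Tracking codimension 1 alone is enough,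
  because by invariance of domain a (d - 1)-cell of the subdivision lies in an open tile or in an
  old (d - 1)-cell. Likewise a vertex label need not say how the neighbours of a tile touch one
  another: its star and the preimage of that star involve only pairs that contain the tile or one of
  its children.\<close>

no_notation eq_closure_of (\<open>closure'_of\<index>\<close>)

section \<open>Disks\<close>

lemma topspace_closed_disk:
  "topspace (closed_disk k) = {x. (\<forall>i\<ge>k. x i = 0) \<and> (\<Sum>i<k. (x i)\<^sup>2) \<le> 1}"
  by (auto simp: closed_disk_def topspace_Euclidean_space)

text \<open>Leads from the abstract topology to the type-class one, where open and closed sets are
  read off from continuous inequalities.\<close>

lemma closed_disk_eq_top_of_set: "closed_disk k = top_of_set (topspace (closed_disk k))"
  unfolding closed_disk_def Euclidean_space_def euclidean_product_topology
  by (simp add: subtopology_subtopology Int_commute)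

lemma open_disk_eq: "open_disk k = {x. (\<forall>i\<ge>k. x i = 0) \<and> (\<Sum>i<k. (x i)\<^sup>2) < 1}"
  by (auto simp: open_disk_def topspace_Euclidean_space)

lemma disk_boundary_eq: "disk_boundary k = {x. (\<forall>i\<ge>k. x i = 0) \<and> (\<Sum>i<k. (x i)\<^sup>2) = 1}"
  by (auto simp: disk_boundary_def topspace_Euclidean_space)

lemma topspace_closed_disk_Un: "topspace (closed_disk k) = open_disk k \<union> disk_boundary k"
  by (auto simp: topspace_closed_disk open_disk_eq disk_boundary_eq)

lemma open_disk_subset: "open_disk k \<subseteq> topspace (closed_disk k)"
  by (auto simp: topspace_closed_disk_Un)

lemma open_disk_nonempty: "open_disk k \<noteq> {}"
  by (auto simp: open_disk_eq intro!: exI[of _ "\<lambda>_. 0"])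

lemma Hausdorff_closed_disk: "Hausdorff_space (closed_disk k)"
  unfolding closed_disk_def by (intro Hausdorff_space_subtopology Hausdorff_Euclidean_space)

lemma continuous_on_sum_squares: "continuous_on A (\<lambda>x::nat \<Rightarrow> real. \<Sum>i<k. (x i - y i)\<^sup>2)"
  by (intro continuous_intros) (auto intro: continuous_on_product_then_coordinatewise[OF continuous_on_id])

text \<open>The disk is a closed set in a product of intervals over all natural indices, which is
  compact by Tychonoff's theorem.\<close>

lemma compact_topspace_closed_disk: "compact (topspace (closed_disk k))"
proof -
  have sub: "topspace (closed_disk k) \<subseteq> (PiE UNIV (\<lambda>_. {-1..1}))"
  proof
    fix x assume x: "x \<in> topspace (closed_disk k)"
    have "x i \<in> {-1..1}" for i
    proof (cases "i < k")
      case True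
      then have "(x i)\<^sup>2 \<le> (\<Sum>i<k. (x i)\<^sup>2)"
        by (intro member_le_sum) auto
      also have "\<dots> \<le> 1" using x by (simp add: topspace_closed_disk)
      finally show ?thesis by (simp add: abs_square_le_1 abs_le_iff)
    qed (use x in \<open>auto simp: topspace_closed_disk\<close>)
    then show "x \<in> (PiE UNIV (\<lambda>_. {-1..1}))" by auto
  qed
  have "compactin (product_topology (\<lambda>i::nat. euclideanreal) UNIV) (PiE UNIV (\<lambda>_. {-1..1}))"
    by (simp add: compactin_PiE)
  then have c: "compact (PiE UNIV (\<lambda>_::nat. {-1..1::real}))"
    by (simp add: euclidean_product_topology)
  \<comment> \<open>Subtracting 0 only puts the set into the form of
    \<open>continuous_on_sum_squares\<close>.\<close>
  have "topspace (closed_disk k)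
      = {x. \<forall>i\<ge>k. x i = 0} \<inter> {x. (\<Sum>i<k. (x i - 0)\<^sup>2) \<le> 1}"
    by (auto simp: topspace_closed_disk)
  moreover have "closed {x::nat \<Rightarrow> real. \<forall>i\<ge>k. x i = 0}"
    by (intro closed_Collect_all closed_Collect_imp closed_Collect_eq continuous_intros
        continuous_on_product_coordinates) auto
  moreover have "closed {x::nat \<Rightarrow> real. (\<Sum>i<k. (x i - 0)\<^sup>2) \<le> 1}"
    by (intro closed_Collect_le continuous_on_sum_squares continuous_intros)
  ultimately have "closed (topspace (closed_disk k))" by (simp only: closed_Int)
  from compact_Int_closed[OF c this] sub show ?thesis by (simp add: Int_absorb1)
qed

lemma compact_space_closed_disk: "compact_space (closed_disk k)"
  using compact_topspace_closed_disk[of k]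
  by (subst closed_disk_eq_top_of_set) (simp add: compact_space_subtopology)

text \<open>A countable nested neighbourhood base of relative balls. Balls are chosen because their
  traces on the open disk are convex, hence connected, which fails for arbitrary
  neighbourhoods.\<close>

definition disk_nbhd :: "nat \<Rightarrow> (nat \<Rightarrow> real) \<Rightarrow> nat \<Rightarrow> (nat \<Rightarrow> real) set" where
  "disk_nbhd k y n = {x \<in> topspace (closed_disk k). (\<Sum>i<k. (x i - y i)\<^sup>2) < 1 / real (Suc n)}"

lemma disk_nbhd_subset: "disk_nbhd k y n \<subseteq> topspace (closed_disk k)"
  by (auto simp: disk_nbhd_def)

lemma disk_nbhd_mem: "y \<in> topspace (closed_disk k) \<Longrightarrow> y \<in> disk_nbhd k y n"
  by (auto simp: disk_nbhd_def)

lemma disk_nbhd_mono: "m \<le> n \<Longrightarrow> disk_nbhd k y n \<subseteq> disk_nbhd k y m"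
proof -
  assume "m \<le> n"
  then have "1 / real (Suc n) \<le> 1 / real (Suc m)" by (simp add: field_simps)
  then show ?thesis unfolding disk_nbhd_def by force
qed

lemma openin_disk_nbhd: "openin (closed_disk k) (disk_nbhd k y n)"
proof -
  have "open {x::nat \<Rightarrow> real. (\<Sum>i<k. (x i - y i)\<^sup>2) < 1 / real (Suc n)}"
    by (intro open_Collect_less continuous_on_sum_squares continuous_intros)
  then have "openin (top_of_set (topspace (closed_disk k))) (topspace (closed_disk k) \<inter> {x. (\<Sum>i<k. (x i - y i)\<^sup>2) < 1 / real (Suc n)})"
    by blast
  moreover have "topspace (closed_disk k) \<inter> {x. (\<Sum>i<k. (x i - y i)\<^sup>2) < 1 / real (Suc n)} = disk_nbhd k y n"
    by (auto simp: disk_nbhd_def)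
  ultimately show ?thesis
    by (subst closed_disk_eq_top_of_set) simp
qed

text \<open>Otherwise the sets \<open>C n - U\<close> would be nested, closed and nonempty, and
  compactness would give them a common point, contrary to the last assumption.\<close>

lemma compact_nest_subset:
  assumes "compact_space X" "\<And>n. closedin X (C n)" "decseq C" "openin X U" "(\<Inter>n. C n) \<subseteq> U"
  shows "\<exists>n::nat. C n \<subseteq> U"
proof (rule ccontr)
  assume "\<not> ?thesis"
  then have "\<And>n. C n - U \<noteq> {}" by blast
  moreover have "closedin X (C n - U)" for n using assms by (simp add: closedin_diff)
  moreover have "decseq (\<lambda>n. C n - U)" using assms(3) unfolding decseq_def by blast
  ultimately have "(\<Inter>n. C n - U) \<noteq> {}"
    using assms(1) by (intro compact_space_imp_nest)
  then show False using assms(5) by blast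
qed

text \<open>Compactness takes the place of an estimate: the closed balls \<open>C n\<close> shrink
  to \<open>y\<close>, so one of them lies in \<open>U\<close>.\<close>

lemma disk_nbhd_basis:
  assumes U: "openin (closed_disk k) U" and y: "y \<in> U"
  shows "\<exists>n. disk_nbhd k y n \<subseteq> U"
proof -
  define C where "C n = {x \<in> topspace (closed_disk k). (\<Sum>i<k. (x i - y i)\<^sup>2) \<le> 1 / real (Suc n)}" for n
  have cl: "closedin (closed_disk k) (C n)" for n
  proof -
    have "closed {x::nat \<Rightarrow> real. (\<Sum>i<k. (x i - y i)\<^sup>2) \<le> 1 / real (Suc n)}"
      by (intro closed_Collect_le continuous_on_sum_squares continuous_intros)
    then have "closedin (top_of_set (topspace (closed_disk k))) (topspace (closed_disk k) \<inter> {x. (\<Sum>i<k. (x i - y i)\<^sup>2) \<le> 1 / real (Suc n)})"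
      by (rule closedin_closed_Int)
    moreover have "topspace (closed_disk k) \<inter> {x. (\<Sum>i<k. (x i - y i)\<^sup>2) \<le> 1 / real (Suc n)} = C n"
      by (auto simp: C_def)
    ultimately show ?thesis
      by (subst closed_disk_eq_top_of_set) simp
  qed
  have dec: "decseq C"
  proof (rule decseq_SucI)
    fix n
    have "1 / real (Suc (Suc n)) \<le> 1 / real (Suc n)" by (simp add: field_simps)
    then show "C (Suc n) \<subseteq> C n" unfolding C_def by force
  qed
  have "(\<Inter>n. C n) \<subseteq> {y}"
  proof
    fix x assume x: "x \<in> (\<Inter>n. C n)"
    have "(\<Sum>i<k. (x i - y i)\<^sup>2) \<le> 0"
    proof (rule ccontr)
      assume "\<not> ?thesis"
      then obtain n where "inverse (real (Suc n)) < (\<Sum>i<k. (x i - y i)\<^sup>2)"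
        using reals_Archimedean by (metis not_le)
      moreover have "x \<in> C n" using x by blast
      ultimately show False by (auto simp: C_def inverse_eq_divide)
    qed
    then have "(\<Sum>i<k. (x i - y i)\<^sup>2) = 0"
      by (intro antisym sum_nonneg) auto
    then have "\<And>i. i < k \<Longrightarrow> x i = y i" by (subst (asm) sum_nonneg_eq_0_iff) auto
    moreover have "y \<in> topspace (closed_disk k)" using U y openin_subset by blast
    moreover have "x \<in> topspace (closed_disk k)" using x by (auto simp: C_def)
    ultimately have "x i = y i" for i by (cases "i < k") (auto simp: topspace_closed_disk)
    then show "x \<in> {y}" by auto
  qed
  then have "\<exists>n. C n \<subseteq> U"
    using compact_nest_subset[OF compact_space_closed_disk cl dec U] y by blast
  moreover have "disk_nbhd k y n \<subseteq> C n" for n by (auto simp: disk_nbhd_def C_def)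
  ultimately show ?thesis by blast
qed

text \<open>Convexity of the square, summed. The bound \<open>r\<close> is 1 for the open disk and
  \<open>1 / real (Suc n)\<close> for a ball, whose centre is first subtracted from both
  points.\<close>

lemma convex_square_sum:
  fixes a b :: "nat \<Rightarrow> real"
  assumes "(\<Sum>i<k. (a i)\<^sup>2) < r" "(\<Sum>i<k. (b i)\<^sup>2) < r" "0 \<le> s" "s \<le> 1"
  shows "(\<Sum>i<k. ((1 - s) * a i + s * b i)\<^sup>2) < r"
proof -
  have "((1 - s) * p + s * q)\<^sup>2 \<le> (1 - s) * p\<^sup>2 + s * q\<^sup>2" for p q :: real
  proof -
    have "0 \<le> s * (1 - s) * (p - q)\<^sup>2" using assms by simp
    then show ?thesis by (simp add: power2_eq_square algebra_simps)
  qed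
  then have "(\<Sum>i<k. ((1 - s) * a i + s * b i)\<^sup>2) \<le> (\<Sum>i<k. (1 - s) * (a i)\<^sup>2 + s * (b i)\<^sup>2)"
    by (intro sum_mono)
  also have "\<dots> = (1 - s) * (\<Sum>i<k. (a i)\<^sup>2) + s * (\<Sum>i<k. (b i)\<^sup>2)"
    by (simp add: sum.distrib sum_distrib_left)
  also have "\<dots> < r"
    using assms convex_bound_lt[of "\<Sum>i<k. (a i)\<^sup>2" r "\<Sum>i<k. (b i)\<^sup>2" "1-s" s] by simp
  finally show ?thesis .
qed

section \<open>Connectedness and density in the disk\<close>

lemma pathin_segment:
  assumes "\<And>s. 0 \<le> s \<Longrightarrow> s \<le> 1 \<Longrightarrow> (\<lambda>i. (1 - s) * a i + s * b i) \<in> topspace (closed_disk k)"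
  shows "pathin (closed_disk k) (\<lambda>s i. (1 - s) * a i + s * b i)"
proof -
  have "continuous_on {0..1} (\<lambda>s::real. (\<lambda>i. (1 - s) * a i + s * b i))"
    by (intro continuous_on_coordinatewise_then_product continuous_intros)
  then show ?thesis
    unfolding pathin_def using assms
    by (subst closed_disk_eq_top_of_set) (auto simp: continuous_map_in_subtopology)
qed

lemma connectedin_disk_convex:
  assumes sub: "A \<subseteq> topspace (closed_disk k)"
    and conv: "\<And>a b s. a \<in> A \<Longrightarrow> b \<in> A \<Longrightarrow> 0 \<le> s \<Longrightarrow> s \<le> 1 \<Longrightarrow> (\<lambda>i. (1 - s) * a i + s * b i) \<in> A"
  shows "connectedin (closed_disk k) A"
proof (cases "A = {}")
  case False
  then obtain a where a: "a \<in> A" by blast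
  define P where "P b = (\<lambda>s i. (1 - s) * a i + s * b i) ` {0..1::real}" for b
  have P: "connectedin (closed_disk k) (P b)" if "b \<in> A" for b
    unfolding P_def using conv[OF a that] sub by (intro connectedin_path_image pathin_segment) blast
  have aP: "a \<in> P b" for b
    unfolding P_def by (rule image_eqI[of _ _ 0]) auto
  have bP: "b \<in> P b" for b
    unfolding P_def by (rule image_eqI[of _ _ 1]) auto
  have "P b \<subseteq> A" if "b \<in> A" for b
    unfolding P_def using conv[OF a that] by auto
  then have "A = \<Union>(P ` A)" using bP by blast
  moreover have "connectedin (closed_disk k) (\<Union>(P ` A))"
    using P aP by (intro connectedin_Union) blast+
  ultimately show ?thesis by simp
qed simp

lemma connectedin_disk_nbhd_Int: "connectedin (closed_disk k) (disk_nbhd k y n \<inter> open_disk k)"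
proof (rule connectedin_disk_convex)
  fix a b s assume A: "a \<in> disk_nbhd k y n \<inter> open_disk k" "b \<in> disk_nbhd k y n \<inter> open_disk k" "0 \<le> s" "s \<le> (1::real)"
  let ?c = "\<lambda>i. (1 - s) * a i + s * b i"
  have "?c i - y i = (1 - s) * (a i - y i) + s * (b i - y i)" for i by (simp add: algebra_simps)
  then have "(\<Sum>i<k. (?c i - y i)\<^sup>2) < 1 / real (Suc n)"
    using convex_square_sum[where k = k and a = "\<lambda>i. a i - y i" and r = "1 / real (Suc n)" and b = "\<lambda>i. b i - y i" and s = s] A
    by (simp add: disk_nbhd_def)
  moreover have "(\<Sum>i<k. (?c i)\<^sup>2) < 1"
    using convex_square_sum[where k = k and a = a and r = 1 and b = b and s = s] A by (simp add: open_disk_eq)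
  ultimately show "?c \<in> disk_nbhd k y n \<inter> open_disk k"
    using A by (auto simp: disk_nbhd_def open_disk_eq topspace_closed_disk)
qed (auto simp: disk_nbhd_def)

lemma connectedin_open_disk: "connectedin (closed_disk k) (open_disk k)"
proof (rule connectedin_disk_convex)
  fix a b s assume A: "a \<in> open_disk k" "b \<in> open_disk k" "0 \<le> s" "s \<le> (1::real)"
  then show "(\<lambda>i. (1 - s) * a i + s * b i) \<in> open_disk k"
    using convex_square_sum[where k = k and a = a and r = 1 and b = b and s = s] by (simp add: open_disk_eq)
qed (rule open_disk_subset)

text \<open>A point \<open>y\<close> is the value at \<open>s = 0\<close> of the path with
  coordinates \<open>(1 - s) * y i\<close>, which runs in the open disk for positive
  \<open>s\<close>.\<close>

lemma closure_of_open_disk: "closed_disk k closure_of open_disk k = topspace (closed_disk k)"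
proof -
  have "y \<in> closed_disk k closure_of open_disk k" if y: "y \<in> topspace (closed_disk k)" for y
  proof -
    define g where "g = (\<lambda>s i. (1 - s) * y i)"
    have le: "(\<Sum>i<k. ((1 - s) * y i)\<^sup>2) \<le> (1 - s)\<^sup>2" for s
    proof -
      have "(\<Sum>i<k. ((1 - s) * y i)\<^sup>2) = (1 - s)\<^sup>2 * (\<Sum>i<k. (y i)\<^sup>2)"
        by (simp add: power_mult_distrib sum_distrib_left)
      then show ?thesis using y by (simp add: topspace_closed_disk mult_left_le)
    qed
    have 1: "(\<lambda>i. (1 - s) * y i) \<in> topspace (closed_disk k)" if "0 \<le> s" "s \<le> 1" for s
      using le[of s] y that by (auto simp: topspace_closed_disk intro: order_trans[OF _ power_le_one])
    have 2: "g s \<in> open_disk k" if "0 < s" "s \<le> 1" for s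
    proof -
      have "(1 - s)\<^sup>2 < 1" using that by (auto simp: power_less_one_iff)
      then show ?thesis using le[of s] y by (auto simp: topspace_closed_disk open_disk_eq g_def)
    qed
    have g: "continuous_map (top_of_set {0..1}) (closed_disk k) g"
      using pathin_segment[of y "\<lambda>_. 0" k] 1 unfolding pathin_def g_def by simp
    have "0 \<in> top_of_set {0..1::real} closure_of {0<..1}"
      by (simp add: closure_of_subtopology Int_absorb1 Int_absorb2 subset_iff)
    then have "g 0 \<in> closed_disk k closure_of (g ` {0<..1})"
      using continuous_map_image_closure_subset[OF g] by blast
    moreover have "closed_disk k closure_of (g ` {0<..1}) \<subseteq> closed_disk k closure_of open_disk k"
      using 2 by (intro closure_of_mono) auto
    moreover have "g 0 = y" by (simp add: g_def)
    ultimately show ?thesis by auto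
  qed
  then show ?thesis using closure_of_subset_topspace[of "closed_disk k"] by blast
qed

lemma disk_nbhd_Int_nonempty:
  assumes "y \<in> topspace (closed_disk k)"
  shows "disk_nbhd k y n \<inter> open_disk k \<noteq> {}"
proof -
  have "y \<in> closed_disk k closure_of open_disk k" using assms by (simp add: closure_of_open_disk)
  then show ?thesis
    using openin_disk_nbhd[of k y n] disk_nbhd_mem[OF assms, of n] by (auto simp: in_closure_of)
qed

text \<open>If \<open>k < j\<close>, then \<open>f\<close> may be read as a map into j-space. There
  its image is open by invariance of domain, and yet it lies in the hyperplane on which coordinate
  \<open>k\<close> vanishes.\<close>

lemma no_embedding_open_disk:
  assumes f: "continuous_map (subtopology (closed_disk j) (open_disk j)) (Euclidean_space k) f"
    and inj: "inj_on f (open_disk j)"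
  shows "j \<le> k"
proof (rule ccontr)
  assume "\<not> j \<le> k"
  then have kj: "k < j" by simp
  define U where "U = open_disk j"
  have U: "openin (Euclidean_space j) U"
  proof -
    have "open {x::nat \<Rightarrow> real. (\<Sum>i<j. (x i - 0)\<^sup>2) < 1}"
      by (intro open_Collect_less continuous_on_sum_squares continuous_intros)
    then have "openin (Euclidean_space j) (topspace (Euclidean_space j) \<inter> {x. (\<Sum>i<j. (x i - 0)\<^sup>2) < 1})"
      unfolding Euclidean_space_def euclidean_product_topology by (auto simp: openin_open)
    moreover have "topspace (Euclidean_space j) \<inter> {x. (\<Sum>i<j. (x i - 0)\<^sup>2) < 1} = U"
      by (auto simp: open_disk_eq topspace_Euclidean_space U_def)
    ultimately show ?thesis by simp
  qed
  have eq: "subtopology (closed_disk j) (open_disk j) = subtopology (Euclidean_space j) U"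
    unfolding closed_disk_def subtopology_subtopology U_def
    by (rule arg_cong[where f = "subtopology _"]) (auto simp: open_disk_eq)
  have "continuous_map (Euclidean_space k) (Euclidean_space j) id"
    using kj unfolding Euclidean_space_def
    by (auto simp: continuous_map_in_subtopology continuous_map_from_subtopology)
  then have "continuous_map (subtopology (Euclidean_space j) U) (Euclidean_space j) f"
    using f unfolding eq by (metis continuous_map_compose id_comp)
  then have op: "openin (Euclidean_space j) (f ` U)"
    using invariance_of_domain_Euclidean_space[OF U] inj U_def by blast
  obtain u where u: "u \<in> U" using open_disk_nonempty U_def by blast
  have fk: "f x k = 0" if "x \<in> U" for x
    using continuous_map_image_subset_topspace[OF f] that openin_subset[OF U] kj
    unfolding topspace_Euclidean_space eq by (auto simp: topspace_Euclidean_space)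
  \<comment> \<open>The line through \<open>f u\<close> in the direction of coordinate
    \<open>k\<close>; it stays in the open image for small \<open>s\<close>, although its coordinate
    \<open>k\<close> is \<open>s\<close>.\<close>
  define g where "g = (\<lambda>(s::real) i. if i < j then (if i = k then s else f u i) else 0)"
  have "continuous_map euclideanreal (Euclidean_space j) g"
    unfolding g_def continuous_map_componentwise_Euclidean_space by auto
  then have "openin euclideanreal {s \<in> topspace euclideanreal. g s \<in> f ` U}"
    using op by (rule openin_continuous_map_preimage)
  then have o: "open {s. g s \<in> f ` U}" by simp
  have "f u \<in> topspace (Euclidean_space j)" using op u openin_subset by blast
  then have "g 0 = f u"
    using fk[OF u] by (auto simp: g_def topspace_Euclidean_space)
  then have "0 \<in> {s. g s \<in> f ` U}" using u by auto
  then obtain e where e: "e > 0" "ball 0 e \<subseteq> {s. g s \<in> f ` U}"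
    using o open_contains_ball by blast
  then have "e / 2 \<in> {s. g s \<in> f ` U}" by (auto simp: subset_iff)
  then have "g (e / 2) k = 0" using fk by auto
  then show False using e kj by (simp add: g_def)
qed

section \<open>Nested connected sets\<close>

text \<open>Two distinct points would split the finite intersection into two disjoint compact parts.
  Separate these by open sets \<open>U\<close> and \<open>V\<close>: by compactness some
  \<open>C n\<close> lies in their union, and it meets both, so it is disconnected.\<close>

lemma nested_connected_unique:
  assumes comp: "compact_space Y" and haus: "Hausdorff_space Y"
    and conn: "\<And>n::nat. connectedin Y (C n)" and dec: "decseq C"
    and fin: "finite (\<Inter>n. Y closure_of C n)"
    and x: "x \<in> (\<Inter>n. Y closure_of C n)" and y: "y \<in> (\<Inter>n. Y closure_of C n)"
  shows "x = y"
proof (rule ccontr)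
  assume ne: "x \<noteq> y"
  let ?K = "\<Inter>n. Y closure_of C n"
  have KY: "?K \<subseteq> topspace Y" using closure_of_subset_topspace[of Y "C 0"] by blast
  have "compactin Y {x}" "compactin Y (?K - {x})"
    using fin KY x by (auto intro!: finite_imp_compactin)
  moreover have "disjnt {x} (?K - {x})" by simp
  ultimately obtain U V where UV: "openin Y U" "openin Y V" "{x} \<subseteq> U" "?K - {x} \<subseteq> V" "disjnt U V"
    using haus[unfolded Hausdorff_space_compact_sets, rule_format, of "{x}" "?K - {x}"] by blast
  have "decseq (\<lambda>n. Y closure_of C n)"
    using dec unfolding decseq_def by (simp add: closure_of_mono)
  moreover have "openin Y (U \<union> V)" using UV by blast
  moreover have "?K \<subseteq> U \<union> V" using UV by blast
  ultimately obtain n where n: "Y closure_of C n \<subseteq> U \<union> V"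
    using compact_nest_subset[OF comp, of "\<lambda>n. Y closure_of C n" "U \<union> V"] by auto
  have "C n \<subseteq> U \<union> V"
    using n closure_of_subset[OF connectedin_subset_topspace[OF conn[of n]]] by blast
  moreover have "U \<inter> C n \<noteq> {}"
  proof -
    have "x \<in> U" "x \<in> Y closure_of C n" using x UV by auto
    then show ?thesis using UV by (auto simp: in_closure_of)
  qed
  moreover have "V \<inter> C n \<noteq> {}"
  proof -
    have "y \<in> V" "y \<in> Y closure_of C n" using y ne UV by auto
    then show ?thesis using UV by (auto simp: in_closure_of)
  qed
  ultimately show False
    using connectedinD[OF conn UV(1,2)] UV(5) by (auto simp: disjnt_def)
qed

text \<open>Continuity in terms of nested closures: an open set around \<open>\<psi> y\<close> that
  avoids a neighbourhood of \<open>z\<close> contains the image of some member of the base at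
  \<open>y\<close>.\<close>

lemma Inter_images_disk_nbhd:
  assumes psi: "continuous_map (closed_disk d) S \<psi>" and haus: "Hausdorff_space S"
    and y: "y \<in> topspace (closed_disk d)"
    and z: "\<And>n. z \<in> S closure_of (\<psi> ` disk_nbhd d y n)"
  shows "z = \<psi> y"
proof (rule ccontr)
  assume ne: "z \<noteq> \<psi> y"
  have "z \<in> topspace S" using z[of 0] by (simp add: in_closure_of)
  moreover have "\<psi> y \<in> topspace S"
    using psi y continuous_map_image_subset_topspace by blast
  ultimately obtain U V where UV: "openin S U" "openin S V" "z \<in> U" "\<psi> y \<in> V" "disjnt U V"
    using haus ne unfolding Hausdorff_space_def by metis
  have "openin (closed_disk d) {x \<in> topspace (closed_disk d). \<psi> x \<in> V}"
    using psi UV openin_continuous_map_preimage by blast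
  then obtain n where "disk_nbhd d y n \<subseteq> {x \<in> topspace (closed_disk d). \<psi> x \<in> V}"
    using disk_nbhd_basis y UV by (metis (no_types, lifting) mem_Collect_eq)
  then have "\<psi> ` disk_nbhd d y n \<subseteq> V" by blast
  moreover have "U \<inter> \<psi> ` disk_nbhd d y n \<noteq> {}"
    using z[of n] UV by (auto simp: in_closure_of)
  ultimately show False using UV by (auto simp: disjnt_def)
qed

section \<open>Lifting characteristic maps\<close>

text \<open>Over the open disk the lift is forced, since \<open>p\<close> is invertible on
  \<open>W\<close>. At a boundary point its cluster set lies in one finite fibre of \<open>p\<close>
  and is a nested intersection of closures of connected sets, hence a single point.\<close>

lemma lift_disk_map:
  assumes compY: "compact_space Y" and hausY: "Hausdorff_space Y" and WY: "W \<subseteq> topspace Y"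
    and p: "continuous_map Y S p"
    and pW: "homeomorphic_map (subtopology Y W) (subtopology S t) p"
    and psi: "continuous_map (closed_disk d) S \<psi>"
    and psit: "homeomorphic_map (subtopology (closed_disk d) (open_disk d)) (subtopology S t) \<psi>"
    and hausS: "Hausdorff_space S"
    and fin: "\<And>x. finite {z \<in> topspace Y. p z = x}"
  shows "\<exists>k. continuous_map (closed_disk d) Y k \<and> (\<forall>x \<in> topspace (closed_disk d). p (k x) = \<psi> x) \<and>
    homeomorphic_map (subtopology (closed_disk d) (open_disk d)) (subtopology Y W) k"
proof -
  let ?D = "topspace (closed_disk d)" and ?I = "open_disk d"
  have topI: "topspace (subtopology (closed_disk d) ?I) = ?I"
    using open_disk_subset by auto
  obtain q where q: "homeomorphic_maps (subtopology Y W) (subtopology S t) p q"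
    using pW homeomorphic_map_maps by blast
  define h where "h = q \<circ> \<psi>"
  have hh: "homeomorphic_map (subtopology (closed_disk d) ?I) (subtopology Y W) h"
    unfolding h_def using psit q homeomorphic_map_compose homeomorphic_maps_map homeomorphic_maps_sym
    by metis
  have hW: "h x \<in> W" if "x \<in> ?I" for x
    using homeomorphic_imp_surjective_map[OF hh] that WY topI by auto
  have ph: "p (h x) = \<psi> x" if "x \<in> ?I" for x
  proof -
    have "\<psi> x \<in> topspace (subtopology S t)"
      using homeomorphic_imp_surjective_map[OF psit] that topI by blast
    then show ?thesis using q unfolding homeomorphic_maps_def h_def by simp
  qed
  define C where "C y n = h ` (disk_nbhd d y n \<inter> ?I)" for y n
  \<comment> \<open>The cluster set of \<open>h\<close> at \<open>y\<close>: every value that a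
    continuous extension could take there.\<close>
  define K where "K y = (\<Inter>n. Y closure_of C y n)" for y
  have conth: "continuous_map (subtopology (closed_disk d) ?I) Y h"
    using homeomorphic_imp_continuous_map[OF hh] continuous_map_in_subtopology by blast
  have conn: "connectedin Y (C y n)" for y n
    unfolding C_def using connectedin_disk_nbhd_Int
    by (intro connectedin_continuous_map_image[OF conth]) (simp add: connectedin_subtopology)
  have CY: "C y n \<subseteq> topspace Y" for y n using conn connectedin_subset_topspace by blast
  have Cmono: "C y' m \<subseteq> C y n" if "disk_nbhd d y' m \<subseteq> disk_nbhd d y n" for y y' m n
    using that by (auto simp: C_def)
  have dec: "decseq (C y)" for y
    unfolding decseq_def using disk_nbhd_mono Cmono by blast
  have decc: "decseq (\<lambda>n. Y closure_of C y n)" for y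
    using dec unfolding decseq_def by (simp add: closure_of_mono)
  have pK: "p z = \<psi> y" if "z \<in> K y" "y \<in> ?D" for y z
  proof (rule Inter_images_disk_nbhd[OF psi hausS that(2)])
    fix n
    have "z \<in> Y closure_of C y n" using that K_def by blast
    then have "p z \<in> S closure_of (p ` C y n)"
      using continuous_map_image_closure_subset[OF p] by blast
    moreover have "p ` C y n \<subseteq> \<psi> ` disk_nbhd d y n"
      using ph by (auto simp: C_def)
    ultimately show "p z \<in> S closure_of (\<psi> ` disk_nbhd d y n)"
      using closure_of_mono by blast
  qed
  have KY: "K y \<subseteq> topspace Y" for y
    unfolding K_def using closure_of_subset_topspace[of Y "C y 0"] by blast
  have finK: "finite (K y)" if "y \<in> ?D" for y
    by (rule finite_subset[OF _ fin[of "\<psi> y"]]) (use pK that KY in blast)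
  have Kne: "K y \<noteq> {}" if "y \<in> ?D" for y
    unfolding K_def
  proof (rule compact_space_imp_nest[OF compY _ _ decc])
    fix n
    have "C y n \<noteq> {}" using disk_nbhd_Int_nonempty[OF that] by (auto simp: C_def)
    then show "Y closure_of C y n \<noteq> {}" using closure_of_subset[OF CY] by blast
  qed auto
  have Kuniq: "z = z'" if "z \<in> K y" "z' \<in> K y" "y \<in> ?D" for y z z'
    using nested_connected_unique[OF compY hausY conn dec] finK that unfolding K_def by blast
  define k where "k y = (SOME z. z \<in> K y)" for y
  have kK: "k y \<in> K y" if "y \<in> ?D" for y
    unfolding k_def using Kne[OF that] by (metis ex_in_conv someI)
  have kI: "k y = h y" if "y \<in> ?I" for y
  proof -
    have yD: "y \<in> ?D" using that open_disk_subset by blast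
    have "h y \<in> C y n" for n using disk_nbhd_mem[OF yD] that by (auto simp: C_def)
    then have "h y \<in> K y" unfolding K_def using closure_of_subset[OF CY] by blast
    then show ?thesis using Kuniq[OF kK] yD by blast
  qed
  have "continuous_map (closed_disk d) Y k"
    unfolding continuous_map_def
  proof (intro conjI allI impI)
    show "k \<in> ?D \<rightarrow> topspace Y" using kK KY by blast
  next
    fix U assume U: "openin Y U"
    show "openin (closed_disk d) {x \<in> ?D. k x \<in> U}"
    proof (subst openin_subopen, intro ballI)
      fix y assume y: "y \<in> {x \<in> ?D. k x \<in> U}"
      \<comment> \<open>Once the closure of the trace at stage \<open>n\<close> lies in
        \<open>U\<close>, so do the cluster sets of all points of the neighbourhood at stage
        \<open>n\<close>, since each of them has a smaller neighbourhood inside it.\<close>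
      have "K y \<subseteq> U" using Kuniq kK y by blast
      then obtain n where n: "Y closure_of C y n \<subseteq> U"
        using compact_nest_subset[OF compY closedin_closure_of decc U] unfolding K_def by blast
      have "disk_nbhd d y n \<subseteq> {x \<in> ?D. k x \<in> U}"
      proof
        fix y' assume y': "y' \<in> disk_nbhd d y n"
        then have D: "y' \<in> ?D" using disk_nbhd_subset by blast
        obtain m where "disk_nbhd d y' m \<subseteq> disk_nbhd d y n"
          using disk_nbhd_basis[OF openin_disk_nbhd y'] by blast
        then have "Y closure_of C y' m \<subseteq> U"
          using n closure_of_mono[OF Cmono] by blast
        then show "y' \<in> {x \<in> ?D. k x \<in> U}" using kK[OF D] D by (auto simp: K_def)
      qed
      then show "\<exists>T. openin (closed_disk d) T \<and> y \<in> T \<and> T \<subseteq> {x \<in> ?D. k x \<in> U}"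
        using openin_disk_nbhd[of d y n] disk_nbhd_mem[of y d n] y
        by (intro exI[of _ "disk_nbhd d y n"]) simp
    qed
  qed
  moreover have "\<forall>x \<in> ?D. p (k x) = \<psi> x" using pK kK by blast
  moreover have "homeomorphic_map (subtopology (closed_disk d) (open_disk d)) (subtopology Y W) k"
    by (rule homeomorphic_map_eq[OF hh]) (use kI topI in auto)
  ultimately show ?thesis by blast
qed

text \<open>Near \<open>y\<close> the open disk belongs entirely to \<open>W\<close>, so the
  preimage of a small trace is homeomorphic to the trace and thus connected. Every point over
  \<open>y\<close> lies in the closures of all these preimages, whose intersection is finite, so
  there is only one.\<close>

lemma boundary_lift_unique:
  assumes eta: "continuous_map (closed_disk d) (closed_disk d) \<eta>"
    and etaI: "homeomorphic_map (subtopology (closed_disk d) (open_disk d)) (subtopology (closed_disk d) W) \<eta>"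
    and W: "W \<subseteq> open_disk d" and nb: "disk_nbhd d y N \<inter> open_disk d \<subseteq> W"
    and fin: "finite {z \<in> topspace (closed_disk d). \<eta> z = y}"
    and y1: "y1 \<in> topspace (closed_disk d)" "\<eta> y1 = y"
    and y2: "y2 \<in> topspace (closed_disk d)" "\<eta> y2 = y"
  shows "y1 = y2"
proof -
  let ?D = "topspace (closed_disk d)" and ?I = "open_disk d"
  have topI: "topspace (subtopology (closed_disk d) ?I) = ?I"
    using open_disk_subset by auto
  have topW: "topspace (subtopology (closed_disk d) W) = W"
    using open_disk_subset W by auto
  obtain q where q: "homeomorphic_maps (subtopology (closed_disk d) ?I) (subtopology (closed_disk d) W) \<eta> q"
    using etaI homeomorphic_map_maps by blast
  \<comment> \<open>Starting at index \<open>N\<close> keeps every trace inside \<open>W\<close>,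
    where the inverse \<open>q\<close> is available.\<close>
  define A where "A n = disk_nbhd d y (N + n) \<inter> ?I" for n
  have AW: "A n \<subseteq> W" for n
    using nb disk_nbhd_mono[of N "N + n"] by (auto simp: A_def)
  define C where "C n = {z \<in> ?I. \<eta> z \<in> disk_nbhd d y (N + n)}" for n
  have etaW: "\<eta> z \<in> W" if "z \<in> ?I" for z
    using homeomorphic_imp_surjective_map[OF etaI] topI topW that by blast
  have CA: "C n = q ` A n" for n
  proof
    show "C n \<subseteq> q ` A n"
    proof
      fix z assume "z \<in> C n"
      then have "\<eta> z \<in> A n" "q (\<eta> z) = z"
        using etaW W q topI by (auto simp: C_def A_def homeomorphic_maps_def)
      then show "z \<in> q ` A n" by force
    qed
    show "q ` A n \<subseteq> C n"
    proof
      fix z assume "z \<in> q ` A n"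
      then obtain a where a: "a \<in> A n" "z = q a" by blast
      then have aW: "a \<in> W" using AW by blast
      have "\<eta> (q a) = a" using q aW topW unfolding homeomorphic_maps_def by blast
      moreover have "q a \<in> ?I"
        using q aW topW topI unfolding homeomorphic_maps_def continuous_map_def by blast
      ultimately show "z \<in> C n" using a by (auto simp: C_def A_def)
    qed
  qed
  have contq: "continuous_map (subtopology (closed_disk d) W) (closed_disk d) q"
    using q unfolding homeomorphic_maps_def continuous_map_in_subtopology by blast
  have conn: "connectedin (closed_disk d) (C n)" for n
    unfolding CA
    by (rule connectedin_continuous_map_image[OF contq])
      (use AW connectedin_disk_nbhd_Int in \<open>simp add: connectedin_subtopology A_def\<close>)
  have dec: "decseq C"
    unfolding decseq_def C_def using disk_nbhd_mono[of "N + _" "N + _"] by fastforce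
  have mem: "x \<in> (\<Inter>n. closed_disk d closure_of C n)" if x: "x \<in> ?D" "\<eta> x = y" for x
  proof (intro INT_I)
    fix n
    show "x \<in> closed_disk d closure_of C n"
      unfolding in_closure_of
    proof (intro conjI allI impI)
      fix T assume T: "x \<in> T \<and> openin (closed_disk d) T"
      let ?V = "{z \<in> ?D. \<eta> z \<in> disk_nbhd d y (N + n)}"
      have yD: "y \<in> ?D" using x eta continuous_map_image_subset_topspace by blast
      have V: "openin (closed_disk d) ?V"
        by (rule openin_continuous_map_preimage[OF eta openin_disk_nbhd])
      have "openin (closed_disk d) (T \<inter> ?V)" using T V by (simp add: openin_Int)
      moreover have "x \<in> T \<inter> ?V" using T x disk_nbhd_mem[OF yD] by simp
      moreover have "x \<in> closed_disk d closure_of ?I" using x closure_of_open_disk[of d] by simp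
      ultimately have "?I \<inter> (T \<inter> ?V) \<noteq> {}"
        using openin_Int_closure_of_eq_empty[of "closed_disk d" "T \<inter> ?V" ?I] by auto
      then obtain z where "z \<in> ?I" "z \<in> T \<inter> ?V" by blast
      then show "\<exists>z. z \<in> C n \<and> z \<in> T" by (auto simp: C_def)
    qed (use x in auto)
  qed
  have "finite (\<Inter>n. closed_disk d closure_of C n)"
  proof (rule finite_subset[OF _ fin], rule subsetI)
    fix x assume x: "x \<in> (\<Inter>n. closed_disk d closure_of C n)"
    then have xD: "x \<in> ?D" using closure_of_subset_topspace[of "closed_disk d" "C 0"] by blast
    have yD: "y \<in> ?D" using y1 eta continuous_map_image_subset_topspace by blast
    have "\<eta> x = id y"
    proof (rule Inter_images_disk_nbhd[OF continuous_map_id Hausdorff_closed_disk yD])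
      fix n
      have "\<eta> x \<in> closed_disk d closure_of (\<eta> ` C n)"
        using continuous_map_image_closure_subset[OF eta] x by blast
      moreover have "\<eta> ` C n \<subseteq> id ` disk_nbhd d y n"
        using disk_nbhd_mono[of n "N + n"] by (auto simp: C_def)
      ultimately show "\<eta> x \<in> closed_disk d closure_of (id ` disk_nbhd d y n)"
        using closure_of_mono by blast
    qed
    then show "x \<in> {z \<in> ?D. \<eta> z = y}" using xD by simp
  qed
  then show ?thesis
    using nested_connected_unique[OF compact_space_closed_disk Hausdorff_closed_disk conn dec _ mem[OF y1] mem[OF y2]]
    by simp
qed

section \<open>CW complexes\<close>

lemma homeomorphic_map_cells:
  assumes "homeomorphic_map (subtopology Y c) (subtopology Z e) f" "c \<subseteq> topspace Y" "e \<subseteq> topspace Z"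
  shows "f ` c = e" "inj_on f c"
  using homeomorphic_imp_surjective_map[OF assms(1)] homeomorphic_imp_injective_map[OF assms(1)] assms(2,3)
  by (auto simp: Int_absorb1)

section \<open>Closures of cells and connected sets in CW complexes\<close>

context
  fixes Z :: "'a cell_complex"
  assumes cw: "cw_complex Z"
begin

lemma cw_Hausdorff: "Hausdorff_space (cspace Z)"
  and cw_topspace: "topspace (cspace Z) = \<Union>(all_cells Z)"
  and cw_charmap: "c \<in> cells Z k \<Longrightarrow> \<exists>\<psi>. characteristic_map Z k c \<psi>"
  using cw unfolding cw_complex_def by simp_all

lemma cw_disjoint:
  assumes "c \<in> cells Z k" "e \<in> cells Z l" "x \<in> c" "x \<in> e"
  shows "k = l \<and> c = e"
proof -
  have "\<forall>k l. \<forall>c \<in> cells Z k. \<forall>e \<in> cells Z l. c \<inter> e \<noteq> {} \<longrightarrow> k = l \<and> c = e"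
    using cw unfolding cw_complex_def by simp
  then show ?thesis using assms by blast
qed

lemma cw_cell_subset: "c \<in> cells Z k \<Longrightarrow> c \<subseteq> topspace (cspace Z)"
  unfolding cw_topspace all_cells_def by blast

lemma cw_cell_cover: "x \<in> topspace (cspace Z) \<Longrightarrow> \<exists>k. \<exists>c \<in> cells Z k. x \<in> c"
  unfolding cw_topspace all_cells_def by blast

lemma charmap_image:
  assumes "characteristic_map Z k c \<psi>" "c \<in> cells Z k"
  shows "\<psi> ` open_disk k = c" "inj_on \<psi> (open_disk k)"
proof -
  have "homeomorphic_map (subtopology (closed_disk k) (open_disk k)) (subtopology (cspace Z) c) \<psi>"
    using assms(1) by (simp add: characteristic_map_def)
  from homeomorphic_map_cells[OF this open_disk_subset cw_cell_subset[OF assms(2)]]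
  show "\<psi> ` open_disk k = c" "inj_on \<psi> (open_disk k)" .
qed

lemma cw_cell_connected:
  assumes c: "c \<in> cells Z k"
  shows "connectedin (cspace Z) c" "c \<noteq> {}"
proof -
  obtain \<psi> where psi: "characteristic_map Z k c \<psi>" using cw_charmap c by blast
  have im: "\<psi> ` open_disk k = c" by (rule charmap_image(1)[OF psi c])
  have "continuous_map (closed_disk k) (cspace Z) \<psi>" using psi by (simp add: characteristic_map_def)
  from connectedin_continuous_map_image[OF this connectedin_open_disk]
  show "connectedin (cspace Z) c" by (simp add: im)
  show "c \<noteq> {}" using open_disk_nonempty[of k] im by auto
qed

text \<open>In a Hausdorff space the compact image of the disk under the characteristic map is
  closed, so it contains the closure of \<open>c\<close>; the cells in \<open>F\<close> cover its
  boundary part.\<close>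

lemma cw_closure_cell:
  assumes c: "c \<in> cells Z k"
  shows "\<exists>F. finite F \<and> F \<subseteq> (\<Union>j<k. cells Z j) \<and> closed_cell Z c \<subseteq> c \<union> \<Union>F"
    and "compactin (cspace Z) (closed_cell Z c)"
proof -
  obtain \<psi> where psi: "characteristic_map Z k c \<psi>" using cw_charmap c by blast
  then obtain F where F: "finite F" "F \<subseteq> (\<Union>j<k. cells Z j)" "\<psi> ` disk_boundary k \<subseteq> \<Union>F"
    unfolding characteristic_map_def by blast
  have im: "\<psi> ` open_disk k = c" by (rule charmap_image(1)[OF psi c])
  let ?P = "\<psi> ` topspace (closed_disk k)"
  have comp: "compactin (cspace Z) ?P"
    using psi compact_space_closed_disk[of k] unfolding characteristic_map_def compact_space_def
    by (simp add: image_compactin)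
  have clo: "closedin (cspace Z) ?P"
    by (rule compactin_imp_closedin[OF cw_Hausdorff comp])
  have sub: "closed_cell Z c \<subseteq> ?P"
    unfolding closed_cell_def using clo im open_disk_subset[of k] by (intro closure_of_minimal) auto
  have "?P \<subseteq> c \<union> \<Union>F"
    unfolding topspace_closed_disk_Un image_Un im using F(3) by blast
  with sub have "closed_cell Z c \<subseteq> c \<union> \<Union>F" by (rule order_trans)
  with F(1,2) show "\<exists>F. finite F \<and> F \<subseteq> (\<Union>j<k. cells Z j) \<and> closed_cell Z c \<subseteq> c \<union> \<Union>F"
    by (intro exI[of _ F]) simp
  show "compactin (cspace Z) (closed_cell Z c)"
    using closed_compactin[OF comp sub] by (simp add: closed_cell_def)
qed

lemma cw_cell_subset_closed: "c \<in> cells Z k \<Longrightarrow> c \<subseteq> closed_cell Z c"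
  unfolding closed_cell_def using cw_cell_subset by (simp add: closure_of_subset)

lemma cw_closure_meets:
  assumes "c \<in> cells Z k" "e \<in> cells Z l" "closed_cell Z c \<inter> e \<noteq> {}"
  shows "e = c \<or> l < k"
proof -
  obtain F where F: "F \<subseteq> (\<Union>j<k. cells Z j)" "closed_cell Z c \<subseteq> c \<union> \<Union>F"
    using cw_closure_cell(1)[OF assms(1)] by (elim exE conjE)
  obtain x where x: "x \<in> e" "x \<in> c \<union> \<Union>F" using assms(3) F by blast
  show ?thesis
  proof (cases "x \<in> c")
    case True then show ?thesis using cw_disjoint[OF assms(1,2) True x(1)] by simp
  next
    case False
    then obtain j a where "j < k" "a \<in> cells Z j" "x \<in> a" using x F by blast
    then show ?thesis using cw_disjoint[OF assms(2) \<open>a \<in> cells Z j\<close> x(1) \<open>x \<in> a\<close>] by simp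
  qed
qed

text \<open>Cells of equal dimension avoid each other's closures, and finiteness makes the union
  \<open>?E\<close> of the other closures closed, so a connected set cannot pass from one cell to
  another. This is how knowing the dimension of the cell around each point of a connected image
  confines the image to one cell.\<close>

lemma cw_connected_in_cell:
  assumes A: "connectedin (cspace Z) A" "A \<noteq> {}"
    and F: "finite F" "F \<subseteq> cells Z k" "A \<subseteq> \<Union>F"
  shows "\<exists>c \<in> F. A \<subseteq> c"
proof -
  obtain x c where x: "x \<in> A" "c \<in> F" "x \<in> c" using A(2) F(3) by blast
  have ck: "c \<in> cells Z k" using F(2) x(2) by blast
  let ?E = "\<Union>(closed_cell Z ` (F - {c}))"
  have inE: "c' \<subseteq> ?E" if "c' \<in> F" "c' \<noteq> c" for c'
    using that cw_cell_subset_closed[of c' k] F(2) by blast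
  have cE: "closed_cell Z c \<inter> c' = {}" if "c' \<in> F" "c' \<noteq> c" for c'
    using cw_closure_meets[OF ck, of c' k] that F(2) by auto
  have Ec: "?E \<inter> c = {}"
  proof -
    have "closed_cell Z c' \<inter> c = {}" if "c' \<in> F" "c' \<noteq> c" for c'
      using cw_closure_meets[OF _ ck, of c' k] that F(2) by auto
    then show ?thesis by blast
  qed
  have "closedin (cspace Z) ?E"
    using F(1) by (intro closedin_Union) (auto simp: closed_cell_def)
  moreover have "closedin (cspace Z) (closed_cell Z c)" by (simp add: closed_cell_def)
  moreover have "A \<subseteq> closed_cell Z c \<union> ?E"
    using F(3) inE cw_cell_subset_closed[OF ck] by blast
  moreover have "closed_cell Z c \<inter> ?E \<inter> A = {}"
    using cE Ec F(3) by blast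
  moreover have "closed_cell Z c \<inter> A \<noteq> {}"
    using x cw_cell_subset_closed[OF ck] by blast
  ultimately have "?E \<inter> A = {}"
    using A(1) unfolding connectedin_closedin by blast
  then have "A \<subseteq> c" using F(3) inE by blast
  then show ?thesis using x by blast
qed

end

lemma homeomorphic_on_cells_image:
  assumes "homeomorphic_on_cells Y Z f" "cw_complex Y" "cw_complex Z" "c \<in> cells Y k"
  shows "f ` c \<in> cells Z k" "inj_on f c"
    and "homeomorphic_map (subtopology (cspace Y) c) (subtopology (cspace Z) (f ` c)) f"
proof -
  obtain e where e: "e \<in> cells Z k" "homeomorphic_map (subtopology (cspace Y) c) (subtopology (cspace Z) e) f"
    using assms unfolding homeomorphic_on_cells_def by blast
  have "f ` c = e" "inj_on f c"
    using homeomorphic_map_cells[OF e(2) cw_cell_subset[OF assms(2,4)] cw_cell_subset[OF assms(3) e(1)]]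
    by simp_all
  then show "f ` c \<in> cells Z k" "inj_on f c"
    "homeomorphic_map (subtopology (cspace Y) c) (subtopology (cspace Z) (f ` c)) f"
    using e by auto
qed

text \<open>A chart of \<open>e\<close> followed by an inverse chart of \<open>c\<close> embeds an
  open j-disk in k-space.\<close>

lemma cell_dimension_le:
  assumes Z: "cw_complex Z" and Z': "cw_complex Z'" and sp: "cspace Z' = cspace Z"
    and e: "e \<in> cells Z' j" and c: "c \<in> cells Z k" and sub: "e \<subseteq> c"
  shows "j \<le> k"
proof -
  obtain \<psi> where psi: "characteristic_map Z k c \<psi>" using cw_charmap[OF Z c] by blast
  obtain \<phi> where phi: "characteristic_map Z' j e \<phi>" using cw_charmap[OF Z' e] by blast
  obtain q where q: "homeomorphic_maps (subtopology (closed_disk k) (open_disk k)) (subtopology (cspace Z) c) \<psi> q"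
    using psi unfolding characteristic_map_def homeomorphic_map_maps by blast
  let ?J = "subtopology (closed_disk j) (open_disk j)"
  have phic: "continuous_map ?J (subtopology (cspace Z) c) \<phi>"
    using phi charmap_image(1)[OF Z' phi e] sub unfolding characteristic_map_def sp
    by (auto simp: continuous_map_in_subtopology continuous_map_from_subtopology)
  have "continuous_map (subtopology (cspace Z) c) (Euclidean_space k) q"
    using q unfolding homeomorphic_maps_def closed_disk_def
    by (simp add: subtopology_subtopology continuous_map_in_subtopology)
  then have "continuous_map ?J (Euclidean_space k) (q \<circ> \<phi>)"
    using phic continuous_map_compose by blast
  moreover have "inj_on (q \<circ> \<phi>) (open_disk j)"
  proof (rule comp_inj_on)
    show "inj_on \<phi> (open_disk j)" by (rule charmap_image(2)[OF Z' phi e])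
    have "inj_on q (topspace (subtopology (cspace Z) c))"
      using q unfolding homeomorphic_maps_def by (auto intro: inj_on_inverseI)
    then show "inj_on q (\<phi> ` open_disk j)"
      unfolding charmap_image(1)[OF Z' phi e]
      by (rule inj_on_subset) (use sub cw_cell_subset[OF Z c] in auto)
  qed
  ultimately show ?thesis by (rule no_embedding_open_disk)
qed

section \<open>Labeled graph isomorphisms\<close>

text \<open>The inverse \<open>\<tau>\<close> is demanded only on vertices and on ends of edges,
  including ends that are not vertices of the graph, as happens in open stars. So total functions
  with arbitrary values elsewhere can serve as isomorphisms.\<close>

definition label_morphism ::
    "('v \<Rightarrow> 'w) \<Rightarrow> ('w \<Rightarrow> 'v) \<Rightarrow> ('v, 'l, 'm) labeled_graph \<Rightarrow> ('w, 'l, 'm) labeled_graph \<Rightarrow> bool" where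
  "label_morphism \<rho> \<tau> G H \<longleftrightarrow>
     (\<forall>v \<in> verts G. \<rho> v \<in> verts H \<and> \<tau> (\<rho> v) = v \<and> vlabel H (\<rho> v) = vlabel G v) \<and>
     (\<forall>E \<in> edges G. \<rho> ` E \<in> edges H \<and> elabel H (\<rho> ` E) = elabel G E \<and> (\<forall>u \<in> E. \<tau> (\<rho> u) = u))"

lemma labeled_isomorphicI:
  assumes 1: "label_morphism \<rho> \<tau> G H" and 2: "label_morphism \<tau> \<rho> H G"
  shows "labeled_isomorphic G H"
proof -
  have inv: "\<tau> ` \<rho> ` E = E" if "E \<in> edges G" for E
    using 1 that unfolding label_morphism_def by (force simp: image_image)
  have inv': "\<rho> ` \<tau> ` E = E" if "E \<in> edges H" for E
    using 2 that unfolding label_morphism_def by (force simp: image_image)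
  have "bij_betw \<rho> (verts G) (verts H)"
    using 1 2 unfolding label_morphism_def by (intro bij_betw_byWitness[where f' = \<tau>]) auto
  moreover have "bij_betw ((`) \<rho>) (edges G) (edges H)"
    using 1 2 inv inv' unfolding label_morphism_def
    by (intro bij_betw_byWitness[where f' = "(`) \<tau>"]) auto
  moreover have "v \<in> E \<longleftrightarrow> \<rho> v \<in> \<rho> ` E" if "v \<in> verts G" "E \<in> edges G" for v E
    using 1 that unfolding label_morphism_def by (metis image_iff)
  ultimately show ?thesis
    using 1 unfolding labeled_isomorphic_def label_morphism_def
    by (intro exI[of _ \<rho>] exI[of _ "(`) \<rho>"]) simp
qed

lemma labeled_isomorphic_refl: "labeled_isomorphic G G"
  by (rule labeled_isomorphicI[of id id]) (auto simp: label_morphism_def)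

text \<open>Bijections between corresponding fibres are glued together. In the application the
  fibres are the neighbours of a tile with a given record, so equal counts give a matching of
  neighbours that preserves records.\<close>

lemma bij_betw_of_equal_fibres:
  assumes "finite A" "finite B" and eq: "\<And>p. card {a \<in> A. f a = p} = card {b \<in> B. g b = p}"
  obtains h where "bij_betw h A B" "\<And>a. a \<in> A \<Longrightarrow> g (h a) = f a"
proof -
  have "\<exists>h. bij_betw h {a \<in> A. f a = p} {b \<in> B. g b = p}" for p
    using assms by (intro finite_same_card_bij) auto
  then obtain h where h: "\<And>p. bij_betw (h p) {a \<in> A. f a = p} {b \<in> B. g b = p}" by metis
  define k where "k a = h (f a) a" for a
  have k: "k a \<in> B \<and> g (k a) = f a" if "a \<in> A" for a
    using bij_betwE[OF h[of "f a"]] that by (auto simp: k_def)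
  have "inj_on k A"
  proof (rule inj_onI)
    fix x y assume xy: "x \<in> A" "y \<in> A" "k x = k y"
    then have "f x = f y" using k by metis
    then show "x = y"
      using xy bij_betw_imp_inj_on[OF h[of "f x"]] by (auto simp: k_def inj_on_def)
  qed
  moreover have "k ` A = B"
  proof
    show "B \<subseteq> k ` A"
    proof
      fix b assume "b \<in> B"
      then have "b \<in> h (g b) ` {a \<in> A. f a = g b}"
        using bij_betw_imp_surj_on[OF h[of "g b"]] by auto
      then obtain a where "a \<in> A" "f a = g b" "b = h (g b) a" by blast
      then show "b \<in> k ` A" by (intro image_eqI[of _ _ a]) (simp_all add: k_def)
    qed
  qed (use k in auto)
  ultimately show ?thesis using that k by (auto simp: bij_betw_def)
qed

section \<open>Tile systems\<close>

text \<open>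
  The position of a face of a child in its parent is a pair: the parent's face that contains it
  (\<open>None\<close> if it lies in the interior), and the cell of the subdivided base that it covers.
\<close>

definition compatible_faces ::
    "bool \<Rightarrow> ('b \<times> 'b) set \<Rightarrow> 'b option \<times> 'h \<Rightarrow> 'b option \<times> 'h \<Rightarrow> bool" where
  "compatible_faces same P x y \<longleftrightarrow> snd x = snd y \<and>
     (case (fst x, fst y) of (None, None) \<Rightarrow> same | (Some b, Some b') \<Rightarrow> (b, b') \<in> P | _ \<Rightarrow> False)"

text \<open>What the graph argument takes from topology. A type stands for a model disk with
  finitely many \<open>faces\<close>; \<open>face n T b\<close> is the face of the actual tile, and
  different \<open>b\<close> may give the same one. Positions \<open>sub t e \<beta>\<close> depend
  on types alone, so by \<open>face_child_eq\<close> the gluing of two tiles determines that of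
  their children. By \<open>sub_inj\<close> a position on the boundary of a model disk is taken by
  one face of one child, which keeps the valence from growing.\<close>

locale tile_system =
  fixes tiles :: "nat \<Rightarrow> 'x set set"
    and tile_type :: "nat \<Rightarrow> 'x set \<Rightarrow> 't"
    and types :: "'t set"
    and faces :: "'t \<Rightarrow> 'b set"
    and face :: "nat \<Rightarrow> 'x set \<Rightarrow> 'b \<Rightarrow> 'g"
    and kids :: "'t \<Rightarrow> 'e set"
    and child :: "nat \<Rightarrow> 'x set \<Rightarrow> 'e \<Rightarrow> 'x set"
    and ktyp :: "'e \<Rightarrow> 't"
    and sub :: "'t \<Rightarrow> 'e \<Rightarrow> 'b \<Rightarrow> 'b option \<times> 'h"
  assumes finite_types: "finite types"
    and finite_faces: "t \<in> types \<Longrightarrow> finite (faces t)"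
    and finite_kids: "t \<in> types \<Longrightarrow> finite (kids t)"
    and typ_in: "T \<in> tiles n \<Longrightarrow> tile_type n T \<in> types"
    and child_in: "T \<in> tiles n \<Longrightarrow> e \<in> kids (tile_type n T) \<Longrightarrow> child n T e \<in> tiles (Suc n)"
    and child_typ: "T \<in> tiles n \<Longrightarrow> e \<in> kids (tile_type n T) \<Longrightarrow> tile_type (Suc n) (child n T e) = ktyp e"
    and child_inj: "T \<in> tiles n \<Longrightarrow> e \<in> kids (tile_type n T) \<Longrightarrow> T' \<in> tiles n \<Longrightarrow> e' \<in> kids (tile_type n T') \<Longrightarrow>
      child n T e = child n T' e' \<Longrightarrow> T = T' \<and> e = e'"
    and child_surj: "U \<in> tiles (Suc n) \<Longrightarrow> \<exists>T \<in> tiles n. \<exists>e \<in> kids (tile_type n T). U = child n T e"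
    and face_child_eq: "T \<in> tiles n \<Longrightarrow> e \<in> kids (tile_type n T) \<Longrightarrow> T' \<in> tiles n \<Longrightarrow> e' \<in> kids (tile_type n T') \<Longrightarrow>
      \<beta> \<in> faces (ktyp e) \<Longrightarrow> \<beta>' \<in> faces (ktyp e') \<Longrightarrow>
      face (Suc n) (child n T e) \<beta> = face (Suc n) (child n T' e') \<beta>' \<longleftrightarrow>
      compatible_faces (T = T')
        {(b, b'). b \<in> faces (tile_type n T) \<and> b' \<in> faces (tile_type n T') \<and> face n T b = face n T' b'}
        (sub (tile_type n T) e \<beta>) (sub (tile_type n T') e' \<beta>')"
    and sub_inj: "t \<in> types \<Longrightarrow> e \<in> kids t \<Longrightarrow> e' \<in> kids t \<Longrightarrow>
      \<beta> \<in> faces (ktyp e) \<Longrightarrow> \<beta>' \<in> faces (ktyp e') \<Longrightarrow>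
      fst (sub t e \<beta>) \<noteq> None \<Longrightarrow> sub t e \<beta> = sub t e' \<beta>' \<Longrightarrow> e = e' \<and> \<beta> = \<beta>'"
    and valence_0: "\<exists>K. \<forall>g. finite {T \<in> tiles 0. g \<in> face 0 T ` faces (tile_type 0 T)} \<and>
      card {T \<in> tiles 0. g \<in> face 0 T ` faces (tile_type 0 T)} \<le> K"
begin

text \<open>For \<open>T = T'\<close> it contains the diagonal, and further pairs exactly where
  faces of the model disk are identified in the tile.\<close>

definition gluing :: "nat \<Rightarrow> 'x set \<Rightarrow> 'x set \<Rightarrow> ('b \<times> 'b) set" where
  "gluing n T T' = {(b, b'). b \<in> faces (tile_type n T) \<and> b' \<in> faces (tile_type n T') \<and> face n T b = face n T' b'}"

text \<open>The record is ordered, so an edge has two of them, one for each order of its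
  ends.\<close>

definition pair_type :: "nat \<Rightarrow> 'x set \<Rightarrow> 'x set \<Rightarrow> 't \<times> 't \<times> ('b \<times> 'b) set" where
  "pair_type n T T' = (tile_type n T, tile_type n T', gluing n T T')"

definition adj :: "nat \<Rightarrow> 'x set \<Rightarrow> 'x set \<Rightarrow> bool" where
  "adj n T T' \<longleftrightarrow> T \<in> tiles n \<and> T' \<in> tiles n \<and> T \<noteq> T' \<and> gluing n T T' \<noteq> {}"

lemma gluing_converse: "gluing n T T' = (gluing n T' T)\<inverse>"
  by (auto simp: gluing_def)

lemma adj_sym: "adj n T T' \<longleftrightarrow> adj n T' T"
  unfolding adj_def gluing_converse[of n T T'] by auto

lemma adj_tiles: "adj n T T' \<Longrightarrow> T \<in> tiles n \<and> T' \<in> tiles n"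
  by (simp add: adj_def)

lemma pair_type_swap: "pair_type n T T' = pair_type m S S' \<Longrightarrow> pair_type n T' T = pair_type m S' S"
  unfolding pair_type_def gluing_converse[of n T' T] gluing_converse[of m S' S] by simp

lemma gluing_child:
  assumes "T \<in> tiles n" "e \<in> kids (tile_type n T)" "T' \<in> tiles n" "e' \<in> kids (tile_type n T')"
  shows "gluing (Suc n) (child n T e) (child n T' e') =
    {(\<beta>, \<beta>'). \<beta> \<in> faces (ktyp e) \<and> \<beta>' \<in> faces (ktyp e') \<and>
       compatible_faces (T = T') (gluing n T T') (sub (tile_type n T) e \<beta>) (sub (tile_type n T') e' \<beta>')}"
  unfolding gluing_def child_typ[OF assms(1,2)] child_typ[OF assms(3,4)]
  using face_child_eq[OF assms] by auto

text \<open>By \<open>gluing_child\<close> the gluing of two children is a function of the record of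
  the parents and of whether the parents coincide. The latter is a separate assumption: interior
  faces are shared only by children of one tile, and the record alone need not tell one tile from
  two.\<close>

lemma children_match:
  assumes T: "T \<in> tiles n" "T' \<in> tiles n" and S: "S \<in> tiles m" "S' \<in> tiles m"
    and p: "pair_type n T T' = pair_type m S S'" and eq: "T = T' \<longleftrightarrow> S = S'"
    and e: "e \<in> kids (tile_type n T)" "e' \<in> kids (tile_type n T')"
  shows "pair_type (Suc n) (child n T e) (child n T' e') = pair_type (Suc m) (child m S e) (child m S' e')"
    and "adj (Suc n) (child n T e) (child n T' e') \<longleftrightarrow> adj (Suc m) (child m S e) (child m S' e')"
proof -
  have ty: "tile_type n T = tile_type m S" "tile_type n T' = tile_type m S'" and gl: "gluing n T T' = gluing m S S'"
    using p by (auto simp: pair_type_def)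
  have eS: "e \<in> kids (tile_type m S)" "e' \<in> kids (tile_type m S')" using e ty by auto
  have gl': "gluing (Suc n) (child n T e) (child n T' e') = gluing (Suc m) (child m S e) (child m S' e')"
    unfolding gluing_child[OF T(1) e(1) T(2) e(2)] gluing_child[OF S(1) eS(1) S(2) eS(2)] gl ty eq ..
  then show "pair_type (Suc n) (child n T e) (child n T' e') = pair_type (Suc m) (child m S e) (child m S' e')"
    unfolding pair_type_def child_typ[OF T(1) e(1)] child_typ[OF T(2) e(2)]
      child_typ[OF S(1) eS(1)] child_typ[OF S(2) eS(2)] by simp
  have "child n T e = child n T' e' \<longleftrightarrow> T = T' \<and> e = e'"
    using child_inj[OF T(1) e(1) T(2) e(2)] by auto
  moreover have "child m S e = child m S' e' \<longleftrightarrow> S = S' \<and> e = e'"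
    using child_inj[OF S(1) eS(1) S(2) eS(2)] by auto
  ultimately show "adj (Suc n) (child n T e) (child n T' e') \<longleftrightarrow> adj (Suc m) (child m S e) (child m S' e')"
    unfolding adj_def gl' using child_in T S e eS eq by simp
qed

text \<open>Children of distinct tiles can only share boundary positions, and a shared one exhibits
  a common face of the parents. This makes the predecessor map a graph morphism.\<close>

lemma adj_child_imp:
  assumes "T \<in> tiles n" "e \<in> kids (tile_type n T)" "T' \<in> tiles n" "e' \<in> kids (tile_type n T')"
    and "adj (Suc n) (child n T e) (child n T' e')"
  shows "T = T' \<or> adj n T T'"
proof -
  obtain \<beta> \<beta>' where "compatible_faces (T = T') (gluing n T T') (sub (tile_type n T) e \<beta>) (sub (tile_type n T') e' \<beta>')"
    using assms(5) unfolding adj_def gluing_child[OF assms(1-4)] by auto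
  then show ?thesis
    using assms(1,3) by (auto simp: compatible_faces_def adj_def split: option.splits)
qed

section \<open>Parents and induced maps on children\<close>

definition parent :: "nat \<Rightarrow> 'x set \<Rightarrow> 'x set" where
  "parent n U = (SOME T. T \<in> tiles n \<and> (\<exists>e \<in> kids (tile_type n T). U = child n T e))"

definition index :: "nat \<Rightarrow> 'x set \<Rightarrow> 'e" where
  "index n U = (SOME e. e \<in> kids (tile_type n (parent n U)) \<and> U = child n (parent n U) e)"

lemma parent_index:
  assumes "U \<in> tiles (Suc n)"
  shows "parent n U \<in> tiles n" "index n U \<in> kids (tile_type n (parent n U))"
    "child n (parent n U) (index n U) = U"
proof -
  have "\<exists>T. T \<in> tiles n \<and> (\<exists>e \<in> kids (tile_type n T). U = child n T e)"
    using child_surj[OF assms] by blast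
  from someI_ex[OF this]
  have p: "parent n U \<in> tiles n" "\<exists>e. e \<in> kids (tile_type n (parent n U)) \<and> U = child n (parent n U) e"
    unfolding parent_def[symmetric] by auto
  then show "parent n U \<in> tiles n" by simp
  from someI_ex[OF p(2)]
  show "index n U \<in> kids (tile_type n (parent n U))" "child n (parent n U) (index n U) = U"
    unfolding index_def[symmetric] by simp_all
qed

lemma parent_index_child:
  assumes "T \<in> tiles n" "e \<in> kids (tile_type n T)"
  shows "parent n (child n T e) = T" "index n (child n T e) = e"
proof -
  note pi = parent_index[OF child_in[OF assms]]
  show "parent n (child n T e) = T" "index n (child n T e) = e"
    using child_inj[OF pi(1,2) assms pi(3)] by simp_all
qed

definition lift :: "nat \<Rightarrow> nat \<Rightarrow> ('x set \<Rightarrow> 'x set) \<Rightarrow> 'x set \<Rightarrow> 'x set" where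
  "lift n m \<mu> U = child m (\<mu> (parent n U)) (index n U)"

lemma lift_child: "T \<in> tiles n \<Longrightarrow> e \<in> kids (tile_type n T) \<Longrightarrow> lift n m \<mu> (child n T e) = child m (\<mu> T) e"
  by (simp add: lift_def parent_index_child)

subsection \<open>Bounded valence\<close>

text \<open>Incidences are counted rather than tiles: a tile contributes once for each face of its
  model disk that lands on \<open>g\<close>. This is the number that subdivision does not increase
  along an old face.\<close>

definition around :: "nat \<Rightarrow> 'g \<Rightarrow> ('x set \<times> 'b) set" where
  "around n g = {(T, b). T \<in> tiles n \<and> b \<in> faces (tile_type n T) \<and> face n T b = g}"

definition all_faces :: "'b set" where "all_faces = (\<Union>t \<in> types. faces t)"

definition all_kids :: "'e set" where "all_kids = (\<Union>t \<in> types. kids t)"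

lemma finite_all_faces: "finite all_faces" and finite_all_kids: "finite all_kids"
  unfolding all_faces_def all_kids_def using finite_types finite_faces finite_kids by auto

lemma faces_subset: "T \<in> tiles n \<Longrightarrow> faces (tile_type n T) \<subseteq> all_faces"
  and kids_subset: "T \<in> tiles n \<Longrightarrow> kids (tile_type n T) \<subseteq> all_kids"
  unfolding all_faces_def all_kids_def using typ_in by blast+

text \<open>An interior face of \<open>T\<close> is shared only by children of \<open>T\<close>,
  whose number is bounded in terms of the rule alone.\<close>

lemma around_Suc_inner:
  assumes T: "T \<in> tiles n" "e \<in> kids (tile_type n T)" "\<beta> \<in> faces (ktyp e)"
    and g: "face (Suc n) (child n T e) \<beta> = g" and None: "fst (sub (tile_type n T) e \<beta>) = None"
  shows "around (Suc n) g \<subseteq> (\<lambda>(e, \<beta>). (child n T e, \<beta>)) ` (all_kids \<times> all_faces)"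
proof
  fix x assume x: "x \<in> around (Suc n) g"
  obtain U \<beta>' where "x = (U, \<beta>')" by (cases x)
  with x have U: "x = (U, \<beta>')" "U \<in> tiles (Suc n)" "\<beta>' \<in> faces (tile_type (Suc n) U)"
    "face (Suc n) U \<beta>' = g" by (simp_all add: around_def)
  then obtain T' e' where T': "T' \<in> tiles n" "e' \<in> kids (tile_type n T')" "U = child n T' e'"
    using child_surj by blast
  have b': "\<beta>' \<in> faces (ktyp e')" using U T' child_typ by simp
  have "compatible_faces (T = T') {(b, b'). b \<in> faces (tile_type n T) \<and> b' \<in> faces (tile_type n T') \<and> face n T b = face n T' b'}
      (sub (tile_type n T) e \<beta>) (sub (tile_type n T') e' \<beta>')"
    using face_child_eq[OF T(1,2) T'(1,2) T(3) b'] U T' g by simp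
  then have "T' = T" using None by (auto simp: compatible_faces_def split: option.splits)
  moreover have "\<beta>' \<in> all_faces" using faces_subset[OF U(2)] U(3) by blast
  moreover have "e' \<in> all_kids" using kids_subset[OF T'(1)] T'(2) by blast
  ultimately show "x \<in> (\<lambda>(e, \<beta>). (child n T e, \<beta>)) ` (all_kids \<times> all_faces)"
    using U T' by auto
qed

text \<open>Every incidence at \<open>g\<close> comes from an incidence at the old face that carries
  \<open>g\<close>. All positions at \<open>g\<close> have the same base cell as second component,
  so the parent and its carrying face determine the position, and \<open>sub_inj\<close> recovers
  the child and its face.\<close>

lemma around_Suc_boundary:
  assumes T: "T \<in> tiles n" "e \<in> kids (tile_type n T)" "\<beta> \<in> faces (ktyp e)"
    and g: "face (Suc n) (child n T e) \<beta> = g" and Some: "fst (sub (tile_type n T) e \<beta>) = Some b"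
  shows "\<exists>\<phi>. inj_on \<phi> (around (Suc n) g) \<and> \<phi> ` around (Suc n) g \<subseteq> around n (face n T b)"
proof -
  define \<sigma> where "\<sigma> x = sub (tile_type n (parent n (fst x))) (index n (fst x)) (snd x)" for x
  define \<phi> where "\<phi> x = (parent n (fst x), the (fst (\<sigma> x)))" for x
  have key: "\<exists>T' e' \<beta>' b'. x = (child n T' e', \<beta>') \<and> T' \<in> tiles n \<and> e' \<in> kids (tile_type n T') \<and>
      \<beta>' \<in> faces (ktyp e') \<and> \<sigma> x = sub (tile_type n T') e' \<beta>' \<and> \<sigma> x = (Some b', snd (sub (tile_type n T) e \<beta>)) \<and>
      \<phi> x = (T', b') \<and> (T', b') \<in> around n (face n T b)"
    if "x \<in> around (Suc n) g" for x
  proof -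
    obtain U \<beta>' where x: "x = (U, \<beta>')" by (cases x)
    then have U: "x = (U, \<beta>')" "U \<in> tiles (Suc n)" "\<beta>' \<in> faces (tile_type (Suc n) U)"
      "face (Suc n) U \<beta>' = g" using that by (simp_all add: around_def)
    then obtain T' e' where T': "T' \<in> tiles n" "e' \<in> kids (tile_type n T')" "U = child n T' e'"
      using child_surj by blast
    have b': "\<beta>' \<in> faces (ktyp e')" using U T' child_typ by simp
    have s: "\<sigma> x = sub (tile_type n T') e' \<beta>'"
      by (simp add: \<sigma>_def U T' parent_index_child)
    have c: "compatible_faces (T = T') {(b, b'). b \<in> faces (tile_type n T) \<and> b' \<in> faces (tile_type n T') \<and> face n T b = face n T' b'}
        (sub (tile_type n T) e \<beta>) (\<sigma> x)"
      using face_child_eq[OF T(1,2) T'(1,2) T(3) b'] U T' g s by simp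
    then obtain b'' where b'': "fst (\<sigma> x) = Some b''" "b'' \<in> faces (tile_type n T')" "face n T' b'' = face n T b"
      "snd (\<sigma> x) = snd (sub (tile_type n T) e \<beta>)"
      using Some by (auto simp: compatible_faces_def split: option.splits)
    then have "\<phi> x = (T', b'')" by (simp add: \<phi>_def U T' parent_index_child)
    moreover have "\<sigma> x = (Some b'', snd (sub (tile_type n T) e \<beta>))" using b'' by (simp add: prod_eq_iff)
    ultimately show ?thesis using U T' b' s b'' by (auto simp: around_def)
  qed
  have "inj_on \<phi> (around (Suc n) g)"
  proof (rule inj_onI)
    fix x y assume x: "x \<in> around (Suc n) g" and y: "y \<in> around (Suc n) g" and eq: "\<phi> x = \<phi> y"
    obtain T1 e1 \<beta>1 b1 where 1: "x = (child n T1 e1, \<beta>1)" "T1 \<in> tiles n" "e1 \<in> kids (tile_type n T1)"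
      "\<beta>1 \<in> faces (ktyp e1)" "\<sigma> x = sub (tile_type n T1) e1 \<beta>1" "\<sigma> x = (Some b1, snd (sub (tile_type n T) e \<beta>))" "\<phi> x = (T1, b1)"
      using key[OF x] by blast
    obtain T2 e2 \<beta>2 b2 where 2: "y = (child n T2 e2, \<beta>2)" "T2 \<in> tiles n" "e2 \<in> kids (tile_type n T2)"
      "\<beta>2 \<in> faces (ktyp e2)" "\<sigma> y = sub (tile_type n T2) e2 \<beta>2" "\<sigma> y = (Some b2, snd (sub (tile_type n T) e \<beta>))" "\<phi> y = (T2, b2)"
      using key[OF y] by blast
    have T12: "T1 = T2" and s: "\<sigma> x = \<sigma> y" using eq 1 2 by auto
    have "e1 = e2 \<and> \<beta>1 = \<beta>2"
      using sub_inj[of "tile_type n T1" e1 e2 \<beta>1 \<beta>2] typ_in[OF 1(2)] 1 2 T12 s by auto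
    then show "x = y" using 1 2 T12 by simp
  qed
  moreover have "\<phi> ` around (Suc n) g \<subseteq> around n (face n T b)"
    using key by (metis image_subsetI)
  ultimately show ?thesis by blast
qed

lemma bounded_around: "\<exists>N. \<forall>n g. finite (around n g) \<and> card (around n g) \<le> N"
proof -
  obtain K where K: "\<And>g. finite {T \<in> tiles 0. g \<in> face 0 T ` faces (tile_type 0 T)}"
    "\<And>g. card {T \<in> tiles 0. g \<in> face 0 T ` faces (tile_type 0 T)} \<le> K"
    using valence_0 by blast
  \<comment> \<open>The first term bounds incidences at faces of level 0 and is inherited by their
    pieces; the second bounds incidences at faces that arise inside a tile.\<close>
  define N where "N = max (K * card all_faces) (card (all_kids \<times> all_faces))"
  have "finite (around n g) \<and> card (around n g) \<le> N" for n g
  proof (induction n arbitrary: g)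
    case 0
    let ?A = "{T \<in> tiles 0. g \<in> face 0 T ` faces (tile_type 0 T)} \<times> all_faces"
    have sub: "around 0 g \<subseteq> ?A"
      using faces_subset by (fastforce simp: around_def)
    have fin: "finite ?A" using K finite_all_faces by blast
    have "card (around 0 g) \<le> card ?A" by (rule card_mono[OF fin sub])
    also have "\<dots> \<le> K * card all_faces" using K by (simp add: card_cartesian_product)
    finally show ?case using finite_subset[OF sub fin] by (simp add: N_def)
  next
    case (Suc n)
    show ?case
    proof (cases "around (Suc n) g = {}")
      case False
      then obtain U \<beta> where U: "U \<in> tiles (Suc n)" "\<beta> \<in> faces (tile_type (Suc n) U)" "face (Suc n) U \<beta> = g"
        by (auto simp: around_def)
      then obtain T e where T: "T \<in> tiles n" "e \<in> kids (tile_type n T)" "U = child n T e"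
        using child_surj by blast
      have b: "\<beta> \<in> faces (ktyp e)" and g: "face (Suc n) (child n T e) \<beta> = g"
        using U T child_typ by simp_all
      show ?thesis
      proof (cases "fst (sub (tile_type n T) e \<beta>)")
        case None
        note s = around_Suc_inner[OF T(1,2) b g None]
        have fin: "finite (all_kids \<times> all_faces)" using finite_all_faces finite_all_kids by blast
        have "card (around (Suc n) g) \<le> card (all_kids \<times> all_faces)"
          using surj_card_le[OF fin s] .
        then show ?thesis using finite_subset[OF s] fin by (simp add: N_def)
      next
        case (Some b0)
        obtain \<phi> where "inj_on \<phi> (around (Suc n) g)" "\<phi> ` around (Suc n) g \<subseteq> around n (face n T b0)"
          using around_Suc_boundary[OF T(1,2) b g Some] by blast
        then show ?thesis
          using Suc.IH[of "face n T b0"] by (meson card_inj_on_le inj_on_finite le_trans)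
      qed
    qed simp
  qed
  then show ?thesis by blast
qed

lemma bounded_degree: "\<exists>N. \<forall>n. \<forall>T. finite {T'. adj n T T'} \<and> card {T'. adj n T T'} \<le> N"
proof -
  obtain N where N: "\<And>n g. finite (around n g)" "\<And>n g. card (around n g) \<le> N"
    using bounded_around by blast
  have "finite {T'. adj n T T'} \<and> card {T'. adj n T T'} \<le> card all_faces * N" for n T
  proof (cases "T \<in> tiles n")
    case True
    let ?A = "\<Union>b \<in> all_faces. fst ` around n (face n T b)"
    have sub: "{T'. adj n T T'} \<subseteq> ?A"
    proof
      fix T' assume T': "T' \<in> {T'. adj n T T'}"
      then obtain x where "x \<in> gluing n T T'" by (auto simp: adj_def)
      then obtain b b' where b: "(b, b') \<in> gluing n T T'" by (cases x) simp
      then have "b \<in> all_faces" "(T', b') \<in> around n (face n T b)"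
        using T' faces_subset[OF True] by (auto simp: adj_def gluing_def around_def)
      then show "T' \<in> ?A" by force
    qed
    have fin: "finite ?A" using N finite_all_faces by blast
    have "card {T'. adj n T T'} \<le> card ?A" by (rule card_mono[OF fin sub])
    also have "\<dots> \<le> (\<Sum>b \<in> all_faces. card (fst ` around n (face n T b)))"
      by (rule card_UN_le[OF finite_all_faces])
    also have "\<dots> \<le> (\<Sum>b \<in> all_faces. N)"
      using N by (intro sum_mono) (meson card_image_le le_trans)
    finally show ?thesis using finite_subset[OF sub fin] by simp
  qed (simp add: adj_def)
  then show ?thesis by blast
qed

lemma finite_adj: "finite {T'. adj n T T'}"
  using bounded_degree by blast

end

context tile_system
begin

subsection \<open>The graph of a tile system\<close>

definition up :: "nat \<Rightarrow> 'x set \<Rightarrow> 'x history_vertex" where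
  "up n T = (case n of 0 \<Rightarrow> Origin | Suc k \<Rightarrow> Tile k (parent k T))"

definition tile_graph :: "'x history_vertex graph" where
  "tile_graph = \<lparr>verts = insert Origin {Tile n T | n T. T \<in> tiles n},
     edges = {{Tile n T, Tile n T'} | n T T'. adj n T T'} \<union> {{up n T, Tile n T} | n T. T \<in> tiles n}\<rparr>"

text \<open>Shifted by one against the levels of tiles, since the origin occupies layer 0.\<close>

definition layer :: "nat \<Rightarrow> 'x history_vertex graph" where
  "layer n = (case n of 0 \<Rightarrow> \<lparr>verts = {Origin}, edges = {}\<rparr>
     | Suc k \<Rightarrow> \<lparr>verts = Tile k ` tiles k, edges = {{Tile k T, Tile k T'} | T T'. adj k T T'}\<rparr>)"

text \<open>Edges are unordered, so heights tell horizontal from vertical edges and single out the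
  end of a vertical edge that is nearer to the origin.\<close>

primrec height :: "'x history_vertex \<Rightarrow> nat" where
  "height Origin = 0"
| "height (Tile n T) = Suc n"

lemma height_up [simp]: "height (up n T) = n"
  by (simp add: up_def split: nat.splits)

lemma up_neq_Tile [simp]: "up n T \<noteq> Tile n U" "Tile n U \<noteq> up n T"
  by (metis height_up height.simps(2) n_not_Suc_n)+

lemma up_child: "T \<in> tiles n \<Longrightarrow> e \<in> kids (tile_type n T) \<Longrightarrow> up (Suc n) (child n T e) = Tile n T"
  by (simp add: up_def parent_index_child)

lemma up_eq_iff: "{up n T, Tile n T} = {up k U, Tile k U} \<longleftrightarrow> n = k \<and> T = U"
proof
  assume eq: "{up n T, Tile n T} = {up k U, Tile k U}"
  from arg_cong[OF this, of "image height"] have "{n, Suc n} = {k, Suc k}" by simp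
  then have "n = k" by (auto simp: doubleton_eq_iff)
  then show "n = k \<and> T = U" using eq by (auto simp: doubleton_eq_iff)
qed simp

lemma up_neq_horizontal: "{up k U, Tile k U} \<noteq> {Tile n T, Tile n T'}"
proof
  assume "{up k U, Tile k U} = {Tile n T, Tile n T'}"
  from arg_cong[OF this, of "image height"] have "{k, Suc k} = {Suc n}"
    by (simp only: image_insert image_empty height_up height.simps insert_absorb2)
  then have "k \<in> {Suc n}" "Suc k \<in> {Suc n}" by blast+
  then show False by simp
qed

lemma verts_tile_graph [simp]: "Origin \<in> verts tile_graph" "Tile n T \<in> verts tile_graph \<longleftrightarrow> T \<in> tiles n"
  by (auto simp: tile_graph_def)

lemma verts_layer [simp]:
  "v \<in> verts (layer 0) \<longleftrightarrow> v = Origin" "v \<in> verts (layer (Suc n)) \<longleftrightarrow> (\<exists>T \<in> tiles n. v = Tile n T)"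
  by (auto simp: layer_def)

lemma up_in_layer: "T \<in> tiles n \<Longrightarrow> up n T \<in> verts (layer n)"
  by (cases n) (auto simp: up_def parent_index)

lemma height_layer: "v \<in> verts (layer n) \<Longrightarrow> height v = n"
  by (cases n) auto

lemma layer_subset: "verts (layer n) \<subseteq> verts tile_graph"
  by (cases n) auto

section \<open>Edges, stars and predecessors\<close>

lemma edge_cases:
  assumes "E \<in> edges tile_graph"
  obtains (horizontal) n T T' where "E = {Tile n T, Tile n T'}" "adj n T T'"
    | (vertical) n T where "E = {up n T, Tile n T}" "T \<in> tiles n"
  using assms by (auto simp: tile_graph_def)

lemma horizontal_edge: "adj n T T' \<Longrightarrow> {Tile n T, Tile n T'} \<in> edges tile_graph"
  and vertical_edge: "T \<in> tiles n \<Longrightarrow> {up n T, Tile n T} \<in> edges tile_graph"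
  by (auto simp: tile_graph_def)

lemma child_edge:
  "T \<in> tiles n \<Longrightarrow> e \<in> kids (tile_type n T) \<Longrightarrow> {Tile n T, Tile (Suc n) (child n T e)} \<in> edges tile_graph"
  using vertical_edge[OF child_in] by (simp add: up_child)

lemma star_cases:
  assumes T: "T \<in> tiles n" and E: "E \<in> edges tile_graph" "Tile n T \<in> E"
  obtains (up) "E = {up n T, Tile n T}"
    | (down) e where "e \<in> kids (tile_type n T)" "E = {Tile n T, Tile (Suc n) (child n T e)}"
    | (side) T' where "adj n T T'" "E = {Tile n T, Tile n T'}"
  using E(1)
proof (cases rule: edge_cases)
  case (horizontal k A B)
  then have k: "k = n" and "T = A \<or> T = B" using E(2) by auto
  then show ?thesis
    using horizontal side[of A] side[of B] adj_sym by (metis insert_commute)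
next
  case (vertical k U)
  show ?thesis
  proof (cases "Tile n T = Tile k U")
    case True then show ?thesis using vertical up by simp
  next
    case False
    then have upU: "up k U = Tile n T" using vertical E(2) by auto
    from arg_cong[OF this, of height] have k: "k = Suc n" by simp
    then obtain S e where S: "S \<in> tiles n" "e \<in> kids (tile_type n S)" "U = child n S e"
      using child_surj vertical by blast
    then have "S = T" using upU k up_child[OF S(1,2)] by simp
    then show ?thesis using S down[of e] vertical k upU by simp
  qed
qed

text \<open>All other neighbours of the tile have height at least \<open>Suc n\<close>.\<close>

lemma below_unique:
  assumes T: "T \<in> tiles n"
  shows "u \<in> verts (layer n) \<and> {u, Tile n T} \<in> edges tile_graph \<longleftrightarrow> u = up n T"
proof
  assume u: "u \<in> verts (layer n) \<and> {u, Tile n T} \<in> edges tile_graph"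
  then have h: "height u = n" using height_layer by blast
  from T conjunct2[OF u] insertI2[OF singletonI] show "u = up n T"
  proof (cases rule: star_cases)
    case up then show ?thesis by (auto simp: doubleton_eq_iff)
  next
    case (down e)
    then have "u \<in> {Tile n T, Tile (Suc n) (child n T e)}" by (metis insertI1)
    then have "height u = Suc n \<or> height u = Suc (Suc n)" by auto
    then show ?thesis using h by simp
  next
    case (side T')
    then have "u \<in> {Tile n T, Tile n T'}" by (metis insertI1)
    then have "height u = Suc n \<or> height u = Suc (Suc n)" by auto
    then show ?thesis using h by simp
  qed
qed (use T up_in_layer vertical_edge in auto)

lemma predecessor_Origin: "predecessor G layer Origin = Origin"
  by (simp add: predecessor_def)

lemma predecessor_Tile:
  assumes G: "edges G = edges tile_graph" and T: "T \<in> tiles n"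
  shows "predecessor G layer (Tile n T) = up n T"
proof -
  have "(\<exists>k. Tile n T \<in> verts (layer (Suc k)) \<and> u \<in> verts (layer k) \<and> {u, Tile n T} \<in> edges G) \<longleftrightarrow> u = up n T" for u
    using below_unique[OF T, of u] T G by auto
  then show ?thesis by (simp add: predecessor_def)
qed

text \<open>Sets of values make the label independent of the way in which an unordered edge is
  written. For an edge exactly one component is nonempty, the first if it is horizontal and the
  second if it is vertical.\<close>

definition raw_edge_label where
  "raw_edge_label E = ({p. \<exists>n T T'. E = {Tile n T, Tile n T'} \<and> p = pair_type n T T'},
     {t. \<exists>n T. E = {up n T, Tile n T} \<and> t = tile_type n T})"

lemma raw_edge_label_horizontal:
  "raw_edge_label {Tile n T, Tile n T'} = ({pair_type n T T', pair_type n T' T}, {})"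
  unfolding raw_edge_label_def using up_neq_horizontal[symmetric]
  by (auto simp: doubleton_eq_iff)

lemma raw_edge_label_vertical:
  "raw_edge_label {up n T, Tile n T} = ({}, {tile_type n T})"
  unfolding raw_edge_label_def using up_neq_horizontal by (auto simp: up_eq_iff)

lemma raw_edge_label_child:
  "T \<in> tiles n \<Longrightarrow> e \<in> kids (tile_type n T) \<Longrightarrow>
    raw_edge_label {Tile n T, Tile (Suc n) (child n T e)} = ({}, {ktyp e})"
  using raw_edge_label_vertical[of "Suc n" "child n T e"] by (simp add: up_child child_typ)

text \<open>The self-gluing in \<open>pair_type n T T\<close> governs how children of
  \<open>T\<close> touch each other; the counts govern the neighbours and, through their records,
  the contacts between children of \<open>T\<close> and children of neighbours.\<close>

definition raw_vertex_label where
  "raw_vertex_label v = (case v of Origin \<Rightarrow> None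
     | Tile n T \<Rightarrow> Some (pair_type n T T, \<lambda>p. card {T'. adj n T T' \<and> pair_type n T T' = p}))"

text \<open>By \<open>adj_child_imp\<close> the neighbours of a child of \<open>T\<close> are
  children of these tiles.\<close>

definition neighbourhood :: "nat \<Rightarrow> 'x set \<Rightarrow> 'x set set" where
  "neighbourhood n T = insert T {T'. adj n T T'}"

lemma neighbourhood_tiles: "T \<in> tiles n \<Longrightarrow> T' \<in> neighbourhood n T \<Longrightarrow> T' \<in> tiles n"
  by (auto simp: neighbourhood_def adj_def)

text \<open>Records are compared with the central tile only; two neighbours are not compared with
  each other. Used in pairs, with \<open>\<mu>\<close> and \<open>\<tau>\<close> exchanged, it
  expresses a bijection of neighbourhoods.\<close>

definition matching where
  "matching n T m S \<mu> \<tau> \<longleftrightarrow> \<mu> T = S \<and>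
     (\<forall>T' \<in> neighbourhood n T. \<mu> T' \<in> neighbourhood m S \<and> \<tau> (\<mu> T') = T' \<and> pair_type n T T' = pair_type m S (\<mu> T'))"

lemma matchingD:
  assumes "matching n T m S \<mu> \<tau>" "T \<in> tiles n" "S \<in> tiles m" "T' \<in> neighbourhood n T"
  shows "\<mu> T' \<in> tiles m" "T' \<in> tiles n" "\<tau> (\<mu> T') = T'" "pair_type n T T' = pair_type m S (\<mu> T')"
    "T = T' \<longleftrightarrow> S = \<mu> T'" "tile_type n T' = tile_type m (\<mu> T')" "\<mu> T' \<in> neighbourhood m S"
proof -
  have 1: "\<mu> T = S" "\<mu> T' \<in> neighbourhood m S" "\<tau> (\<mu> T') = T'" "pair_type n T T' = pair_type m S (\<mu> T')"
    using assms unfolding matching_def by blast+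
  have 2: "\<tau> S = T"
    using assms(1) unfolding matching_def neighbourhood_def by blast
  show "\<mu> T' \<in> tiles m" "T' \<in> tiles n" using 1 assms neighbourhood_tiles by blast+
  show "\<tau> (\<mu> T') = T'" "pair_type n T T' = pair_type m S (\<mu> T')" "\<mu> T' \<in> neighbourhood m S" using 1 by auto
  show "T = T' \<longleftrightarrow> S = \<mu> T'" using 1 2 by metis
  show "tile_type n T' = tile_type m (\<mu> T')" using 1(4) by (simp add: pair_type_def)
qed

lemma same_label_matching:
  assumes T: "T \<in> tiles n" and S: "S \<in> tiles m"
    and eq: "raw_vertex_label (Tile n T) = raw_vertex_label (Tile m S)"
  obtains \<mu> \<tau> where "matching n T m S \<mu> \<tau>" "matching m S n T \<tau> \<mu>"
proof -
  let ?A = "{T'. adj n T T'}" and ?B = "{S'. adj m S S'}"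
  have p: "pair_type n T T = pair_type m S S" using eq by (simp add: raw_vertex_label_def)
  have f: "(\<lambda>p. card {T'. adj n T T' \<and> pair_type n T T' = p}) = (\<lambda>p. card {T'. adj m S T' \<and> pair_type m S T' = p})"
    using eq by (simp add: raw_vertex_label_def)
  have c: "card {T' \<in> ?A. pair_type n T T' = p} = card {S' \<in> ?B. pair_type m S S' = p}" for p
    using fun_cong[OF f, of p] by simp
  obtain h where h: "bij_betw h ?A ?B" "\<And>T'. T' \<in> ?A \<Longrightarrow> pair_type m S (h T') = pair_type n T T'"
    using bij_betw_of_equal_fibres[OF finite_adj finite_adj c] by blast
  have TA: "T \<notin> ?A" and SB: "S \<notin> ?B" by (auto simp: adj_def)
  \<comment> \<open>A tile is not adjacent to itself, so the extra value at the centre does not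
    disturb the bijection of neighbours.\<close>
  define \<mu> where "\<mu> = h(T := S)"
  define \<tau> where "\<tau> = (inv_into ?A h)(S := T)"
  have hA: "h T' \<in> ?B" if "T' \<in> ?A" for T' using h(1) that by (rule bij_betwE[rule_format])
  have gB: "inv_into ?A h S' \<in> ?A" "h (inv_into ?A h S') = S'" if "S' \<in> ?B" for S'
    using bij_betw_inv_into[OF h(1)] that bij_betw_inv_into_right[OF h(1)] by (auto dest: bij_betwE)
  have gh: "inv_into ?A h (h T') = T'" if "T' \<in> ?A" for T'
    using bij_betw_inv_into_left[OF h(1) that] .
  have "matching n T m S \<mu> \<tau>"
    unfolding matching_def
  proof (intro conjI ballI)
    fix T' assume T': "T' \<in> neighbourhood n T"
    show "\<mu> T' \<in> neighbourhood m S" "\<tau> (\<mu> T') = T'" "pair_type n T T' = pair_type m S (\<mu> T')"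
    proof (atomize (full), cases "T' = T")
      case False
      then have A: "T' \<in> ?A" using T' by (simp add: neighbourhood_def)
      then have "h T' \<noteq> S" using hA SB by metis
      then show "\<mu> T' \<in> neighbourhood m S \<and> \<tau> (\<mu> T') = T' \<and> pair_type n T T' = pair_type m S (\<mu> T')"
        using hA[OF A] gh[OF A] h(2)[OF A] False by (simp add: \<mu>_def \<tau>_def neighbourhood_def)
    qed (simp add: \<mu>_def \<tau>_def neighbourhood_def p)
  qed (simp add: \<mu>_def)
  moreover have "matching m S n T \<tau> \<mu>"
    unfolding matching_def
  proof (intro conjI ballI)
    fix S' assume S': "S' \<in> neighbourhood m S"
    show "\<tau> S' \<in> neighbourhood n T" "\<mu> (\<tau> S') = S'" "pair_type m S S' = pair_type n T (\<tau> S')"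
    proof (atomize (full), cases "S' = S")
      case False
      then have B: "S' \<in> ?B" using S' by (simp add: neighbourhood_def)
      then have "inv_into ?A h S' \<noteq> T" using gB TA by metis
      then show "\<tau> S' \<in> neighbourhood n T \<and> \<mu> (\<tau> S') = S' \<and> pair_type m S S' = pair_type n T (\<tau> S')"
        using gB[OF B] h(2)[OF gB(1)[OF B]] False by (simp add: \<mu>_def \<tau>_def neighbourhood_def)
    qed (simp add: \<mu>_def \<tau>_def neighbourhood_def p)
  qed (simp add: \<tau>_def)
  ultimately show ?thesis using that by blast
qed

text \<open>The parent \<open>T'\<close> of \<open>U\<close> lies in the neighbourhood of
  \<open>T\<close>, so \<open>children_match\<close> applies to \<open>T\<close> with
  \<open>T'\<close> and \<open>S\<close> with \<open>\<mu> T'\<close>.\<close>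

lemma matching_children:
  assumes M: "matching n T m S \<mu> \<tau>" and T: "T \<in> tiles n" and S: "S \<in> tiles m"
    and e: "e \<in> kids (tile_type n T)"
    and U: "adj (Suc n) (child n T e) U"
  shows "adj (Suc m) (child m S e) (lift n m \<mu> U)"
    and "pair_type (Suc m) (child m S e) (lift n m \<mu> U) = pair_type (Suc n) (child n T e) U"
    and "lift m n \<tau> (lift n m \<mu> U) = U"
proof -
  obtain T' e' where T': "T' \<in> tiles n" "e' \<in> kids (tile_type n T')" "U = child n T' e'"
    using child_surj[of U n] adj_tiles[OF U] by blast
  have nb: "T' \<in> neighbourhood n T"
    using adj_child_imp[OF T e T'(1,2)] U T'(3) by (auto simp: neighbourhood_def)
  note D = matchingD[OF M T S nb]
  have l: "lift n m \<mu> U = child m (\<mu> T') e'" using lift_child[OF T'(1,2)] T'(3) by simp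
  note C = children_match[OF T T'(1) S D(1) D(4,5) e T'(2)]
  show "adj (Suc m) (child m S e) (lift n m \<mu> U)"
    "pair_type (Suc m) (child m S e) (lift n m \<mu> U) = pair_type (Suc n) (child n T e) U"
    using C U T'(3) l by auto
  have "e' \<in> kids (tile_type m (\<mu> T'))" using T'(2) D(6) by simp
  then show "lift m n \<tau> (lift n m \<mu> U) = U" using l lift_child[OF D(1)] D(3) T'(3) by simp
qed

text \<open>Children are vertices of the preimage of a star, whose isomorphisms preserve labels; so
  the label of a tile has to determine the labels of its children. The bijection behind the equal
  counts is \<open>lift n m \<mu>\<close>.\<close>

lemma raw_vertex_label_child:
  assumes M: "matching n T m S \<mu> \<tau>" "matching m S n T \<tau> \<mu>" and T: "T \<in> tiles n" and S: "S \<in> tiles m"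
    and e: "e \<in> kids (tile_type n T)"
  shows "raw_vertex_label (Tile (Suc n) (child n T e)) = raw_vertex_label (Tile (Suc m) (child m S e))"
proof -
  have "T \<in> neighbourhood n T" by (simp add: neighbourhood_def)
  note D = matchingD[OF M(1) T S this]
  have mu: "\<mu> T = S" using M by (simp add: matching_def)
  have e': "e \<in> kids (tile_type m S)" using e D(6) mu by simp
  have "pair_type (Suc n) (child n T e) (child n T e) = pair_type (Suc m) (child m S e) (child m S e)"
    using children_match(1)[OF T T S S _ _ e e] D(4) mu by simp
  moreover have "card {U. adj (Suc n) (child n T e) U \<and> pair_type (Suc n) (child n T e) U = p} =
      card {U. adj (Suc m) (child m S e) U \<and> pair_type (Suc m) (child m S e) U = p}" for p
  proof (rule bij_betw_same_card, rule bij_betw_byWitness[where f = "lift n m \<mu>" and f' = "lift m n \<tau>"])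
    show "\<forall>a\<in>{U. adj (Suc n) (child n T e) U \<and> pair_type (Suc n) (child n T e) U = p}. lift m n \<tau> (lift n m \<mu> a) = a"
      using matching_children(3)[OF M(1) T S e] by blast
    show "\<forall>a\<in>{U. adj (Suc m) (child m S e) U \<and> pair_type (Suc m) (child m S e) U = p}. lift n m \<mu> (lift m n \<tau> a) = a"
      using matching_children(3)[OF M(2) S T e'] by blast
  qed (use matching_children(1,2)[OF M(1) T S e] matching_children(1,2)[OF M(2) S T e'] in auto)
  ultimately show ?thesis by (simp add: raw_vertex_label_def)
qed

text \<open>Open stars reach from the vertex above \<open>T\<close> to its children, their preimages
  from the level of \<open>T\<close> to the grandchildren. So three levels are treated, and
  \<open>w\<close> serves for the vertex above.\<close>

definition tile_map where
  "tile_map n m \<mu> w v = (case v of Origin \<Rightarrow> w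
     | Tile k U \<Rightarrow> if k = n then Tile m (\<mu> U) else if k = Suc n then Tile (Suc m) (lift n m \<mu> U)
         else if k = Suc (Suc n) then Tile (Suc (Suc m)) (lift (Suc n) (Suc m) (lift n m \<mu>) U) else w)"

lemma tile_map_Tile [simp]: "tile_map n m \<mu> w (Tile n U) = Tile m (\<mu> U)"
  by (simp add: tile_map_def)

lemma tile_map_up [simp]: "tile_map n m \<mu> w (up n U) = w"
  by (simp add: tile_map_def up_def split: nat.splits)

lemma tile_map_child [simp]:
  "T \<in> tiles n \<Longrightarrow> e \<in> kids (tile_type n T) \<Longrightarrow>
    tile_map n m \<mu> w (Tile (Suc n) (child n T e)) = Tile (Suc m) (child m (\<mu> T) e)"
  by (simp add: tile_map_def lift_child)

lemma tile_map_grandchild [simp]: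
  "T \<in> tiles n \<Longrightarrow> e \<in> kids (tile_type n T) \<Longrightarrow> e' \<in> kids (ktyp e) \<Longrightarrow>
    tile_map n m \<mu> w (Tile (Suc (Suc n)) (child (Suc n) (child n T e) e')) =
    Tile (Suc (Suc m)) (child (Suc m) (child m (\<mu> T) e) e')"
  using lift_child[OF child_in[of T n e], of e' "Suc m" "lift n m \<mu>"]
  by (simp add: tile_map_def lift_child child_typ)

end

text \<open>The encodings \<open>i\<close> and \<open>j\<close> are arbitrary: isomorphisms are
  built from equality of raw labels, and \<open>tile_graph_combinatorial\<close> chooses encodings
  that are injective on the raw labels that occur.\<close>

locale labeled_tile_system = tile_system +
  fixes G and i :: "_ \<Rightarrow> nat" and j :: "_ \<Rightarrow> nat"
  defines G_def: "G \<equiv> with_labels tile_graph (i \<circ> raw_vertex_label) (j \<circ> raw_edge_label)"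
begin

section \<open>Isomorphic stars and preimages in the labeled graph\<close>

lemma G_simps [simp]: "verts G = verts tile_graph" "edges G = edges tile_graph"
  "vlabel G v = i (raw_vertex_label v)" "elabel G E = j (raw_edge_label E)"
  by (simp_all add: G_def with_labels_def)

lemma predecessor_simps [simp]: "predecessor G layer Origin = Origin"
  "T \<in> tiles n \<Longrightarrow> predecessor G layer (Tile n T) = up n T"
  using predecessor_Origin predecessor_Tile[OF G_simps(2)] by auto

lemma predecessor_child [simp]:
  "T \<in> tiles n \<Longrightarrow> e \<in> kids (tile_type n T) \<Longrightarrow> predecessor G layer (Tile (Suc n) (child n T e)) = Tile n T"
  by (simp add: child_in up_child)

text \<open>At level 0 an edge collapses to the origin. Further down, the parents of adjacent tiles
  are equal or adjacent by \<open>adj_child_imp\<close>, and a vertical edge moves up by one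
  level.\<close>

lemma predecessor_image_edge:
  assumes "E \<in> edges tile_graph"
  shows "predecessor G layer ` E \<in> edges tile_graph \<or> (\<exists>u \<in> verts tile_graph. predecessor G layer ` E = {u})"
  using assms
proof (cases rule: edge_cases)
  case (horizontal n T T')
  then have t: "T \<in> tiles n" "T' \<in> tiles n" using adj_tiles by auto
  show ?thesis
  proof (cases n)
    case 0
    then show ?thesis using horizontal t by (simp add: up_def)
  next
    case (Suc k)
    obtain A e where A: "A \<in> tiles k" "e \<in> kids (tile_type k A)" "T = child k A e"
      using child_surj t(1) Suc by blast
    obtain B e' where B: "B \<in> tiles k" "e' \<in> kids (tile_type k B)" "T' = child k B e'"
      using child_surj t(2) Suc by blast
    have im: "predecessor G layer ` E = {Tile k A, Tile k B}" using horizontal Suc A B by simp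
    have "A = B \<or> adj k A B" using adj_child_imp[OF A(1,2) B(1,2)] horizontal A B Suc by simp
    then show ?thesis unfolding im using horizontal_edge A by auto
  qed
next
  case (vertical n T)
  show ?thesis
  proof (cases n)
    case 0
    then show ?thesis using vertical by (simp add: up_def)
  next
    case (Suc k)
    obtain A e where A: "A \<in> tiles k" "e \<in> kids (tile_type k A)" "T = child k A e"
      using child_surj vertical Suc by blast
    have "predecessor G layer ` E = {up k A, Tile k A}" using vertical Suc A by (simp add: up_child)
    then show ?thesis using vertical_edge A by simp
  qed
qed

lemma star_morphism:
  assumes M: "matching n T m S \<mu> \<tau>" and T: "T \<in> tiles n" and S: "S \<in> tiles m"
    and l: "raw_vertex_label (Tile n T) = raw_vertex_label (Tile m S)"
  shows "label_morphism (tile_map n m \<mu> (up m S)) (tile_map m n \<tau> (up n T))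
    (open_star G (Tile n T)) (open_star G (Tile m S))"
proof -
  let ?\<rho> = "tile_map n m \<mu> (up m S)" and ?\<tau> = "tile_map m n \<tau> (up n T)"
  have nb: "T \<in> neighbourhood n T" by (simp add: neighbourhood_def)
  note D = matchingD[OF M T S nb]
  have mu: "\<mu> T = S" using M by (simp add: matching_def)
  have tau: "\<tau> S = T" using D(3) mu by simp
  have ty: "tile_type m S = tile_type n T" using D(6) mu by simp
  have "?\<rho> ` E \<in> edges tile_graph \<and> Tile m S \<in> ?\<rho> ` E \<and> raw_edge_label (?\<rho> ` E) = raw_edge_label E \<and> (\<forall>u \<in> E. ?\<tau> (?\<rho> u) = u)"
    if E: "E \<in> edges tile_graph" "Tile n T \<in> E" for E
    using T E
  proof (cases rule: star_cases)
    case up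
    then show ?thesis using vertical_edge[OF S] by (simp add: mu tau ty raw_edge_label_vertical)
  next
    case (down e)
    then have "e \<in> kids (tile_type m S)" using ty by simp
    with down show ?thesis using child_edge[OF S] T S by (simp add: mu tau raw_edge_label_child)
  next
    case (side T')
    then have nb': "T' \<in> neighbourhood n T" by (simp add: neighbourhood_def)
    note D' = matchingD[OF M T S nb']
    have "T \<noteq> T'" using side(1) by (simp add: adj_def)
    then have "adj m S (\<mu> T')" using D'(5,7) by (simp add: neighbourhood_def)
    then show ?thesis
      using horizontal_edge side D'(3) D'(4)[symmetric] pair_type_swap[OF D'(4)[symmetric]]
      by (simp add: mu tau raw_edge_label_horizontal)
  qed
  then show ?thesis unfolding label_morphism_def open_star_def using l tau mu by simp blast
qed

lemma star_isomorphic: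
  assumes v: "v \<in> verts tile_graph" and w: "w \<in> verts tile_graph" and l: "raw_vertex_label v = raw_vertex_label w"
  shows "labeled_isomorphic (open_star G v) (open_star G w)"
proof (cases v)
  case Origin
  then have "w = Origin" using l by (simp add: raw_vertex_label_def split: history_vertex.splits)
  then show ?thesis using Origin labeled_isomorphic_refl by simp
next
  case (Tile n T)
  then obtain m S where w': "w = Tile m S" using l by (cases w) (simp_all add: raw_vertex_label_def)
  have T: "T \<in> tiles n" and S: "S \<in> tiles m" using v w Tile w' by auto
  obtain \<mu> \<tau> where "matching n T m S \<mu> \<tau>" "matching m S n T \<tau> \<mu>"
    using same_label_matching[OF T S] l Tile w' by auto
  then show ?thesis
    using labeled_isomorphicI[OF star_morphism star_morphism] T S l Tile w' by simp
qed

text \<open>The image of an edge is again an edge or a single vertex, so an edge lies in the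
  preimage as soon as one of its ends lies over \<open>Tile n T\<close>.\<close>

lemma star_preimage:
  assumes T: "T \<in> tiles n"
  defines "P \<equiv> predecessor_preimage G layer (open_star G (Tile n T))"
  shows "verts P = {Tile (Suc n) (child n T e) | e. e \<in> kids (tile_type n T)}"
    and "edges P = {E \<in> edges tile_graph. \<exists>e \<in> kids (tile_type n T). Tile (Suc n) (child n T e) \<in> E}"
    and "vlabel P v = i (raw_vertex_label v)" "elabel P E = j (raw_edge_label E)"
proof -
  let ?\<pi> = "predecessor G layer"
  have pi: "?\<pi> v = Tile n T \<longleftrightarrow> (\<exists>e \<in> kids (tile_type n T). v = Tile (Suc n) (child n T e))"
    if v: "v \<in> verts tile_graph" for v
  proof
    assume eq: "?\<pi> v = Tile n T"
    then obtain k U where U: "v = Tile k U" by (cases v) auto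
    then have Uk: "U \<in> tiles k" using v by simp
    then have "up k U = Tile n T" using eq U by simp
    from arg_cong[OF this, of height] have k: "k = Suc n" by simp
    then obtain S e where S: "S \<in> tiles n" "e \<in> kids (tile_type n S)" "U = child n S e"
      using child_surj Uk by blast
    then show "\<exists>e \<in> kids (tile_type n T). v = Tile (Suc n) (child n T e)"
      using eq U k by auto
  qed (use T in auto)
  have E_verts: "E \<subseteq> verts tile_graph" if "E \<in> edges tile_graph" for E
    using that
  proof (cases rule: edge_cases)
    case (vertical n T)
    then show ?thesis using layer_subset[of n] up_in_layer[of T n] by auto
  qed (use adj_tiles in auto)
  show "verts P = {Tile (Suc n) (child n T e) | e. e \<in> kids (tile_type n T)}"
    unfolding P_def predecessor_preimage_def open_star_def
    using pi child_in[OF T] up_child[OF T] T by auto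
  show "vlabel P v = i (raw_vertex_label v)" "elabel P E = j (raw_edge_label E)"
    unfolding P_def predecessor_preimage_def by simp_all
  have key: "(?\<pi> ` E \<in> edges tile_graph \<and> Tile n T \<in> ?\<pi> ` E) \<or> ?\<pi> ` E = {Tile n T} \<longleftrightarrow>
      (\<exists>e \<in> kids (tile_type n T). Tile (Suc n) (child n T e) \<in> E)" if E: "E \<in> edges tile_graph" for E
  proof -
    have mem: "Tile n T \<in> ?\<pi> ` E \<longleftrightarrow> (\<exists>e \<in> kids (tile_type n T). Tile (Suc n) (child n T e) \<in> E)"
      using pi E_verts[OF E] by (auto simp: image_iff) (metis subsetD)+
    show ?thesis
    proof (cases "Tile n T \<in> ?\<pi> ` E")
      case True
      have "?\<pi> ` E \<in> edges tile_graph \<or> ?\<pi> ` E = {Tile n T}"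
        using predecessor_image_edge[OF E]
      proof
        assume "\<exists>u \<in> verts tile_graph. ?\<pi> ` E = {u}"
        then obtain u where "?\<pi> ` E = {u}" by blast
        with True show ?thesis by simp
      qed simp
      then show ?thesis using True mem by blast
    next
      case False
      then show ?thesis using mem by blast
    qed
  qed
  have "edges P = {E \<in> edges tile_graph.
      (?\<pi> ` E \<in> edges tile_graph \<and> Tile n T \<in> ?\<pi> ` E) \<or> ?\<pi> ` E = {Tile n T}}"
    by (simp add: P_def predecessor_preimage_def open_star_def)
  also have "\<dots> = {E \<in> edges tile_graph. \<exists>e \<in> kids (tile_type n T). Tile (Suc n) (child n T e) \<in> E}"
    by (intro Collect_cong conj_cong refl key)
  finally show "edges P = {E \<in> edges tile_graph. \<exists>e \<in> kids (tile_type n T). Tile (Suc n) (child n T e) \<in> E}" .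
qed

text \<open>Every edge of the preimage contains a child of \<open>T\<close>, and
  \<open>star_cases\<close> at that child leaves three kinds: to \<open>T\<close>, to a grandchild,
  or to an adjacent tile. The last kind is transported by \<open>lift\<close>, and
  \<open>matching_children\<close> preserves its records.\<close>

lemma star_preimage_morphism:
  assumes M: "matching n T m S \<mu> \<tau>" "matching m S n T \<tau> \<mu>" and T: "T \<in> tiles n" and S: "S \<in> tiles m"
  shows "label_morphism (tile_map n m \<mu> w) (tile_map m n \<tau> w')
    (predecessor_preimage G layer (open_star G (Tile n T)))
    (predecessor_preimage G layer (open_star G (Tile m S)))"
proof -
  let ?\<rho> = "tile_map n m \<mu> w" and ?\<tau> = "tile_map m n \<tau> w'"
  have nb: "T \<in> neighbourhood n T" by (simp add: neighbourhood_def)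
  note D = matchingD[OF M(1) T S nb]
  have mu: "\<mu> T = S" using M by (simp add: matching_def)
  have tau: "\<tau> S = T" using D(3) mu by simp
  have ty: "tile_type m S = tile_type n T" using D(6) mu by simp
  have "?\<rho> ` E \<in> edges tile_graph \<and> Tile (Suc m) (child m S e) \<in> ?\<rho> ` E \<and>
      raw_edge_label (?\<rho> ` E) = raw_edge_label E \<and> (\<forall>u \<in> E. ?\<tau> (?\<rho> u) = u)"
    if E: "E \<in> edges tile_graph" and e: "e \<in> kids (tile_type n T)" and TE: "Tile (Suc n) (child n T e) \<in> E" for E e
  proof -
    have eS: "e \<in> kids (tile_type m S)" using e ty by simp
    note C = child_in[OF T e] and CS = child_in[OF S eS]
    note r = tile_map_child[OF T e, of m \<mu> w] and r' = tile_map_child[OF S eS, of n \<tau> w']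
    show ?thesis
      using C E TE
    proof (cases rule: star_cases)
      case up
      then have "E = {Tile n T, Tile (Suc n) (child n T e)}" using up_child[OF T e] by simp
      then show ?thesis
        using child_edge[OF S eS] r r' T S e eS by (simp add: mu tau raw_edge_label_child)
    next
      case (down e')
      then have e': "e' \<in> kids (ktyp e)" using child_typ[OF T e] by simp
      then have "e' \<in> kids (tile_type (Suc m) (child m S e))" using child_typ[OF S eS] by simp
      then show ?thesis
        using child_edge[OF CS, of e'] down r r' raw_edge_label_child[OF CS, of e'] raw_edge_label_child[OF C, of e']
          tile_map_grandchild[OF T e e', of m \<mu> w] tile_map_grandchild[OF S eS e', of n \<tau> w']
        by (simp add: mu tau)
    next
      case (side U)
      note MC = matching_children[OF M(1) T S e side(1)]
      have rU: "?\<rho> (Tile (Suc n) U) = Tile (Suc m) (lift n m \<mu> U)" by (simp add: tile_map_def)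
      have rU': "?\<tau> (Tile (Suc m) (lift n m \<mu> U)) = Tile (Suc n) U" using MC(3) by (simp add: tile_map_def)
      show ?thesis
        using side r r' rU rU' horizontal_edge[OF MC(1)] MC(2) pair_type_swap[OF MC(2)]
        by (simp add: mu tau raw_edge_label_horizontal)
    qed
  qed
  moreover have "raw_vertex_label (Tile (Suc m) (child m S e)) = raw_vertex_label (Tile (Suc n) (child n T e))"
    if "e \<in> kids (tile_type n T)" for e
    using raw_vertex_label_child[OF M T S that] by simp
  ultimately show ?thesis
    unfolding label_morphism_def star_preimage[OF T] star_preimage[OF S] ty
    using T S by (auto simp: mu tau ty) blast
qed

lemma star_preimage_isomorphic:
  assumes v: "v \<in> verts tile_graph" and w: "w \<in> verts tile_graph" and l: "raw_vertex_label v = raw_vertex_label w"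
  shows "labeled_isomorphic (predecessor_preimage G layer (open_star G v)) (predecessor_preimage G layer (open_star G w))"
proof (cases v)
  case Origin
  then have "w = Origin" using l by (simp add: raw_vertex_label_def split: history_vertex.splits)
  then show ?thesis using Origin labeled_isomorphic_refl by simp
next
  case (Tile n T)
  then obtain m S where w': "w = Tile m S" using l by (cases w) (simp_all add: raw_vertex_label_def)
  have T: "T \<in> tiles n" and S: "S \<in> tiles m" using v w Tile w' by auto
  obtain \<mu> \<tau> where "matching n T m S \<mu> \<tau>" "matching m S n T \<tau> \<mu>"
    using same_label_matching[OF T S] l Tile w' by auto
  then show ?thesis
    using labeled_isomorphicI[OF star_preimage_morphism star_preimage_morphism] T S Tile w' by simp
qed

section \<open>Preimages of open edges\<close>

lemma edge_preimage:
  "verts (predecessor_preimage G layer (open_edge G E)) = {}"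
  "edges (predecessor_preimage G layer (open_edge G E)) = {F \<in> edges tile_graph. predecessor G layer ` F = E}"
  "vlabel (predecessor_preimage G layer (open_edge G E)) v = i (raw_vertex_label v)"
  "elabel (predecessor_preimage G layer (open_edge G E)) F = j (raw_edge_label F)"
  by (auto simp: predecessor_preimage_def open_edge_def)

text \<open>The ends of a horizontal edge have predecessors of equal height, so only vertical edges
  can lie over a vertical one, and these move up by one level.\<close>

lemma vertical_preimage:
  assumes T: "T \<in> tiles n" and F: "F \<in> edges tile_graph" "predecessor G layer ` F = {up n T, Tile n T}"
  obtains e where "e \<in> kids (tile_type n T)" "F = {Tile n T, Tile (Suc n) (child n T e)}"
  using F(1)
proof (cases rule: edge_cases)
  case (horizontal k A B)
  then have "predecessor G layer ` F = {up k A, up k B}" using adj_tiles by simp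
  then have "{up k A, up k B} = {up n T, Tile n T}" using F(2) by simp
  from arg_cong[OF this, of "image height"] have "{k} = {n, Suc n}"
    by (simp only: image_insert image_empty height_up height.simps insert_absorb2)
  then have "n \<in> {k}" "Suc n \<in> {k}" by blast+
  then show ?thesis by simp
next
  case (vertical k U)
  show ?thesis
  proof (cases k)
    case 0
    then have "predecessor G layer ` F = {Origin}" using vertical by (simp add: up_def)
    then show ?thesis using F(2) by auto
  next
    case (Suc k')
    obtain A e where A: "A \<in> tiles k'" "e \<in> kids (tile_type k' A)" "U = child k' A e"
      using child_surj vertical Suc by blast
    have "predecessor G layer ` F = {up k' A, Tile k' A}" using vertical Suc A by (simp add: up_child)
    then have "k' = n \<and> A = T" using F(2) up_eq_iff by simp
    then show ?thesis using that[of e] A vertical Suc by (simp add: up_child)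
  qed
qed

lemma horizontal_preimage:
  assumes T: "T \<noteq> T'" and F: "F \<in> edges tile_graph" "predecessor G layer ` F = {Tile n T, Tile n T'}"
  obtains e e' where "T \<in> tiles n" "e \<in> kids (tile_type n T)" "T' \<in> tiles n" "e' \<in> kids (tile_type n T')"
    "F = {Tile (Suc n) (child n T e), Tile (Suc n) (child n T' e')}"
    "adj (Suc n) (child n T e) (child n T' e')"
  using F(1)
proof (cases rule: edge_cases)
  case (horizontal k A B)
  then have t: "A \<in> tiles k" "B \<in> tiles k" using adj_tiles by auto
  then have im: "predecessor G layer ` F = {up k A, up k B}" using horizontal by simp
  then have "{up k A, up k B} = {Tile n T, Tile n T'}" using F(2) by simp
  from arg_cong[OF this, of "image height"] have "{k} = {Suc n}" by simp
  then have k: "k = Suc n" by simp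
  obtain A' e where A: "A' \<in> tiles n" "e \<in> kids (tile_type n A')" "A = child n A' e"
    using child_surj t k by blast
  obtain B' e' where B: "B' \<in> tiles n" "e' \<in> kids (tile_type n B')" "B = child n B' e'"
    using child_surj t k by blast
  have "{Tile n A', Tile n B'} = {Tile n T, Tile n T'}" using im F(2) k A B by (simp add: up_child)
  then have "(A' = T \<and> B' = T') \<or> (A' = T' \<and> B' = T)" by (auto simp: doubleton_eq_iff)
  then show ?thesis
  proof
    assume "A' = T \<and> B' = T'"
    then show ?thesis using that[of e e'] A B horizontal k by simp
  next
    assume "A' = T' \<and> B' = T"
    then show ?thesis using that[of e' e] A B horizontal k adj_sym by (simp add: insert_commute)
  qed
next
  case (vertical k U)
  show ?thesis
  proof (cases k)
    case 0
    then have "predecessor G layer ` F = {Origin}" using vertical by (simp add: up_def)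
    then show ?thesis using F(2) by auto
  next
    case (Suc k')
    obtain A e where A: "A \<in> tiles k'" "e \<in> kids (tile_type k' A)" "U = child k' A e"
      using child_surj vertical Suc by blast
    have "predecessor G layer ` F = {up k' A, Tile k' A}" using vertical Suc A by (simp add: up_child)
    then show ?thesis using F(2) up_neq_horizontal by metis
  qed
qed

text \<open>The preimage consists of edges from \<open>T\<close> to its children, so only the value
  of the map at \<open>T\<close> counts, and a constant map is enough.\<close>

lemma vertical_preimage_morphism:
  assumes T: "T \<in> tiles n" and S: "S \<in> tiles m" and ty: "tile_type n T = tile_type m S"
  shows "label_morphism (tile_map n m (\<lambda>_. S) w) (tile_map m n (\<lambda>_. T) w')
    (predecessor_preimage G layer (open_edge G {up n T, Tile n T}))
    (predecessor_preimage G layer (open_edge G {up m S, Tile m S}))"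
proof -
  let ?\<rho> = "tile_map n m (\<lambda>_. S) w" and ?\<tau> = "tile_map m n (\<lambda>_. T) w'"
  have "?\<rho> ` F \<in> edges tile_graph \<and> predecessor G layer ` ?\<rho> ` F = {up m S, Tile m S} \<and>
    raw_edge_label (?\<rho> ` F) = raw_edge_label F \<and> (\<forall>u \<in> F. ?\<tau> (?\<rho> u) = u)"
    if F: "F \<in> edges tile_graph" "predecessor G layer ` F = {up n T, Tile n T}" for F
  proof -
    obtain e where e: "e \<in> kids (tile_type n T)" "F = {Tile n T, Tile (Suc n) (child n T e)}"
      using vertical_preimage[OF T F] .
    then have "e \<in> kids (tile_type m S)" using ty by simp
    then show ?thesis
      using e T S child_edge[OF S] by (simp add: raw_edge_label_child)
  qed
  then show ?thesis unfolding label_morphism_def edge_preimage by simp blast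
qed

lemma horizontal_preimage_morphism:
  assumes T: "adj n T T'" and S: "adj m S S'" and p: "pair_type n T T' = pair_type m S S'"
  shows "label_morphism (tile_map n m (\<lambda>U. if U = T then S else S') w) (tile_map m n (\<lambda>U. if U = S then T else T') w')
    (predecessor_preimage G layer (open_edge G {Tile n T, Tile n T'}))
    (predecessor_preimage G layer (open_edge G {Tile m S, Tile m S'}))"
proof -
  let ?\<rho> = "tile_map n m (\<lambda>U. if U = T then S else S') w" and ?\<tau> = "tile_map m n (\<lambda>U. if U = S then T else T') w'"
  have ne: "T \<noteq> T'" "S \<noteq> S'" using T S by (auto simp: adj_def)
  have St: "S \<in> tiles m" "S' \<in> tiles m" using S adj_tiles by auto
  have "?\<rho> ` F \<in> edges tile_graph \<and> predecessor G layer ` ?\<rho> ` F = {Tile m S, Tile m S'} \<and>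
    raw_edge_label (?\<rho> ` F) = raw_edge_label F \<and> (\<forall>u \<in> F. ?\<tau> (?\<rho> u) = u)"
    if F: "F \<in> edges tile_graph" "predecessor G layer ` F = {Tile n T, Tile n T'}" for F
  proof -
    obtain e e' where e: "T \<in> tiles n" "e \<in> kids (tile_type n T)" "T' \<in> tiles n" "e' \<in> kids (tile_type n T')"
      "F = {Tile (Suc n) (child n T e), Tile (Suc n) (child n T' e')}"
      "adj (Suc n) (child n T e) (child n T' e')"
      using horizontal_preimage[OF ne(1) F] .
    then have eS: "e \<in> kids (tile_type m S)" "e' \<in> kids (tile_type m S')" using p by (auto simp: pair_type_def)
    have "T = T' \<longleftrightarrow> S = S'" using ne by simp
    note C = children_match[OF e(1,3) St p this e(2,4)]
    have adjS: "adj (Suc m) (child m S e) (child m S' e')" using C(2) e(6) by simp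
    show ?thesis
      using e St eS ne horizontal_edge[OF adjS] C(1)[symmetric] pair_type_swap[OF C(1)[symmetric]]
      by (simp add: raw_edge_label_horizontal)
  qed
  then show ?thesis unfolding label_morphism_def edge_preimage by simp blast
qed

lemma edge_preimage_isomorphic:
  assumes E: "E \<in> edges tile_graph" and E': "E' \<in> edges tile_graph" and l: "raw_edge_label E = raw_edge_label E'"
  shows "labeled_isomorphic (predecessor_preimage G layer (open_edge G E)) (predecessor_preimage G layer (open_edge G E'))"
  using E
proof (cases rule: edge_cases)
  case (horizontal n T T')
  note h = horizontal
  from E' show ?thesis
  proof (cases rule: edge_cases)
    case (horizontal m S S')
    have "{pair_type n T T', pair_type n T' T} = {pair_type m S S', pair_type m S' S}"
      using l h horizontal by (simp add: raw_edge_label_horizontal)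
    \<comment> \<open>Equal sets of records fix the pair up to the order of its ends, which may have
      to be exchanged.\<close>
    then have "pair_type n T T' = pair_type m S S' \<or> pair_type n T T' = pair_type m S' S"
      by (auto simp: doubleton_eq_iff)
    then obtain A B where A: "E' = {Tile m A, Tile m B}" "adj m A B" "pair_type n T T' = pair_type m A B"
      using horizontal adj_sym[of m S S'] by (auto simp: insert_commute)
    show ?thesis
      unfolding h(1) A(1)
      by (rule labeled_isomorphicI[OF horizontal_preimage_morphism[OF h(2) A(2,3)]
            horizontal_preimage_morphism[OF A(2) h(2) A(3)[symmetric]]])
  next
    case (vertical m S)
    then show ?thesis using h l by (simp add: raw_edge_label_horizontal raw_edge_label_vertical)
  qed
next
  case (vertical n T)
  note h = vertical
  from E' show ?thesis
  proof (cases rule: edge_cases)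
    case (horizontal m S S')
    then show ?thesis using h l by (simp add: raw_edge_label_horizontal raw_edge_label_vertical)
  next
    case (vertical m S)
    then have ty: "tile_type n T = tile_type m S" using h l by (simp add: raw_edge_label_vertical)
    show ?thesis
      unfolding h(1) vertical(1)
      by (rule labeled_isomorphicI[OF vertical_preimage_morphism[OF h(2) vertical(2) ty]
            vertical_preimage_morphism[OF vertical(2) h(2) ty[symmetric]]])
  qed
qed

end

context tile_system
begin

text \<open>By \<open>bounded_degree\<close> the counting functions take values up to a uniform
  \<open>N\<close>, and they vanish outside the finite set \<open>?P\<close> of possible records;
  there are finitely many such functions.\<close>

lemma finite_raw_labels:
  "finite (raw_vertex_label ` verts tile_graph)" "finite (raw_edge_label ` edges tile_graph)"
proof -
  obtain N where N: "\<And>n T. card {T'. adj n T T'} \<le> N" using bounded_degree by blast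
  let ?P = "types \<times> types \<times> Pow (all_faces \<times> all_faces)"
  have finP: "finite ?P" using finite_types finite_all_faces by simp
  have P: "pair_type n T T' \<in> ?P" if "T \<in> tiles n" "T' \<in> tiles n" for n T T'
    using typ_in faces_subset that by (force simp: pair_type_def gluing_def)
  let ?C = "{c. \<forall>p. (p \<in> ?P \<longrightarrow> c p \<in> {..N}) \<and> (p \<notin> ?P \<longrightarrow> c p = (0::nat))}"
  have finC: "finite ?C" by (rule finite_set_of_finite_funs[OF finP]) simp
  have C: "(\<lambda>p. card {T'. adj n T T' \<and> pair_type n T T' = p}) \<in> ?C" for n T
  proof (intro CollectI allI conjI impI)
    fix p
    have "card {T'. adj n T T' \<and> pair_type n T T' = p} \<le> card {T'. adj n T T'}"
      by (intro card_mono finite_adj) auto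
    then show "card {T'. adj n T T' \<and> pair_type n T T' = p} \<in> {..N}" using N[of n T] by simp
    assume "p \<notin> ?P"
    then have "{T'. adj n T T' \<and> pair_type n T T' = p} = {}" using P adj_tiles by blast
    then show "card {T'. adj n T T' \<and> pair_type n T T' = p} = 0" by (simp only: card.empty)
  qed
  have "raw_vertex_label v \<in> insert None (Some ` (?P \<times> ?C))" if v: "v \<in> verts tile_graph" for v
  proof (cases v)
    case (Tile n T)
    then have "raw_vertex_label v = Some (pair_type n T T, \<lambda>p. card {T'. adj n T T' \<and> pair_type n T T' = p})"
      by (simp add: raw_vertex_label_def)
    moreover have "pair_type n T T \<in> ?P" by (rule P) (use v Tile in simp_all)
    ultimately show ?thesis using C[of n T] by (simp only: insert_iff image_eqI[OF refl] SigmaI simp_thms)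
  qed (simp add: raw_vertex_label_def)
  then have "raw_vertex_label ` verts tile_graph \<subseteq> insert None (Some ` (?P \<times> ?C))"
    by (rule image_subsetI)
  moreover have "finite (insert None (Some ` (?P \<times> ?C)))"
    by (intro finite.insertI finite_imageI finite_SigmaI finP finC)
  ultimately show "finite (raw_vertex_label ` verts tile_graph)" by (rule finite_subset)
  have "raw_edge_label E \<in> Pow ?P \<times> Pow types" if "E \<in> edges tile_graph" for E
    using that
  proof (cases rule: edge_cases)
    case (horizontal n T T')
    then show ?thesis using P adj_tiles[of n T T'] by (simp add: raw_edge_label_horizontal)
  next
    case (vertical n T)
    then show ?thesis using typ_in by (simp add: raw_edge_label_vertical)
  qed
  then have "raw_edge_label ` edges tile_graph \<subseteq> Pow ?P \<times> Pow types"
    by (rule image_subsetI)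
  moreover have "finite (Pow ?P \<times> Pow types)"
    using finP finite_types by (simp only: finite_SigmaI finite_Pow_iff)
  ultimately show "finite (raw_edge_label ` edges tile_graph)" by (rule finite_subset)
qed

theorem tile_graph_combinatorial:
  "\<exists>(vl :: 'x history_vertex \<Rightarrow> nat) (el :: 'x history_vertex set \<Rightarrow> nat).
     combinatorial_subdivision_rule (with_labels tile_graph vl el) layer"
proof -
  obtain i :: "_ \<Rightarrow> nat" where i: "inj_on i (raw_vertex_label ` verts tile_graph)"
    using finite_imp_inj_to_nat_seg[OF finite_raw_labels(1)] by blast
  obtain j :: "_ \<Rightarrow> nat" where j: "inj_on j (raw_edge_label ` edges tile_graph)"
    using finite_imp_inj_to_nat_seg[OF finite_raw_labels(2)] by blast
  define G where "G = with_labels tile_graph (i \<circ> raw_vertex_label) (j \<circ> raw_edge_label)"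
  interpret L: labeled_tile_system tiles tile_type types faces face kids child ktyp sub G i j
    by unfold_locales (simp add: G_def)
  have vi: "raw_vertex_label v = raw_vertex_label w"
    if "v \<in> verts tile_graph" "w \<in> verts tile_graph" "vlabel G v = vlabel G w" for v w
    using that i by (simp add: inj_on_eq_iff)
  have ej: "raw_edge_label v = raw_edge_label w"
    if "v \<in> edges tile_graph" "w \<in> edges tile_graph" "elabel G v = elabel G w" for v w
    using that j by (simp add: inj_on_eq_iff)
  have E: "E \<subseteq> verts tile_graph \<and> card E = 2" if "E \<in> edges tile_graph" for E
    using that
  proof (cases rule: edge_cases)
    case (horizontal n T T')
    then have "T \<in> tiles n" "T' \<in> tiles n" "T \<noteq> T'" by (simp_all add: adj_def)
    then show ?thesis by (simp add: horizontal(1))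
  next
    case (vertical n T)
    have "up n T \<in> verts tile_graph"
      by (rule subsetD[OF layer_subset up_in_layer[OF vertical(2)]])
    then show ?thesis using vertical by simp
  qed
  have "combinatorial_subdivision_rule G layer"
    unfolding combinatorial_subdivision_rule_def
  proof (intro conjI)
    show "simple_graph G" using E by (simp add: simple_graph_def)
    show "finitely_labeled G"
    proof -
      have "vlabel G ` verts G = i ` raw_vertex_label ` verts tile_graph"
        "elabel G ` edges G = j ` raw_edge_label ` edges tile_graph"
        by (auto simp: image_image)
      then show ?thesis unfolding finitely_labeled_def using finite_raw_labels by simp
    qed
    show "\<forall>n. simple_graph (layer n) \<and> verts (layer n) \<subseteq> verts G \<and> edges (layer n) \<subseteq> edges G"
    proof
      fix n
      have "edges (layer n) \<subseteq> edges tile_graph" by (cases n) (auto simp: layer_def tile_graph_def)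
      moreover have "E \<subseteq> verts (layer n)" if "E \<in> edges (layer n)" for E
        using that by (cases n) (auto simp: layer_def adj_def)
      ultimately show "simple_graph (layer n) \<and> verts (layer n) \<subseteq> verts G \<and> edges (layer n) \<subseteq> edges G"
        using E layer_subset[of n] by (auto simp: simple_graph_def)
    qed
    show "\<forall>m n. m \<noteq> n \<longrightarrow> verts (layer m) \<inter> verts (layer n) = {}"
      using height_layer by (metis disjoint_iff)
    show "\<exists>v. verts (layer 0) = {v}" by (simp add: layer_def)
    show "verts G \<subseteq> (\<Union>n. verts (layer n))"
    proof
      fix v assume v: "v \<in> verts G"
      show "v \<in> (\<Union>n. verts (layer n))"
      proof (cases v)
        case Origin
        then have "v \<in> verts (layer 0)" by simp
        then show ?thesis by blast
      next
        case (Tile n T)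
        then have "v \<in> verts (layer (Suc n))" using v by simp
        then show ?thesis by blast
      qed
    qed
    show "\<forall>n. \<forall>v\<in>verts (layer (Suc n)). \<exists>!u. u \<in> verts (layer n) \<and> {u, v} \<in> edges G"
    proof (intro allI ballI)
      fix n v assume "v \<in> verts (layer (Suc n))"
      then obtain T where T: "T \<in> tiles n" "v = Tile n T" by auto
      show "\<exists>!u. u \<in> verts (layer n) \<and> {u, v} \<in> edges G"
        unfolding T(2) L.G_simps below_unique[OF T(1)] by simp
    qed
    show "\<forall>v\<in>verts G. \<forall>w\<in>verts G. vlabel G v = vlabel G w \<longrightarrow> labeled_isomorphic (open_star G v) (open_star G w)"
      by (intro ballI impI L.star_isomorphic vi) simp_all
    show "\<forall>e\<in>edges G. predecessor G layer ` e \<in> edges G \<or> (\<exists>u\<in>verts G. predecessor G layer ` e = {u})"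
      using L.predecessor_image_edge by (simp only: L.G_simps) blast
    show "\<forall>e\<in>edges G. \<forall>e'\<in>edges G. elabel G e = elabel G e' \<longrightarrow>
        labeled_isomorphic (predecessor_preimage G layer (open_edge G e)) (predecessor_preimage G layer (open_edge G e'))"
      by (intro ballI impI L.edge_preimage_isomorphic ej) simp_all
    show "\<forall>v\<in>verts G. \<forall>w\<in>verts G. vlabel G v = vlabel G w \<longrightarrow>
        labeled_isomorphic (predecessor_preimage G layer (open_star G v)) (predecessor_preimage G layer (open_star G w))"
      by (intro ballI impI L.star_preimage_isomorphic vi) simp_all
  qed
  then show ?thesis unfolding G_def by (intro exI)
qed

end

section \<open>Finite subdivision rules\<close>

text \<open>The last clause of \<open>almost_polyhedral\<close> for a single tile, named so that one
  complex and one map can be chosen for it.\<close>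

definition disk_model ::
    "nat \<Rightarrow> 'a cell_complex \<Rightarrow> 'a set \<Rightarrow> (nat \<Rightarrow> real) cell_complex \<Rightarrow> ((nat \<Rightarrow> real) \<Rightarrow> 'a) \<Rightarrow> bool" where
  "disk_model d Z c s \<psi> \<longleftrightarrow>
     cw_complex s \<and> cspace s = closed_disk d \<and> open_disk d \<in> cells s d \<and>
     (\<forall>e \<in> all_cells s. e = open_disk d \<or> e \<subseteq> disk_boundary d) \<and>
     characteristic_map Z d c \<psi> \<and> \<psi> ` topspace (closed_disk d) = closed_cell Z c \<and>
     homeomorphic_on_cells s Z \<psi>"

locale fixed_subdivision_rule =
  fixes d :: nat and R :: "'s subdivision_rule"
  assumes rule: "finite_subdivision_rule d R"
begin

abbreviation "S \<equiv> base R"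
abbreviation "S' \<equiv> base_subdivision R"
abbreviation "\<phi> \<equiv> subdivision_map R"
abbreviation "D \<equiv> topspace (closed_disk d)"

section \<open>The base complex and its subdivision\<close>

lemma S_cw: "cw_complex S" and S_finite: "finite_complex S" and S_dim: "has_dimension S d"
  and S_model: "c \<in> cells S d \<Longrightarrow> \<exists>s \<psi>. disk_model d S c s \<psi>"
  and S'_cw: "cw_complex S'" and S'_finite: "finite_complex S'" and S'_dim: "has_dimension S' d"
  and S'_space: "cspace S' = cspace S"
  and phi_cellular: "cellular_map S' S \<phi>" and phi_homeo: "homeomorphic_on_cells S' S \<phi>"
  and ideal_cells: "ideal_cells R \<subseteq> all_cells S"
  and phi_ideal: "\<phi> ` \<Union>(ideal_cells R) \<subseteq> \<Union>(ideal_cells R)"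
  using rule
  unfolding finite_subdivision_rule_def almost_polyhedral_def subdivision_of_def disk_model_def
  by simp_all

lemma S'_subdivides:
  assumes "e \<in> cells S' k"
  obtains j c where "c \<in> cells S j" "e \<subseteq> c"
proof -
  have "\<forall>c' \<in> all_cells S'. \<exists>c \<in> all_cells S. c' \<subseteq> c"
    using rule unfolding finite_subdivision_rule_def subdivision_of_def by simp
  moreover have "e \<in> all_cells S'" using assms by (auto simp: all_cells_def)
  ultimately obtain c where "c \<in> all_cells S" "e \<subseteq> c" by blast
  then show ?thesis using that by (auto simp: all_cells_def)
qed

lemma S_dim_le: "c \<in> cells S k \<Longrightarrow> k \<le> d"
  using S_dim unfolding has_dimension_def by (cases "d < k") auto

lemma S'_dim_le: "c \<in> cells S' k \<Longrightarrow> k \<le> d"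
  using S'_dim unfolding has_dimension_def by (cases "d < k") auto

lemma phi_cont: "continuous_map (cspace S) (cspace S) \<phi>"
  using phi_cellular unfolding cellular_map_def S'_space by simp

lemma phi_cell:
  assumes "e \<in> cells S' k"
  shows "\<phi> ` e \<in> cells S k" "inj_on \<phi> e"
    "homeomorphic_map (subtopology (cspace S) e) (subtopology (cspace S) (\<phi> ` e)) \<phi>"
  using homeomorphic_on_cells_image[OF phi_homeo S'_cw S_cw assms] unfolding S'_space by simp_all

text \<open>\<open>\<phi>\<close> is injective on each of finitely many cells. Finite fibres are the
  hypothesis on which the lifting rests.\<close>

lemma finite_phi_fibre: "finite {y \<in> topspace (cspace S). \<phi> y = x}"
proof (rule finite_subset)
  show "{y \<in> topspace (cspace S). \<phi> y = x} \<subseteq> (\<Union>e \<in> all_cells S'. {y \<in> e. \<phi> y = x})"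
    using cw_topspace[OF S'_cw] unfolding S'_space by auto
  have "finite {y \<in> e. \<phi> y = x}" if "e \<in> all_cells S'" for e
  proof -
    have "inj_on \<phi> e" using that phi_cell(2) by (auto simp: all_cells_def)
    then show ?thesis
      using finite_vimage_IntI[of "{x}" \<phi> e] by (simp add: vimage_def Int_def conj_commute)
  qed
  then show "finite (\<Union>e \<in> all_cells S'. {y \<in> e. \<phi> y = x})"
    using S'_finite by (simp add: finite_complex_def)
qed

text \<open>One model per tile type, shared by all tiles of that type in all subdivisions; faces of
  different tiles thereby get comparable names.\<close>

definition disk_complex :: "'s set \<Rightarrow> (nat \<Rightarrow> real) cell_complex" where
  "disk_complex t = (SOME s. \<exists>\<psi>. disk_model d S t s \<psi>)"

definition chart :: "'s set \<Rightarrow> (nat \<Rightarrow> real) \<Rightarrow> 's" where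
  "chart t = (SOME \<psi>. disk_model d S t (disk_complex t) \<psi>)"

lemma chart_model:
  assumes "t \<in> cells S d"
  shows "disk_model d S t (disk_complex t) (chart t)"
proof -
  have "\<exists>\<psi>. disk_model d S t (disk_complex t) \<psi>"
    unfolding disk_complex_def by (rule someI_ex[OF S_model[OF assms]])
  then show ?thesis unfolding chart_def by (rule someI_ex)
qed

section \<open>The model disk of a tile type\<close>

context
  fixes t assumes t: "t \<in> cells S d"
begin

lemma disk_complex_cw: "cw_complex (disk_complex t)"
  and disk_complex_space: "cspace (disk_complex t) = closed_disk d"
  and disk_complex_interior: "open_disk d \<in> cells (disk_complex t) d"
  and disk_complex_cells: "b \<in> all_cells (disk_complex t) \<Longrightarrow> b = open_disk d \<or> b \<subseteq> disk_boundary d"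
  and chart_characteristic: "characteristic_map S d t (chart t)"
  and chart_homeo_cells: "homeomorphic_on_cells (disk_complex t) S (chart t)"
  using chart_model[OF t] unfolding disk_model_def by simp_all

lemma chart_cont: "continuous_map (closed_disk d) (cspace S) (chart t)"
  and chart_homeo: "homeomorphic_map (subtopology (closed_disk d) (open_disk d)) (subtopology (cspace S) t) (chart t)"
  using chart_characteristic unfolding characteristic_map_def by simp_all

lemma chart_interior: "chart t ` open_disk d = t" "inj_on (chart t) (open_disk d)"
  using charmap_image[OF S_cw chart_characteristic t] by simp_all

lemma chart_cell:
  assumes "b \<in> cells (disk_complex t) k"
  shows "chart t ` b \<in> cells S k" "inj_on (chart t) b"
  using homeomorphic_on_cells_image[OF chart_homeo_cells disk_complex_cw S_cw assms] by simp_all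

lemma disk_cell_subset: "b \<in> cells (disk_complex t) k \<Longrightarrow> b \<subseteq> D"
  using cw_cell_subset[OF disk_complex_cw] unfolding disk_complex_space by simp

lemma disk_cell_cover:
  assumes "y \<in> D"
  obtains k b where "b \<in> cells (disk_complex t) k" "y \<in> b"
  using cw_cell_cover[OF disk_complex_cw, of y] assms that unfolding disk_complex_space by blast

lemma chart_boundary:
  assumes "x \<in> disk_boundary d"
  obtains k c where "k < d" "c \<in> cells S k" "chart t x \<in> c"
proof -
  obtain F where "F \<subseteq> (\<Union>j<d. cells S j)" "chart t ` disk_boundary d \<subseteq> \<Union>F"
    using chart_characteristic unfolding characteristic_map_def by blast
  then show ?thesis using assms that by blast
qed

text \<open>A further d-cell would lie in the boundary sphere, which the characteristic map sends
  into cells of lower dimension, while the chart preserves dimensions of cells.\<close>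

lemma disk_top_cell:
  assumes b: "b \<in> cells (disk_complex t) d"
  shows "b = open_disk d"
proof (rule ccontr)
  assume "b \<noteq> open_disk d"
  then have sub: "b \<subseteq> disk_boundary d" using disk_complex_cells b by (auto simp: all_cells_def)
  obtain x where x: "x \<in> b" using cw_cell_connected(2)[OF disk_complex_cw b] by blast
  then obtain k c where c: "k < d" "c \<in> cells S k" "chart t x \<in> c"
    using chart_boundary sub by blast
  show False using cw_disjoint[OF S_cw chart_cell(1)[OF b] c(2) imageI[OF x] c(3)] c(1) by simp
qed

text \<open>Closure finiteness for the interior cell, whose closure is the entire disk.\<close>

lemma finite_disk_cells: "finite (all_cells (disk_complex t))"
proof -
  obtain F where F: "finite F" "F \<subseteq> (\<Union>j<d. cells (disk_complex t) j)"
      "closed_cell (disk_complex t) (open_disk d) \<subseteq> open_disk d \<union> \<Union>F"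
    using cw_closure_cell(1)[OF disk_complex_cw disk_complex_interior] by blast
  have cover: "D \<subseteq> open_disk d \<union> \<Union>F"
    using F(3) unfolding closed_cell_def disk_complex_space closure_of_open_disk .
  have "b \<in> insert (open_disk d) F" if b': "b \<in> all_cells (disk_complex t)" for b
  proof -
    obtain k where b: "b \<in> cells (disk_complex t) k" using b' by (auto simp: all_cells_def)
    obtain x where x: "x \<in> b" using cw_cell_connected(2)[OF disk_complex_cw b] by blast
    then have "x \<in> open_disk d \<union> \<Union>F" using cover disk_cell_subset[OF b] by blast
    then show ?thesis
    proof
      assume "x \<in> open_disk d"
      then show ?thesis using cw_disjoint[OF disk_complex_cw b disk_complex_interior x] by simp
    next
      assume "x \<in> \<Union>F"
      then obtain a j where a: "a \<in> F" "x \<in> a" "a \<in> cells (disk_complex t) j" using F(2) by blast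
      then show ?thesis using cw_disjoint[OF disk_complex_cw b a(3) x a(2)] by simp
    qed
  qed
  then have "all_cells (disk_complex t) \<subseteq> insert (open_disk d) F" by (rule subsetI)
  then show ?thesis using F(1) by (simp add: finite_subset)
qed

lemma finite_chart_fibre: "finite {y \<in> D. chart t y = x}"
proof (rule finite_subset)
  show "{y \<in> D. chart t y = x} \<subseteq> (\<Union>b \<in> all_cells (disk_complex t). {y \<in> b. chart t y = x})"
    using cw_topspace[OF disk_complex_cw] unfolding disk_complex_space by auto
  have "finite {y \<in> b. chart t y = x}" if "b \<in> all_cells (disk_complex t)" for b
  proof -
    have "inj_on (chart t) b" using that chart_cell(2) by (auto simp: all_cells_def)
    then show ?thesis
      using finite_vimage_IntI[of "{x}" "chart t" b] by (simp add: vimage_def Int_def conj_commute)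
  qed
  then show "finite (\<Union>b \<in> all_cells (disk_complex t). {y \<in> b. chart t y = x})"
    using finite_disk_cells by simp
qed

end

text \<open>Empty for \<open>d = 0\<close>, where there is no codimension 1 and the dual graphs have
  no edges.\<close>

definition tile_faces :: "'s set \<Rightarrow> (nat \<Rightarrow> real) set set" where
  "tile_faces t = {b. \<exists>k. d = Suc k \<and> b \<in> cells (disk_complex t) k}"

lemma tile_facesI: "d = Suc k \<Longrightarrow> b \<in> cells (disk_complex t) k \<Longrightarrow> b \<in> tile_faces t"
  unfolding tile_faces_def by blast

lemma tile_facesD:
  assumes "b \<in> tile_faces t" "d = Suc k"
  shows "b \<in> cells (disk_complex t) k"
proof -
  obtain l where l: "d = Suc l" "b \<in> cells (disk_complex t) l" using assms(1) by (auto simp: tile_faces_def)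
  then have "l = k" using assms(2) by (simp only: nat.inject)
  then show ?thesis using l by simp
qed

lemma finite_tile_faces: "t \<in> cells S d \<Longrightarrow> finite (tile_faces t)"
  by (rule finite_subset[OF _ finite_disk_cells]) (auto simp: tile_faces_def all_cells_def)

subsection \<open>Lifting the charts of the subdivided tiles\<close>

text \<open>Parametrises, by the model disk of the child's type, the part of the model disk of
  \<open>t\<close> that belongs to \<open>e\<close>: a lift of the child's chart through
  \<open>\<phi> \<circ> chart t\<close>.\<close>

definition child_chart :: "'s set \<Rightarrow> 's set \<Rightarrow> (nat \<Rightarrow> real) \<Rightarrow> nat \<Rightarrow> real" where
  "child_chart t e = (SOME k. continuous_map (closed_disk d) (closed_disk d) k \<and>
     (\<forall>x \<in> D. (\<phi> \<circ> chart t) (k x) = chart (\<phi> ` e) x) \<and>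
     homeomorphic_map (subtopology (closed_disk d) (open_disk d))
       (subtopology (closed_disk d) {x \<in> open_disk d. chart t x \<in> e}) k)"

context
  fixes t e assumes t: "t \<in> cells S d" and e: "e \<in> cells S' d" and et: "e \<subseteq> t"
begin

lemma child_chart_ex:
  "\<exists>k. continuous_map (closed_disk d) (closed_disk d) k \<and>
     (\<forall>x \<in> D. (\<phi> \<circ> chart t) (k x) = chart (\<phi> ` e) x) \<and>
     homeomorphic_map (subtopology (closed_disk d) (open_disk d))
       (subtopology (closed_disk d) {x \<in> open_disk d. chart t x \<in> e}) k"
proof (rule lift_disk_map[OF compact_space_closed_disk Hausdorff_closed_disk])
  let ?W = "{x \<in> open_disk d. chart t x \<in> e}"
  have et': "\<phi> ` e \<in> cells S d" by (rule phi_cell(1)[OF e])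
  show "?W \<subseteq> D" using open_disk_subset by blast
  show "continuous_map (closed_disk d) (cspace S) (\<phi> \<circ> chart t)"
    using chart_cont[OF t] phi_cont by (rule continuous_map_compose)
  have "homeomorphic_map (subtopology (subtopology (closed_disk d) (open_disk d)) ?W)
      (subtopology (subtopology (cspace S) t) e) (chart t)"
  proof (rule homeomorphic_map_subtopologies[OF chart_homeo[OF t]])
    have "topspace (subtopology (closed_disk d) (open_disk d)) \<inter> ?W = ?W"
      using open_disk_subset by auto
    moreover have "topspace (subtopology (cspace S) t) \<inter> e = e"
      using et cw_cell_subset[OF S_cw t] by auto
    moreover have "chart t ` ?W = e"
    proof
      show "e \<subseteq> chart t ` ?W"
      proof
        fix y assume y: "y \<in> e"
        then have "y \<in> chart t ` open_disk d" using et chart_interior(1)[OF t] by auto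
        then obtain x where "x \<in> open_disk d" "y = chart t x" by blast
        then show "y \<in> chart t ` ?W" using y by simp
      qed
    qed blast
    ultimately show "chart t ` (topspace (subtopology (closed_disk d) (open_disk d)) \<inter> ?W) =
        topspace (subtopology (cspace S) t) \<inter> e" by simp
  qed
  moreover have "open_disk d \<inter> ?W = ?W" by blast
  moreover have "t \<inter> e = e" using et by blast
  ultimately have "homeomorphic_map (subtopology (closed_disk d) ?W) (subtopology (cspace S) e) (chart t)"
    by (simp add: subtopology_subtopology)
  then show "homeomorphic_map (subtopology (closed_disk d) ?W) (subtopology (cspace S) (\<phi> ` e)) (\<phi> \<circ> chart t)"
    using phi_cell(3)[OF e] by (rule homeomorphic_map_compose)
  show "continuous_map (closed_disk d) (cspace S) (chart (\<phi> ` e))" by (rule chart_cont[OF et'])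
  show "homeomorphic_map (subtopology (closed_disk d) (open_disk d)) (subtopology (cspace S) (\<phi> ` e)) (chart (\<phi> ` e))"
    by (rule chart_homeo[OF et'])
  show "Hausdorff_space (cspace S)" by (rule cw_Hausdorff[OF S_cw])
  fix x
  have "{z \<in> D. (\<phi> \<circ> chart t) z = x} \<subseteq> (\<Union>y \<in> {y \<in> topspace (cspace S). \<phi> y = x}. {z \<in> D. chart t z = y})"
    using continuous_map_image_subset_topspace[OF chart_cont[OF t]] by auto
  moreover have "finite (\<Union>y \<in> {y \<in> topspace (cspace S). \<phi> y = x}. {z \<in> D. chart t z = y})"
    using finite_phi_fibre[of x] finite_chart_fibre[OF t] by (intro finite_UN_I)
  ultimately show "finite {z \<in> D. (\<phi> \<circ> chart t) z = x}" by (rule finite_subset)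
qed

lemma child_chart_cont: "continuous_map (closed_disk d) (closed_disk d) (child_chart t e)"
  and child_chart_eq: "x \<in> D \<Longrightarrow> \<phi> (chart t (child_chart t e x)) = chart (\<phi> ` e) x"
  and child_chart_homeo: "homeomorphic_map (subtopology (closed_disk d) (open_disk d))
       (subtopology (closed_disk d) {x \<in> open_disk d. chart t x \<in> e}) (child_chart t e)"
  using someI_ex[OF child_chart_ex] unfolding child_chart_def[symmetric] by simp_all

lemma child_chart_D: "x \<in> D \<Longrightarrow> child_chart t e x \<in> D"
  using continuous_map_image_subset_topspace[OF child_chart_cont] by blast

lemma child_chart_interior: "child_chart t e ` open_disk d = {x \<in> open_disk d. chart t x \<in> e}"
  by (rule homeomorphic_map_cells(1)[OF child_chart_homeo open_disk_subset]) (use open_disk_subset in blast)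

text \<open>Under \<open>\<phi>\<close> the image \<open>?A\<close> of the face becomes a single
  k-cell of the base, so its points lie in k-cells of the subdivision, and connectedness leaves one,
  \<open>e'\<close>. The base cell around \<open>e'\<close> has dimension \<open>k\<close> or
  \<open>d\<close> by \<open>cell_dimension_le\<close>, and connectedness puts the lifted face into
  one cell of the model disk.\<close>

lemma child_face:
  assumes k: "d = Suc k" and \<beta>: "\<beta> \<in> cells (disk_complex (\<phi> ` e)) k"
  shows "\<exists>b j. b \<in> cells (disk_complex t) j \<and> (j = k \<or> j = d \<and> b = open_disk d) \<and>
      child_chart t e ` \<beta> \<subseteq> b \<and> chart t ` child_chart t e ` \<beta> \<in> cells S' k \<and>
      chart t ` child_chart t e ` \<beta> \<subseteq> chart t ` b"
proof -
  have pe: "\<phi> ` e \<in> cells S d" by (rule phi_cell(1)[OF e])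
  let ?B = "child_chart t e ` \<beta>"
  let ?A = "chart t ` ?B"
  have \<beta>D: "\<beta> \<subseteq> D" by (rule disk_cell_subset[OF pe \<beta>])
  have \<beta>conn: "connectedin (closed_disk d) \<beta>" and \<beta>ne: "\<beta> \<noteq> {}"
    using cw_cell_connected[OF disk_complex_cw[OF pe] \<beta>] unfolding disk_complex_space[OF pe] by simp_all
  have Bconn: "connectedin (closed_disk d) ?B" by (rule connectedin_continuous_map_image[OF child_chart_cont \<beta>conn])
  have Aconn: "connectedin (cspace S) ?A" by (rule connectedin_continuous_map_image[OF chart_cont[OF t] Bconn])
  have BD: "?B \<subseteq> D" using \<beta>D child_chart_D by blast
  have phiA: "\<phi> ` ?A = chart (\<phi> ` e) ` \<beta>"
    using child_chart_eq \<beta>D by (force simp: image_image)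
  let ?h = "chart (\<phi> ` e) ` \<beta>"
  have h: "?h \<in> cells S k" by (rule chart_cell(1)[OF pe \<beta>])
  have "\<exists>e' \<in> {a \<in> cells S' k. \<phi> ` a = ?h}. ?A \<subseteq> e'"
  proof (rule cw_connected_in_cell[OF S'_cw])
    show "connectedin (cspace S') ?A" using Aconn S'_space by simp
    show "?A \<noteq> {}" using \<beta>ne by simp
    show "finite {a \<in> cells S' k. \<phi> ` a = ?h}"
      by (rule finite_subset[of _ "all_cells S'"]) (use S'_finite in \<open>auto simp: finite_complex_def all_cells_def\<close>)
    show "?A \<subseteq> \<Union>{a \<in> cells S' k. \<phi> ` a = ?h}"
    proof
      fix y assume y: "y \<in> ?A"
      then have "y \<in> topspace (cspace S')"
        using connectedin_subset_topspace[OF Aconn] S'_space by auto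
      then obtain l a where a: "a \<in> cells S' l" "y \<in> a" using cw_cell_cover[OF S'_cw] by blast
      have "\<phi> y \<in> ?h" using y phiA by blast
      from cw_disjoint[OF S_cw phi_cell(1)[OF a(1)] h imageI[OF a(2)] this]
      show "y \<in> \<Union>{a \<in> cells S' k. \<phi> ` a = ?h}" using a by blast
    qed
  qed blast
  then obtain e' where e': "e' \<in> cells S' k" "\<phi> ` e' = ?h" "?A \<subseteq> e'" by blast
  have "\<phi> ` ?A = \<phi> ` e'" using phiA e'(2) by simp
  \<comment> \<open>Equality and not just inclusion: \<open>\<phi>\<close> is injective on
    \<open>e'\<close> and gives both sets the same image.\<close>
  then have Ae': "?A = e'"
    using inj_on_image_eq_iff[OF phi_cell(2)[OF e'(1)] e'(3) subset_refl] by simp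
  obtain j h' where h': "h' \<in> cells S j" "e' \<subseteq> h'" using S'_subdivides[OF e'(1)] .
  have kj: "k \<le> j" by (rule cell_dimension_le[OF S_cw S'_cw S'_space e'(1) h'(1,2)])
  have "\<exists>b \<in> {b \<in> cells (disk_complex t) j. chart t ` b = h'}. ?B \<subseteq> b"
  proof (rule cw_connected_in_cell[OF disk_complex_cw[OF t]])
    show "connectedin (cspace (disk_complex t)) ?B" using Bconn disk_complex_space[OF t] by simp
    show "?B \<noteq> {}" using \<beta>ne by simp
    show "finite {b \<in> cells (disk_complex t) j. chart t ` b = h'}"
      by (rule finite_subset[OF _ finite_disk_cells[OF t]]) (auto simp: all_cells_def)
    show "?B \<subseteq> \<Union>{b \<in> cells (disk_complex t) j. chart t ` b = h'}"
    proof
      fix y assume y: "y \<in> ?B"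
      then obtain l b where b: "b \<in> cells (disk_complex t) l" "y \<in> b"
        using disk_cell_cover[OF t] BD by blast
      have "chart t y \<in> h'" using y e'(3) h'(2) by blast
      from cw_disjoint[OF S_cw chart_cell(1)[OF t b(1)] h'(1) imageI[OF b(2)] this]
      show "y \<in> \<Union>{b \<in> cells (disk_complex t) j. chart t ` b = h'}" using b by blast
    qed
  qed blast
  then obtain b where b: "b \<in> cells (disk_complex t) j" "chart t ` b = h'" "?B \<subseteq> b" by blast
  have "j = k \<or> j = d \<and> b = open_disk d"
  proof (cases "j = k")
    case False
    then have "j = d" using kj S_dim_le[OF h'(1)] k by simp
    then show ?thesis using disk_top_cell[OF t] b(1) by simp
  qed simp
  moreover have "?A \<in> cells S' k" using Ae' e'(1) by simp
  moreover have "?A \<subseteq> chart t ` b" using Ae' h'(2) b(2) by simp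
  ultimately show ?thesis using b by blast
qed

end

section \<open>The position of a child's face in its parent\<close>

definition carrier_cell :: "'s set \<Rightarrow> 's set \<Rightarrow> (nat \<Rightarrow> real) set \<Rightarrow> (nat \<Rightarrow> real) set" where
  "carrier_cell t e \<beta> = (SOME b. b \<in> all_cells (disk_complex t) \<and> child_chart t e ` \<beta> \<subseteq> b)"

definition face_position ::
    "'s set \<Rightarrow> 's set \<Rightarrow> (nat \<Rightarrow> real) set \<Rightarrow> (nat \<Rightarrow> real) set option \<times> 's set" where
  "face_position t e \<beta> =
     (if carrier_cell t e \<beta> = open_disk d then None else Some (carrier_cell t e \<beta>),
      chart t ` child_chart t e ` \<beta>)"

lemma carrier_cell:
  assumes t: "t \<in> cells S d" and e: "e \<in> cells S' d" "e \<subseteq> t"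
    and k: "d = Suc k" and \<beta>: "\<beta> \<in> cells (disk_complex (\<phi> ` e)) k"
  shows "child_chart t e ` \<beta> \<subseteq> carrier_cell t e \<beta>"
    and "carrier_cell t e \<beta> = open_disk d \<or> carrier_cell t e \<beta> \<in> cells (disk_complex t) k"
    and "chart t ` child_chart t e ` \<beta> \<in> cells S' k"
    and "chart t ` child_chart t e ` \<beta> \<subseteq> chart t ` carrier_cell t e \<beta>"
proof -
  obtain b j where b: "b \<in> cells (disk_complex t) j" "j = k \<or> j = d \<and> b = open_disk d"
      "child_chart t e ` \<beta> \<subseteq> b" "chart t ` child_chart t e ` \<beta> \<in> cells S' k"
      "chart t ` child_chart t e ` \<beta> \<subseteq> chart t ` b"
    using child_face[OF t e k \<beta>] by blast
  have "\<exists>b. b \<in> all_cells (disk_complex t) \<and> child_chart t e ` \<beta> \<subseteq> b"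
    using b by (auto simp: all_cells_def)
  from someI_ex[OF this]
  have c: "carrier_cell t e \<beta> \<in> all_cells (disk_complex t)" "child_chart t e ` \<beta> \<subseteq> carrier_cell t e \<beta>"
    unfolding carrier_cell_def[symmetric] by simp_all
  obtain l where l: "carrier_cell t e \<beta> \<in> cells (disk_complex t) l" using c(1) by (auto simp: all_cells_def)
  obtain y where y: "y \<in> \<beta>" using cw_cell_connected(2)[OF disk_complex_cw[OF phi_cell(1)[OF e(1)]] \<beta>] by blast
  have "child_chart t e y \<in> b" "child_chart t e y \<in> carrier_cell t e \<beta>" using y b(3) c(2) by blast+
  \<comment> \<open>Cells are disjoint, so the chosen cell is the one found in
    \<open>child_face\<close>.\<close>
  from cw_disjoint[OF disk_complex_cw[OF t] b(1) l this]
  have eq: "carrier_cell t e \<beta> = b" by simp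
  show "child_chart t e ` \<beta> \<subseteq> carrier_cell t e \<beta>"
    "carrier_cell t e \<beta> = open_disk d \<or> carrier_cell t e \<beta> \<in> cells (disk_complex t) k"
    "chart t ` child_chart t e ` \<beta> \<in> cells S' k"
    "chart t ` child_chart t e ` \<beta> \<subseteq> chart t ` carrier_cell t e \<beta>"
    unfolding eq using b by auto
qed

text \<open>
  Only top-dimensional cells and \<open>e'\<close> itself come close to \<open>chart t y\<close>, and a small neighbourhood
  of \<open>y\<close> meets the open disk in a connected set.
\<close>

lemma unique_tile_near_face:
  assumes t: "t \<in> cells S d" and k: "d = Suc k" and y: "y \<in> D" "y \<notin> open_disk d"
    and e': "e' \<in> cells S' k" "chart t y \<in> e'" and h: "h \<in> cells S k" "e' \<subseteq> h"
  shows "\<exists>N. \<exists>e \<in> cells S' d. disk_nbhd d y N \<inter> open_disk d \<subseteq> {x \<in> open_disk d. chart t x \<in> e}"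
proof -
  let ?low = "{a \<in> all_cells S'. a \<notin> cells S' d \<and> a \<noteq> e'}"
  let ?C = "\<Union>(closed_cell S' ` ?low)"
  have cl: "closedin (cspace S) ?C"
  proof (rule closedin_Union)
    show "finite (closed_cell S' ` ?low)" using S'_finite by (simp add: finite_complex_def)
  qed (auto simp: closed_cell_def S'_space)
  have notC: "chart t y \<notin> ?C"
  proof
    assume "chart t y \<in> ?C"
    then obtain a l where a: "a \<in> cells S' l" "a \<notin> cells S' d" "a \<noteq> e'" "chart t y \<in> closed_cell S' a"
      by (auto simp: all_cells_def)
    then have "k < l" using cw_closure_meets[OF S'_cw a(1) e'(1)] e'(2) by blast
    then have "l = d" using S'_dim_le[OF a(1)] k by simp
    then show False using a by simp
  qed
  let ?U = "{x \<in> D. chart t x \<in> topspace (cspace S) - ?C}"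
  have U: "openin (closed_disk d) ?U"
    using cl by (intro openin_continuous_map_preimage[OF chart_cont[OF t]]) (simp add: closedin_def)
  have yU: "y \<in> ?U"
    using y notC continuous_map_image_subset_topspace[OF chart_cont[OF t]] by blast
  obtain N where N: "disk_nbhd d y N \<subseteq> ?U" using disk_nbhd_basis[OF U yU] by blast
  let ?V = "disk_nbhd d y N \<inter> open_disk d"
  have Vt: "chart t ` ?V \<subseteq> t" using chart_interior(1)[OF t] by blast
  have "\<exists>e \<in> cells S' d. chart t ` ?V \<subseteq> e"
  proof (rule cw_connected_in_cell[OF S'_cw, where k = d])
    show "connectedin (cspace S') (chart t ` ?V)"
      unfolding S'_space by (rule connectedin_continuous_map_image[OF chart_cont[OF t] connectedin_disk_nbhd_Int])
    show "chart t ` ?V \<noteq> {}" using disk_nbhd_Int_nonempty[OF y(1)] by simp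
    show "finite (cells S' d)"
      by (rule finite_subset[of _ "all_cells S'"]) (use S'_finite in \<open>auto simp: finite_complex_def all_cells_def\<close>)
    show "chart t ` ?V \<subseteq> \<Union>(cells S' d)"
    proof
      fix z assume z: "z \<in> chart t ` ?V"
      then have zC: "z \<in> topspace (cspace S')" "z \<notin> ?C" using N S'_space by auto
      obtain l a where a: "a \<in> cells S' l" "z \<in> a" using cw_cell_cover[OF S'_cw zC(1)] by blast
      \<comment> \<open>\<open>e'\<close> lies in the (d - 1)-cell \<open>h\<close>, whereas the
        points of \<open>?V\<close> are sent into the open tile \<open>t\<close>.\<close>
      have "a \<noteq> e'"
      proof
        assume "a = e'"
        then have zh: "z \<in> h" using a h by blast
        have "z \<in> t" using z Vt by blast
        from cw_disjoint[OF S_cw t h(1) this zh] show False using k by simp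
      qed
      moreover have "z \<in> closed_cell S' a" using cw_cell_subset_closed[OF S'_cw a(1)] a(2) by blast
      ultimately have "a \<in> cells S' d" using zC(2) a(1) by (auto simp: all_cells_def)
      then show "z \<in> \<Union>(cells S' d)" using a by blast
    qed
  qed simp
  then obtain e where "e \<in> cells S' d" "chart t ` ?V \<subseteq> e" by blast
  then show ?thesis by (intro exI[of _ N] bexI[of _ e]) auto
qed

text \<open>Faces at equal boundary positions share a point \<open>y\<close> of the model disk's
  boundary. Near \<open>y\<close> the open disk belongs to one child only, so the children agree;
  then \<open>boundary_lift_unique\<close> makes the two preimages of \<open>y\<close>, hence the
  faces, agree.\<close>

lemma face_position_inj:
  assumes t: "t \<in> cells S d" and e: "e \<in> cells S' d" "e \<subseteq> t" and e2: "e2 \<in> cells S' d" "e2 \<subseteq> t"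
    and \<beta>: "\<beta> \<in> tile_faces (\<phi> ` e)" and \<beta>2: "\<beta>2 \<in> tile_faces (\<phi> ` e2)"
    and bd: "fst (face_position t e \<beta>) \<noteq> None" and eq: "face_position t e \<beta> = face_position t e2 \<beta>2"
  shows "e = e2 \<and> \<beta> = \<beta>2"
proof -
  obtain k where k: "d = Suc k" "\<beta> \<in> cells (disk_complex (\<phi> ` e)) k" using \<beta> by (auto simp: tile_faces_def)
  then have k2: "\<beta>2 \<in> cells (disk_complex (\<phi> ` e2)) k" using tile_facesD[OF \<beta>2] by simp
  note C = carrier_cell[OF t e k] and C2 = carrier_cell[OF t e2 k(1) k2]
  let ?b = "carrier_cell t e \<beta>" and ?e' = "chart t ` child_chart t e ` \<beta>"
  have b: "?b \<noteq> open_disk d" "carrier_cell t e2 \<beta>2 = ?b" "chart t ` child_chart t e2 ` \<beta>2 = ?e'"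
    using bd eq by (auto simp: face_position_def split: if_splits)
  have bk: "?b \<in> cells (disk_complex t) k" using C(2) b(1) by simp
  \<comment> \<open>The chart is injective on the common carrier, so equal images in the base come
    from equal images in the model disk.\<close>
  have "child_chart t e ` \<beta> = child_chart t e2 ` \<beta>2"
    using inj_on_image_eq_iff[OF chart_cell(2)[OF t bk] C(1) C2(1)[unfolded b(2)]] b(3) by simp
  moreover obtain y1 where y1: "y1 \<in> \<beta>"
    using cw_cell_connected(2)[OF disk_complex_cw[OF phi_cell(1)[OF e(1)]] k(2)] by blast
  ultimately obtain y2 where y2: "y2 \<in> \<beta>2" "child_chart t e2 y2 = child_chart t e y1" by (metis imageE imageI)
  define y where "y = child_chart t e y1"
  have y1D: "y1 \<in> D" using disk_cell_subset[OF phi_cell(1)[OF e(1)] k(2)] y1 by blast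
  have y2D: "y2 \<in> D" using disk_cell_subset[OF phi_cell(1)[OF e2(1)] k2] y2 by blast
  have yD: "y \<in> D" unfolding y_def by (rule child_chart_D[OF t e y1D])
  have yb: "y \<in> ?b" using C(1) y1 y_def by blast
  have yI: "y \<notin> open_disk d"
  proof
    assume "y \<in> open_disk d"
    from cw_disjoint[OF disk_complex_cw[OF t] bk disk_complex_interior[OF t] yb this] b(1) show False by simp
  qed
  have ye': "chart t y \<in> ?e'" using y1 y_def by blast
  obtain N a where a: "a \<in> cells S' d" "disk_nbhd d y N \<inter> open_disk d \<subseteq> {x \<in> open_disk d. chart t x \<in> a}"
    using unique_tile_near_face[OF t k(1) yD yI C(3) ye' chart_cell(1)[OF t bk] C(4)] by blast
  \<comment> \<open>A child whose chart reaches \<open>y\<close> has interior points arbitrarily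
    close to \<open>y\<close>, and these lie in \<open>a\<close> too.\<close>
  have same: "a = c" if c: "c \<in> cells S' d" "c \<subseteq> t" and z: "z \<in> D" "child_chart t c z = y" for c z
  proof -
    let ?V = "{x \<in> D. child_chart t c x \<in> disk_nbhd d y N}"
    have "openin (closed_disk d) ?V"
      by (rule openin_continuous_map_preimage[OF child_chart_cont[OF t c] openin_disk_nbhd])
    moreover have "z \<in> ?V" using z disk_nbhd_mem[OF yD] by simp
    moreover have "z \<in> closed_disk d closure_of open_disk d" using z closure_of_open_disk by simp
    ultimately have "?V \<inter> open_disk d \<noteq> {}"
      using openin_Int_closure_of_eq_empty[of "closed_disk d" ?V "open_disk d"] by blast
    then obtain x where x: "x \<in> ?V" "x \<in> open_disk d" by blast
    then have "child_chart t c x \<in> {x \<in> open_disk d. chart t x \<in> c}"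
      using child_chart_interior[OF t c] by blast
    moreover have "child_chart t c x \<in> disk_nbhd d y N" using x by blast
    ultimately have "chart t (child_chart t c x) \<in> c" "chart t (child_chart t c x) \<in> a" using a(2) by auto
    from cw_disjoint[OF S'_cw c(1) a(1) this] show ?thesis by simp
  qed
  have ae: "a = e" by (rule same[OF e y1D]) (simp add: y_def)
  have ae2: "a = e2" by (rule same[OF e2 y2D]) (simp add: y_def y2)
  have ee2: "e = e2" using ae ae2 by simp
  have "y1 = y2"
  proof (rule boundary_lift_unique[OF child_chart_cont[OF t e] child_chart_homeo[OF t e]])
    show "{x \<in> open_disk d. chart t x \<in> e} \<subseteq> open_disk d" by blast
    show "disk_nbhd d y N \<inter> open_disk d \<subseteq> {x \<in> open_disk d. chart t x \<in> e}" using a(2) ae by simp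
    show "y1 \<in> D" "y2 \<in> D" by (rule y1D, rule y2D)
    show "child_chart t e y1 = y" "child_chart t e y2 = y" using y2(2) ee2 by (simp_all add: y_def)
    show "finite {z \<in> D. child_chart t e z = y}"
      by (rule finite_subset[OF _ finite_chart_fibre[OF phi_cell(1)[OF e(1)], of "\<phi> (chart t y)"]])
        (use child_chart_eq[OF t e] in auto)
  qed
  then have "\<beta> = \<beta>2"
    using cw_disjoint[OF disk_complex_cw[OF phi_cell(1)[OF e(1)]] k(2) k2[folded ee2] y1] y2(1) by simp
  then show ?thesis using ee2 by simp
qed

end

section \<open>The iterated subdivisions of an R-complex\<close>

locale subdivision_pair = fixed_subdivision_rule d R
  for d :: nat and R :: "'s subdivision_rule" +
  fixes X :: "'x cell_complex" and f :: "'x \<Rightarrow> 's"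
  assumes complex: "R_complex d R X f"
begin

abbreviation "Z n \<equiv> iterated_subdivision R X f n"
abbreviation "g n \<equiv> structure_map R f n"

lemma X_cw: "cw_complex X" and f_cellular: "cellular_map X S f" and f_homeo: "homeomorphic_on_cells X S f"
  using complex unfolding R_complex_def by simp_all

lemma g_simps: "g 0 = f" "g (Suc n) x = \<phi> (g n x)"
  by (simp_all add: structure_map_def)

lemma g_image_Suc: "g (Suc n) ` A = \<phi> ` g n ` A"
  by (simp add: g_simps(2) image_image)

lemma g_cont: "continuous_map (cspace X) (cspace S) (g n)"
proof (induction n)
  case 0
  then show ?case using f_cellular by (simp add: g_simps cellular_map_def)
next
  case (Suc n)
  have "g (Suc n) = \<phi> \<circ> g n" by (rule ext) (simp add: g_simps)
  then show ?case using continuous_map_compose[OF Suc phi_cont] by (simp only:)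
qed

lemma Z_space: "cspace (Z n) = cspace X"
  by (induction n) (simp_all add: subdivide_def)

lemma Z_Suc_cells:
  "cells (Z (Suc n)) k = {c \<inter> g n -` e | c e. c \<in> all_cells (Z n) \<and> e \<in> cells S' k \<and> e \<subseteq> g n ` c}"
  by (simp add: subdivide_def)

lemma Z_cell_SucE:
  assumes "u \<in> cells (Z (Suc n)) k"
  obtains c j e where "u = c \<inter> g n -` e" "c \<in> cells (Z n) j" "e \<in> cells S' k" "e \<subseteq> g n ` c"
proof -
  obtain c e where ce: "u = c \<inter> g n -` e" "c \<in> all_cells (Z n)" "e \<in> cells S' k" "e \<subseteq> g n ` c"
    using assms unfolding Z_Suc_cells by blast
  then obtain j where "c \<in> cells (Z n) j" by (auto simp: all_cells_def)
  then show ?thesis using ce that by blast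
qed

lemma Z_cell_SucI:
  assumes "c \<in> cells (Z n) j" "e \<in> cells S' k" "e \<subseteq> g n ` c"
  shows "c \<inter> g n -` e \<in> cells (Z (Suc n)) k"
proof -
  have "c \<in> all_cells (Z n)" using assms(1) by (auto simp: all_cells_def)
  then show ?thesis unfolding Z_Suc_cells using assms(2,3) by blast
qed

lemma image_pullback: "e \<subseteq> g n ` c \<Longrightarrow> g n ` (c \<inter> g n -` e) = e"
  by blast

text \<open>Together with \<open>Z_disjoint\<close> this stands in for the CW axioms of the iterated
  subdivisions: their cells are handled through the structure map and the fixed topology of
  \<open>X\<close>.\<close>

lemma Z_cells:
  "c \<in> cells (Z n) k \<Longrightarrow> c \<subseteq> topspace (cspace X) \<and> inj_on (g n) c \<and> g n ` c \<in> cells S k"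
proof (induction n arbitrary: c k)
  case 0
  then have c: "c \<in> cells X k" by simp
  show ?case
    unfolding g_simps(1)
    using cw_cell_subset[OF X_cw c] homeomorphic_on_cells_image[OF f_homeo X_cw S_cw c] by simp
next
  case (Suc n)
  obtain a j e where a: "c = a \<inter> g n -` e" "a \<in> cells (Z n) j" "e \<in> cells S' k" "e \<subseteq> g n ` a"
    using Z_cell_SucE[OF Suc.prems] .
  note IH = Suc.IH[OF a(2)]
  have im: "g n ` c = e" unfolding a(1) by (rule image_pullback[OF a(4)])
  have inj: "inj_on (\<phi> \<circ> g n) c"
  proof (rule comp_inj_on)
    show "inj_on (g n) c" using IH a(1) by (meson inf_le1 inj_on_subset)
    show "inj_on \<phi> (g n ` c)" unfolding im by (rule phi_cell(2)[OF a(3)])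
  qed
  have "g (Suc n) = \<phi> \<circ> g n" by (rule ext) (simp add: g_simps)
  with inj have "inj_on (g (Suc n)) c" by (simp only:)
  moreover have "g (Suc n) ` c \<in> cells S k" unfolding g_image_Suc im by (rule phi_cell(1)[OF a(3)])
  moreover have "c \<subseteq> topspace (cspace X)" using IH a(1) by blast
  ultimately show ?case by simp
qed

lemma Z_cell_inj: "c \<in> cells (Z n) k \<Longrightarrow> inj_on (g n) c"
  and Z_cell_image: "c \<in> cells (Z n) k \<Longrightarrow> g n ` c \<in> cells S k"
  using Z_cells by simp_all

lemma Z_cell_nonempty: "c \<in> cells (Z n) k \<Longrightarrow> c \<noteq> {}"
  using cw_cell_connected(2)[OF S_cw Z_cell_image] by fastforce

lemma Z_disjoint:
  "c \<in> cells (Z n) k \<Longrightarrow> c' \<in> cells (Z n) l \<Longrightarrow> x \<in> c \<Longrightarrow> x \<in> c' \<Longrightarrow> k = l \<and> c = c'"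
proof (induction n arbitrary: c c' k l)
  case 0
  then show ?case using cw_disjoint[OF X_cw, of c k c' l x] by simp
next
  case (Suc n)
  obtain a j e where a: "c = a \<inter> g n -` e" "a \<in> cells (Z n) j" "e \<in> cells S' k" "e \<subseteq> g n ` a"
    using Z_cell_SucE[OF Suc.prems(1)] .
  obtain a' j' e' where a': "c' = a' \<inter> g n -` e'" "a' \<in> cells (Z n) j'" "e' \<in> cells S' l" "e' \<subseteq> g n ` a'"
    using Z_cell_SucE[OF Suc.prems(2)] .
  have x: "x \<in> a" "x \<in> a'" "g n x \<in> e" "g n x \<in> e'" using Suc.prems(3,4) a(1) a'(1) by auto
  show ?case
    using Suc.IH[OF a(2) a'(2) x(1,2)] cw_disjoint[OF S'_cw a(3) a'(3) x(3,4)] a(1) a'(1) by simp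
qed

text \<open>A d-cell of the subdivided base cannot lie in a base cell of lower dimension, so the
  parent is a top-dimensional tile.\<close>

lemma Z_top_SucE:
  assumes "u \<in> cells (Z (Suc n)) d"
  obtains T e where "u = T \<inter> g n -` e" "T \<in> cells (Z n) d" "e \<in> cells S' d" "e \<subseteq> g n ` T"
proof -
  obtain c j e where c: "u = c \<inter> g n -` e" "c \<in> cells (Z n) j" "e \<in> cells S' d" "e \<subseteq> g n ` c"
    using Z_cell_SucE[OF assms] .
  have "d \<le> j" by (rule cell_dimension_le[OF S_cw S'_cw S'_space c(3) Z_cell_image[OF c(2)] c(4)])
  moreover have "j \<le> d" by (rule S_dim_le[OF Z_cell_image[OF c(2)]])
  ultimately show ?thesis using that c by simp
qed

text \<open>A lift of the chart of the tile's type along the structure map, defined on the closed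
  disk. Sending faces onto whole (d - 1)-cells is what gives the faces of tiles their finitely many
  names.\<close>

definition develops :: "nat \<Rightarrow> 'x set \<Rightarrow> ((nat \<Rightarrow> real) \<Rightarrow> 'x) \<Rightarrow> bool" where
  "develops n T \<delta> \<longleftrightarrow> continuous_map (closed_disk d) (cspace X) \<delta> \<and>
     (\<forall>x \<in> D. g n (\<delta> x) = chart (g n ` T) x) \<and> \<delta> ` open_disk d = T \<and>
     (\<forall>b \<in> tile_faces (g n ` T). \<forall>k. d = Suc k \<longrightarrow> \<delta> ` b \<in> cells (Z n) k)"

lemma developsI:
  assumes "continuous_map (closed_disk d) (cspace X) \<delta>" "\<And>x. x \<in> D \<Longrightarrow> g n (\<delta> x) = chart (g n ` T) x"
    "\<delta> ` open_disk d = T"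
    "\<And>b k. b \<in> tile_faces (g n ` T) \<Longrightarrow> d = Suc k \<Longrightarrow> \<delta> ` b \<in> cells (Z n) k"
  shows "develops n T \<delta>"
  unfolding develops_def by (intro conjI ballI allI impI assms)

text \<open>\<open>lift_disk_map\<close> is applied to the closed cell of \<open>T\<close>, which is
  compact and, by closure finiteness, covered by finitely many cells even if \<open>X\<close> is
  infinite; hence \<open>f\<close> has finite fibres on it.\<close>

lemma develops_0:
  assumes T: "T \<in> cells X d"
  shows "\<exists>\<delta>. develops 0 T \<delta>"
proof -
  let ?K = "closed_cell X T"
  let ?Y = "subtopology (cspace X) ?K"
  let ?t = "f ` T"
  obtain F where F: "finite F" "F \<subseteq> (\<Union>j<d. cells X j)" "?K \<subseteq> T \<union> \<Union>F"
    using cw_closure_cell(1)[OF X_cw T] by blast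
  have KX: "?K \<subseteq> topspace (cspace X)" by (simp add: closed_cell_def closure_of_subset_topspace)
  have topY: "topspace ?Y = ?K" using KX by auto
  have TK: "T \<subseteq> ?K" by (rule cw_cell_subset_closed[OF X_cw T])
  have t: "?t \<in> cells S d" and fh: "homeomorphic_map (subtopology (cspace X) T) (subtopology (cspace S) ?t) f"
    using homeomorphic_on_cells_image[OF f_homeo X_cw S_cw T] by simp_all
  have fc: "continuous_map (cspace X) (cspace S) f" using g_cont[of 0] by (simp add: g_simps)
  have cell: "\<exists>j. c \<in> cells X j" if "c \<in> insert T F" for c using that F(2) T by blast
  have "\<exists>k. continuous_map (closed_disk d) ?Y k \<and> (\<forall>x \<in> D. f (k x) = chart ?t x) \<and>
      homeomorphic_map (subtopology (closed_disk d) (open_disk d)) (subtopology ?Y T) k"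
  proof (rule lift_disk_map)
    show "compact_space ?Y" by (rule compact_space_subtopology[OF cw_closure_cell(2)[OF X_cw T]])
    show "Hausdorff_space ?Y" by (rule Hausdorff_space_subtopology[OF cw_Hausdorff[OF X_cw]])
    show "T \<subseteq> topspace ?Y" using TK topY by simp
    show "continuous_map ?Y (cspace S) f" by (rule continuous_map_from_subtopology[OF fc])
    show "homeomorphic_map (subtopology ?Y T) (subtopology (cspace S) ?t) f"
      using fh TK by (simp add: subtopology_subtopology Int_absorb1)
    show "continuous_map (closed_disk d) (cspace S) (chart ?t)" by (rule chart_cont[OF t])
    show "homeomorphic_map (subtopology (closed_disk d) (open_disk d)) (subtopology (cspace S) ?t) (chart ?t)"
      by (rule chart_homeo[OF t])
    show "Hausdorff_space (cspace S)" by (rule cw_Hausdorff[OF S_cw])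
    fix x
    have "{z \<in> topspace ?Y. f z = x} \<subseteq> (\<Union>c \<in> insert T F. {z \<in> c. f z = x})"
      using F(3) unfolding topY by auto
    moreover have "finite {z \<in> c. f z = x}" if c: "c \<in> insert T F" for c
    proof -
      obtain j where "c \<in> cells X j" using cell[OF c] by blast
      then have "inj_on f c" using homeomorphic_on_cells_image(2)[OF f_homeo X_cw S_cw] by simp
      then show ?thesis
        using finite_vimage_IntI[of "{x}" f c] by (simp add: vimage_def Int_def conj_commute)
    qed
    then have "finite (\<Union>c \<in> insert T F. {z \<in> c. f z = x})" using F(1) by (intro finite_UN_I) auto
    ultimately show "finite {z \<in> topspace ?Y. f z = x}" by (rule finite_subset)
  qed
  then obtain \<delta> where \<delta>: "continuous_map (closed_disk d) ?Y \<delta>" "\<And>x. x \<in> D \<Longrightarrow> f (\<delta> x) = chart ?t x"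
      "homeomorphic_map (subtopology (closed_disk d) (open_disk d)) (subtopology ?Y T) \<delta>" by blast
  have \<delta>K: "\<delta> x \<in> ?K" if "x \<in> D" for x
    using \<delta>(1) that unfolding continuous_map_in_subtopology by blast
  have \<delta>X: "continuous_map (closed_disk d) (cspace X) \<delta>"
    using \<delta>(1) unfolding continuous_map_in_subtopology by blast
  have \<delta>I: "\<delta> ` open_disk d = T"
    by (rule homeomorphic_map_cells(1)[OF \<delta>(3) open_disk_subset]) (use TK topY in simp)
  have "\<delta> ` b \<in> cells (Z 0) k" if bf: "b \<in> tile_faces ?t" and k: "d = Suc k" for b k
  proof -
    have b: "b \<in> cells (disk_complex ?t) k" by (rule tile_facesD[OF bf k])
    have bD: "b \<subseteq> D" by (rule disk_cell_subset[OF t b])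
    have bconn: "connectedin (closed_disk d) b" and bne: "b \<noteq> {}"
      using cw_cell_connected[OF disk_complex_cw[OF t] b] unfolding disk_complex_space[OF t] by simp_all
    have fb: "f ` \<delta> ` b = chart ?t ` b" using \<delta>(2) bD by (force simp: image_image)
    have h: "chart ?t ` b \<in> cells S k" by (rule chart_cell(1)[OF t b])
    \<comment> \<open>As \<open>f\<close> preserves dimensions of cells, all points of the lifted
      face lie in k-cells, and connectedness leaves one.\<close>
    have "\<exists>c \<in> {c \<in> insert T F. c \<in> cells X k}. \<delta> ` b \<subseteq> c"
    proof (rule cw_connected_in_cell[OF X_cw])
      show "connectedin (cspace X) (\<delta> ` b)" by (rule connectedin_continuous_map_image[OF \<delta>X bconn])
      show "\<delta> ` b \<noteq> {}" using bne by simp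
      show "finite {c \<in> insert T F. c \<in> cells X k}" using F(1) by simp
      show "\<delta> ` b \<subseteq> \<Union>{c \<in> insert T F. c \<in> cells X k}"
      proof
        fix z assume z: "z \<in> \<delta> ` b"
        then have "z \<in> ?K" using \<delta>K bD by blast
        then obtain c where c: "c \<in> insert T F" "z \<in> c" using F(3) by blast
        then obtain l where l: "c \<in> cells X l" using cell by blast
        have "f z \<in> chart ?t ` b" using z fb by blast
        from cw_disjoint[OF S_cw homeomorphic_on_cells_image(1)[OF f_homeo X_cw S_cw l] h imageI[OF c(2)] this]
        show "z \<in> \<Union>{c \<in> insert T F. c \<in> cells X k}" using c l by blast
      qed
    qed blast
    then obtain c where c: "c \<in> cells X k" "\<delta> ` b \<subseteq> c" by blast
    note fci = homeomorphic_on_cells_image(1,2)[OF f_homeo X_cw S_cw c(1)]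
    obtain y where y: "y \<in> b" using bne by blast
    have "f (\<delta> y) \<in> f ` c" "f (\<delta> y) \<in> chart ?t ` b" using y c(2) fb by blast+
    from cw_disjoint[OF S_cw fci(1) h this] have "f ` \<delta> ` b = f ` c" using fb by simp
    then have "\<delta> ` b = c" using inj_on_image_eq_iff[OF fci(2) c(2) subset_refl] by simp
    then show ?thesis using c(1) by simp
  qed
  with \<delta>X \<delta>(2) \<delta>I have "develops 0 T \<delta>" by (intro developsI, unfold g_simps(1))
  then show ?thesis by blast
qed

context
  fixes n T e \<delta>
  assumes T: "T \<in> cells (Z n) d" and e: "e \<in> cells S' d" "e \<subseteq> g n ` T" and dev: "develops n T \<delta>"
begin

text \<open>Composing with the child chart sends a face of the child into the parent's cell over its
  carrier and, under \<open>g n\<close>, onto \<open>e'\<close>. Injectivity of \<open>g n\<close>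
  on that cell turns this into equality with a cell of the next subdivision.\<close>

lemma develops_face:
  assumes k: "d = Suc k" and \<beta>: "\<beta> \<in> cells (disk_complex (\<phi> ` e)) k"
  defines "b \<equiv> carrier_cell (g n ` T) e \<beta>"
  defines "e' \<equiv> chart (g n ` T) ` child_chart (g n ` T) e ` \<beta>"
  shows "(\<delta> \<circ> child_chart (g n ` T) e) ` \<beta> = \<delta> ` b \<inter> g n -` e'"
    and "\<delta> ` b \<in> cells (Z n) (if b = open_disk d then d else k)"
    and "(\<delta> \<circ> child_chart (g n ` T) e) ` \<beta> \<in> cells (Z (Suc n)) k"
proof -
  let ?t = "g n ` T" and ?\<eta> = "child_chart (g n ` T) e"
  have t: "?t \<in> cells S d" by (rule Z_cell_image[OF T])
  note C = carrier_cell[OF t e k \<beta>, folded b_def e'_def]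
  have bD: "b \<subseteq> D"
    using C(2) disk_cell_subset[OF t] open_disk_subset by blast
  have g\<delta>: "g n (\<delta> x) = chart ?t x" if "x \<in> D" for x using dev that by (simp add: develops_def)
  have gb: "g n ` \<delta> ` A = chart ?t ` A" if "A \<subseteq> D" for A
    unfolding image_image by (rule image_cong[OF refl], rule g\<delta>) (use that in blast)
  show c: "\<delta> ` b \<in> cells (Z n) (if b = open_disk d then d else k)"
  proof (cases "b = open_disk d")
    case True
    then have "\<delta> ` b = T" using dev by (simp add: develops_def)
    then show ?thesis using T True by simp
  next
    case False
    then have "b \<in> tile_faces ?t" using C(2) by (intro tile_facesI[OF k]) simp
    then have "\<delta> ` b \<in> cells (Z n) k" using dev k unfolding develops_def by blast
    then show ?thesis using False by simp
  qed
  have eb: "e' \<subseteq> g n ` \<delta> ` b" using C(4) gb[OF bD] by simp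
  have sub: "(\<delta> \<circ> ?\<eta>) ` \<beta> \<subseteq> \<delta> ` b \<inter> g n -` e'"
  proof -
    have "(\<delta> \<circ> ?\<eta>) ` \<beta> \<subseteq> \<delta> ` b" unfolding image_comp[symmetric] by (rule image_mono[OF C(1)])
    moreover have "g n ` (\<delta> \<circ> ?\<eta>) ` \<beta> = e'"
      unfolding image_comp[symmetric] e'_def by (rule gb) (use C(1) bD in blast)
    ultimately show ?thesis by blast
  qed
  have im: "g n ` (\<delta> \<circ> ?\<eta>) ` \<beta> = e'"
    unfolding image_comp[symmetric] e'_def by (rule gb) (use C(1) bD in blast)
  have "g n ` (\<delta> \<circ> ?\<eta>) ` \<beta> = g n ` (\<delta> ` b \<inter> g n -` e')"
    unfolding im image_pullback[OF eb] ..
  then show eq: "(\<delta> \<circ> ?\<eta>) ` \<beta> = \<delta> ` b \<inter> g n -` e'"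
    using inj_on_image_eq_iff[OF Z_cell_inj[OF c], of "(\<delta> \<circ> ?\<eta>) ` \<beta>" "\<delta> ` b \<inter> g n -` e'"] sub by blast
  show "(\<delta> \<circ> ?\<eta>) ` \<beta> \<in> cells (Z (Suc n)) k"
    unfolding eq by (rule Z_cell_SucI[OF c C(3) eb])
qed

lemma develops_Suc: "develops (Suc n) (T \<inter> g n -` e) (\<delta> \<circ> child_chart (g n ` T) e)"
proof -
  let ?t = "g n ` T" and ?\<eta> = "child_chart (g n ` T) e" and ?U = "T \<inter> g n -` e"
  have t: "?t \<in> cells S d" by (rule Z_cell_image[OF T])
  have gU: "g (Suc n) ` ?U = \<phi> ` e" unfolding g_image_Suc image_pullback[OF e(2)] ..
  have \<delta>: "continuous_map (closed_disk d) (cspace X) \<delta>" "\<And>x. x \<in> D \<Longrightarrow> g n (\<delta> x) = chart ?t x"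
    "\<delta> ` open_disk d = T"
    using dev by (simp_all add: develops_def)
  have "continuous_map (closed_disk d) (cspace X) (\<delta> \<circ> ?\<eta>)"
    by (rule continuous_map_compose[OF child_chart_cont[OF t e] \<delta>(1)])
  moreover have "g (Suc n) ((\<delta> \<circ> ?\<eta>) x) = chart (\<phi> ` e) x" if "x \<in> D" for x
    using \<delta>(2)[OF child_chart_D[OF t e that]] child_chart_eq[OF t e that] by (simp add: g_simps)
  moreover have "(\<delta> \<circ> ?\<eta>) ` open_disk d = ?U"
  proof -
    have "g n (\<delta> x) = chart ?t x" if "x \<in> open_disk d" for x
      by (rule \<delta>(2)) (use that open_disk_subset in blast)
    then have "\<delta> ` {x \<in> open_disk d. chart ?t x \<in> e} = \<delta> ` open_disk d \<inter> g n -` e" by force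
    then show ?thesis unfolding image_comp[symmetric] child_chart_interior[OF t e] \<delta>(3) .
  qed
  moreover have "(\<delta> \<circ> ?\<eta>) ` \<beta> \<in> cells (Z (Suc n)) k" if "\<beta> \<in> tile_faces (\<phi> ` e)" "d = Suc k" for \<beta> k
    by (rule develops_face(3)[OF that(2) tile_facesD[OF that]])
  ultimately show ?thesis by (intro developsI, unfold gU)
qed

end

lemma develops_ex: "T \<in> cells (Z n) d \<Longrightarrow> \<exists>\<delta>. develops n T \<delta>"
proof (induction n arbitrary: T)
  case 0
  then show ?case using develops_0 by simp
next
  case (Suc n)
  obtain T' e where T': "T = T' \<inter> g n -` e" "T' \<in> cells (Z n) d" "e \<in> cells S' d" "e \<subseteq> g n ` T'"
    using Z_top_SucE[OF Suc.prems] .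
  obtain \<delta> where "develops n T' \<delta>" using Suc.IH[OF T'(2)] by blast
  then show ?case unfolding T'(1) using develops_Suc[OF T'(2-4)] by blast
qed

text \<open>Over the open disk both values lie in \<open>T\<close>, where \<open>g n\<close> is
  injective; density does the rest. This reconciles maps that are chosen separately at each level,
  see \<open>dev_child\<close>.\<close>

lemma develops_unique:
  assumes T: "T \<in> cells (Z n) d" and 1: "develops n T \<delta>" and 2: "develops n T \<delta>'" and x: "x \<in> D"
  shows "\<delta> x = \<delta>' x"
proof (rule forall_in_closure_of_eq[where X = "closed_disk d" and S = "open_disk d" and Y = "cspace X" and f = \<delta> and g = \<delta>'])
  show "x \<in> closed_disk d closure_of open_disk d" using x closure_of_open_disk by simp
  show "Hausdorff_space (cspace X)" by (rule cw_Hausdorff[OF X_cw])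
  show "continuous_map (closed_disk d) (cspace X) \<delta>" "continuous_map (closed_disk d) (cspace X) \<delta>'"
    using 1 2 by (simp_all add: develops_def)
  fix z assume z: "z \<in> open_disk d"
  then have zD: "z \<in> D" using open_disk_subset by blast
  have "g n (\<delta> z) = g n (\<delta>' z)" using 1 2 zD by (simp add: develops_def)
  moreover have "\<delta> z \<in> T" "\<delta>' z \<in> T" using 1 2 z by (auto simp: develops_def)
  ultimately show "\<delta> z = \<delta>' z" using Z_cell_inj[OF T] by (simp add: inj_on_eq_iff)
qed

section \<open>The chosen developing maps and their faces\<close>

definition dev :: "nat \<Rightarrow> 'x set \<Rightarrow> (nat \<Rightarrow> real) \<Rightarrow> 'x" where
  "dev n T = (SOME \<delta>. develops n T \<delta>)"

lemma dev: "T \<in> cells (Z n) d \<Longrightarrow> develops n T (dev n T)"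
  unfolding dev_def by (rule someI_ex[OF develops_ex])

lemma dev_child:
  assumes T: "T \<in> cells (Z n) d" and e: "e \<in> cells S' d" "e \<subseteq> g n ` T" and A: "A \<subseteq> D"
  shows "dev (Suc n) (T \<inter> g n -` e) ` A = (dev n T \<circ> child_chart (g n ` T) e) ` A"
proof (rule image_cong[OF refl])
  fix x assume "x \<in> A"
  then have "x \<in> D" using A by blast
  note U = Z_cell_SucI[OF T e]
  from develops_unique[OF U dev[OF U] develops_Suc[OF T e dev[OF T]] \<open>x \<in> D\<close>]
  show "dev (Suc n) (T \<inter> g n -` e) x = (dev n T \<circ> child_chart (g n ` T) e) x" .
qed

lemma dev_disk:
  assumes T: "T \<in> cells (Z n) d"
  shows "dev n T ` D = closed_cell (Z n) T"
proof
  note \<delta> = dev[OF T, unfolded develops_def]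
  have cont: "continuous_map (closed_disk d) (cspace X) (dev n T)" and im: "dev n T ` open_disk d = T"
    using \<delta> by simp_all
  have "dev n T ` (closed_disk d closure_of open_disk d) \<subseteq> cspace X closure_of (dev n T ` open_disk d)"
    by (rule continuous_map_image_closure_subset[OF cont])
  then show "dev n T ` D \<subseteq> closed_cell (Z n) T"
    unfolding closure_of_open_disk im closed_cell_def Z_space .
  have "compactin (cspace X) (dev n T ` D)"
    using image_compactin[OF _ cont] compact_space_closed_disk[of d] by (simp add: compact_space_def)
  then have "closedin (cspace X) (dev n T ` D)"
    by (rule compactin_imp_closedin[OF cw_Hausdorff[OF X_cw]])
  moreover have "T \<subseteq> dev n T ` D" using im open_disk_subset by blast
  ultimately show "closed_cell (Z n) T \<subseteq> dev n T ` D"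
    unfolding closed_cell_def Z_space by (intro closure_of_minimal)
qed

lemma dev_face:
  assumes T: "T \<in> cells (Z n) d" and b: "b \<in> tile_faces (g n ` T)" and k: "d = Suc k"
  shows "dev n T ` b \<in> cells (Z n) k" "dev n T ` b \<subseteq> closed_cell (Z n) T"
proof -
  show "dev n T ` b \<in> cells (Z n) k" using dev[OF T] b k unfolding develops_def by blast
  have "b \<subseteq> D" by (rule disk_cell_subset[OF Z_cell_image[OF T] tile_facesD[OF b k]])
  then show "dev n T ` b \<subseteq> closed_cell (Z n) T" unfolding dev_disk[OF T, symmetric] by (rule image_mono)
qed

text \<open>A point of \<open>c\<close> comes from some cell \<open>b\<close> of the model disk.
  Comparing images in the base shows that \<open>b\<close> has dimension \<open>k\<close>; then
  \<open>c\<close> and the image of \<open>b\<close> are k-cells with a common point.\<close>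

lemma face_of_closed_cell:
  assumes T: "T \<in> cells (Z n) d" and c: "c \<in> cells (Z n) k" "c \<subseteq> closed_cell (Z n) T" and k: "d = Suc k"
  shows "\<exists>b \<in> tile_faces (g n ` T). dev n T ` b = c"
proof -
  have t: "g n ` T \<in> cells S d" by (rule Z_cell_image[OF T])
  obtain x where x: "x \<in> c" using Z_cell_nonempty[OF c(1)] by blast
  then obtain y where y: "y \<in> D" "x = dev n T y" using c(2) dev_disk[OF T] by blast
  obtain l b where b: "b \<in> cells (disk_complex (g n ` T)) l" "y \<in> b" using disk_cell_cover[OF t y(1)] .
  have "g n x = chart (g n ` T) y" using dev[OF T] y by (simp add: develops_def)
  then have "g n x \<in> chart (g n ` T) ` b" using b(2) by blast
  from cw_disjoint[OF S_cw Z_cell_image[OF c(1)] chart_cell(1)[OF t b(1)] imageI[OF x] this]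
  have bf: "b \<in> tile_faces (g n ` T)" using b(1) by (intro tile_facesI[OF k]) simp
  moreover have "dev n T ` b = c"
    using Z_disjoint[OF dev_face(1)[OF T bf k] c(1), of x] x y b(2) by blast
  ultimately show ?thesis by blast
qed

text \<open>By \<open>develops_face\<close> either side is the part of a parent cell over a cell of
  the subdivided base, so equality amounts to equality of both data. When the carrier is the open
  disk, the parent cell is the tile itself.\<close>

lemma dev_child_face_eq:
  assumes T: "T \<in> cells (Z n) d" and e: "e \<in> cells S' d" "e \<subseteq> g n ` T"
    and T2: "T2 \<in> cells (Z n) d" and e2: "e2 \<in> cells S' d" "e2 \<subseteq> g n ` T2"
    and \<beta>: "\<beta> \<in> tile_faces (\<phi> ` e)" and \<beta>2: "\<beta>2 \<in> tile_faces (\<phi> ` e2)"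
  shows "dev (Suc n) (T \<inter> g n -` e) ` \<beta> = dev (Suc n) (T2 \<inter> g n -` e2) ` \<beta>2 \<longleftrightarrow>
    compatible_faces (T = T2)
      {(b, b'). b \<in> tile_faces (g n ` T) \<and> b' \<in> tile_faces (g n ` T2) \<and> dev n T ` b = dev n T2 ` b'}
      (face_position (g n ` T) e \<beta>) (face_position (g n ` T2) e2 \<beta>2)"
    (is "?L \<longleftrightarrow> ?R")
proof -
  obtain k where k: "d = Suc k" using \<beta> by (auto simp: tile_faces_def)
  have t: "g n ` T \<in> cells S d" and t2: "g n ` T2 \<in> cells S d" using Z_cell_image T T2 by simp_all
  have \<beta>k: "\<beta> \<in> cells (disk_complex (\<phi> ` e)) k" and \<beta>2k: "\<beta>2 \<in> cells (disk_complex (\<phi> ` e2)) k"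
    using tile_facesD \<beta> \<beta>2 k by simp_all
  define b where "b = carrier_cell (g n ` T) e \<beta>"
  define b2 where "b2 = carrier_cell (g n ` T2) e2 \<beta>2"
  define a where "a = chart (g n ` T) ` child_chart (g n ` T) e ` \<beta>"
  define a2 where "a2 = chart (g n ` T2) ` child_chart (g n ` T2) e2 ` \<beta>2"
  have pos: "face_position (g n ` T) e \<beta> = (if b = open_disk d then None else Some b, a)"
    "face_position (g n ` T2) e2 \<beta>2 = (if b2 = open_disk d then None else Some b2, a2)"
    by (simp_all add: face_position_def b_def b2_def a_def a2_def)
  have \<beta>D: "\<beta> \<subseteq> D" "\<beta>2 \<subseteq> D"
    using disk_cell_subset[OF phi_cell(1)[OF e(1)] \<beta>k] disk_cell_subset[OF phi_cell(1)[OF e2(1)] \<beta>2k] by simp_all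
  note F = develops_face[OF T e dev[OF T] k \<beta>k, folded b_def a_def]
  note F2 = develops_face[OF T2 e2 dev[OF T2] k \<beta>2k, folded b2_def a2_def]
  note C = carrier_cell[OF t e k \<beta>k, folded b_def a_def]
  note C2 = carrier_cell[OF t2 e2 k \<beta>2k, folded b2_def a2_def]
  have L: "?L \<longleftrightarrow> dev n T ` b \<inter> g n -` a = dev n T2 ` b2 \<inter> g n -` a2"
    unfolding dev_child[OF T e \<beta>D(1)] dev_child[OF T2 e2 \<beta>D(2)] F(1) F2(1) ..
  have dI: "dev n T ` open_disk d = T" "dev n T2 ` open_disk d = T2"
    using dev[OF T] dev[OF T2] by (simp_all add: develops_def)
  have bf: "b \<in> tile_faces (g n ` T)" if "b \<noteq> open_disk d" using C(2) that by (intro tile_facesI[OF k]) simp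
  have b2f: "b2 \<in> tile_faces (g n ` T2)" if "b2 \<noteq> open_disk d" using C2(2) that by (intro tile_facesI[OF k]) simp
  show ?thesis
  proof
    assume ?L
    then have eq: "dev n T ` b \<inter> g n -` a = dev n T2 ` b2 \<inter> g n -` a2" using L by simp
    have "dev n T ` b \<inter> g n -` a \<noteq> {}" using Z_cell_nonempty[OF F(3)] unfolding F(1) .
    then obtain x where x: "x \<in> dev n T ` b \<inter> g n -` a" by blast
    then have x1: "x \<in> dev n T ` b" "g n x \<in> a" by auto
    have x2: "x \<in> dev n T2 ` b2" "g n x \<in> a2" using x eq by auto
    have aa: "a = a2" using cw_disjoint[OF S'_cw C(3) C2(3) x1(2) x2(2)] by simp
    \<comment> \<open>Equal dimensions exclude that one carrier is the open disk and the other a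
      boundary face.\<close>
    have dd: "(if b = open_disk d then d else k) = (if b2 = open_disk d then d else k)" "dev n T ` b = dev n T2 ` b2"
      using Z_disjoint[OF F(2) F2(2) x1(1) x2(1)] by simp_all
    show ?R
    proof (cases "b = open_disk d")
      case True
      then have "b2 = open_disk d" using dd(1) k by (simp split: if_splits)
      then show ?thesis unfolding pos using True dd(2) dI aa by (simp add: compatible_faces_def)
    next
      case False
      then have "b2 \<noteq> open_disk d" using dd(1) k by (simp split: if_splits)
      then show ?thesis unfolding pos using False dd(2) aa bf b2f by (simp add: compatible_faces_def)
    qed
  next
    assume ?R
    then have "a = a2" "dev n T ` b = dev n T2 ` b2"
      unfolding pos using dI by (auto simp: compatible_faces_def split: if_splits)
    then show ?L using L by simp
  qed
qed

end

subsection \<open>The history graph is the graph of a tile system\<close>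

context subdivision_pair
begin

section \<open>Non-ideal tiles and their children\<close>

definition nonideal_children :: "'s set \<Rightarrow> 's set set" where
  "nonideal_children t = {e \<in> cells S' d. e \<subseteq> t \<and> \<phi> ` e \<notin> ideal_cells R}"

lemma nonideal_iff: "T \<in> nonideal_tiles d R X f n \<longleftrightarrow> T \<in> cells (Z n) d \<and> g n ` T \<notin> ideal_cells R"
  by (simp add: nonideal_tiles_def)

text \<open>\<open>\<phi>\<close> keeps the ideal part invariant, and a cell that meets an ideal
  cell is that cell. Consequently every non-ideal tile beyond level 0 has a non-ideal parent, which
  becomes its predecessor.\<close>

lemma ideal_child:
  assumes e: "e \<in> cells S' k" "e \<subseteq> t" and t: "t \<in> ideal_cells R"
  shows "\<phi> ` e \<in> ideal_cells R"
proof -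
  obtain x where x: "x \<in> e" using cw_cell_connected(2)[OF S'_cw e(1)] by blast
  then have "\<phi> x \<in> \<Union>(ideal_cells R)" using phi_ideal e(2) t by blast
  then obtain c where c: "c \<in> ideal_cells R" "\<phi> x \<in> c" by blast
  then obtain l where "c \<in> cells S l" using ideal_cells by (auto simp: all_cells_def)
  from cw_disjoint[OF S_cw phi_cell(1)[OF e(1)] this imageI[OF x] c(2)] show ?thesis using c(1) by simp
qed

lemma child_nonempty: "x \<in> nonideal_tiles d R X f n \<Longrightarrow> x \<noteq> {}"
  unfolding nonideal_iff by (rule Z_cell_nonempty[of x n d]) simp

lemma tile_child:
  assumes T: "T \<in> nonideal_tiles d R X f n" and e: "e \<in> nonideal_children (g n ` T)"
  shows "T \<inter> g n -` e \<in> nonideal_tiles d R X f (Suc n)" "g n ` (T \<inter> g n -` e) = e"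
    "g (Suc n) ` (T \<inter> g n -` e) = \<phi> ` e"
proof -
  have T': "T \<in> cells (Z n) d" and e': "e \<in> cells S' d" "e \<subseteq> g n ` T" "\<phi> ` e \<notin> ideal_cells R"
    using T e by (simp_all add: nonideal_iff nonideal_children_def)
  show im: "g n ` (T \<inter> g n -` e) = e" by (rule image_pullback[OF e'(2)])
  show "g (Suc n) ` (T \<inter> g n -` e) = \<phi> ` e" unfolding g_image_Suc im ..
  then show "T \<inter> g n -` e \<in> nonideal_tiles d R X f (Suc n)"
    unfolding nonideal_iff using Z_cell_SucI[OF T' e'(1,2)] e'(3) by simp
qed

lemma tile_childE:
  assumes U: "U \<in> nonideal_tiles d R X f (Suc n)"
  obtains T e where "T \<in> nonideal_tiles d R X f n" "e \<in> nonideal_children (g n ` T)" "U = T \<inter> g n -` e"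
proof -
  have U': "U \<in> cells (Z (Suc n)) d" and ni: "g (Suc n) ` U \<notin> ideal_cells R" using U by (simp_all add: nonideal_iff)
  obtain T e where T: "U = T \<inter> g n -` e" "T \<in> cells (Z n) d" "e \<in> cells S' d" "e \<subseteq> g n ` T"
    using Z_top_SucE[OF U'] .
  have "g (Suc n) ` U = \<phi> ` e" unfolding g_image_Suc T(1) image_pullback[OF T(4)] ..
  then have pe: "\<phi> ` e \<notin> ideal_cells R" using ni by simp
  then have "g n ` T \<notin> ideal_cells R" using ideal_child[OF T(3,4)] by blast
  then show ?thesis
    using that[of T e] T pe by (simp add: nonideal_iff nonideal_children_def)
qed

lemma tile_child_inj:
  assumes "T \<in> nonideal_tiles d R X f n" "e \<in> nonideal_children (g n ` T)"
    and "T' \<in> nonideal_tiles d R X f n" "e' \<in> nonideal_children (g n ` T')"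
    and eq: "T \<inter> g n -` e = T' \<inter> g n -` e'"
  shows "T = T' \<and> e = e'"
proof -
  obtain x where "x \<in> T \<inter> g n -` e" using child_nonempty[OF tile_child(1)[OF assms(1,2)]] by blast
  then have "x \<in> T" "x \<in> T'" using eq by blast+
  then have "T = T'" using Z_disjoint[of T n d T' d x] assms(1,3) unfolding nonideal_iff by simp
  moreover have "e = e'" using tile_child(2)[OF assms(1,2)] tile_child(2)[OF assms(3,4)] eq by simp
  ultimately show ?thesis by simp
qed

lemma nonideal_type: "T \<in> nonideal_tiles d R X f n \<Longrightarrow> g n ` T \<in> cells S d"
  unfolding nonideal_iff by (rule Z_cell_image) simp

text \<open>The faces of the model disk name exactly the (d - 1)-cells in a closed tile, so
  adjacency in the dual graph becomes nonempty gluing.\<close>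

lemma meet_iff:
  assumes "T \<in> nonideal_tiles d R X f n" "T' \<in> nonideal_tiles d R X f n"
  shows "meet_in_codim_1 d (Z n) T T' \<longleftrightarrow>
    (\<exists>b \<in> tile_faces (g n ` T). \<exists>b' \<in> tile_faces (g n ` T'). dev n T ` b = dev n T' ` b')"
proof -
  have T: "T \<in> cells (Z n) d" "T' \<in> cells (Z n) d" using assms by (simp_all add: nonideal_iff)
  show ?thesis
  proof
    assume "meet_in_codim_1 d (Z n) T T'"
    then obtain k c where c: "d = Suc k" "c \<in> cells (Z n) k" "c \<subseteq> closed_cell (Z n) T" "c \<subseteq> closed_cell (Z n) T'"
      unfolding meet_in_codim_1_def by blast
    obtain b where b: "b \<in> tile_faces (g n ` T)" "dev n T ` b = c"
      using face_of_closed_cell[OF T(1) c(2,3,1)] by blast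
    obtain b' where b': "b' \<in> tile_faces (g n ` T')" "dev n T' ` b' = c"
      using face_of_closed_cell[OF T(2) c(2,4,1)] by blast
    show "\<exists>b \<in> tile_faces (g n ` T). \<exists>b' \<in> tile_faces (g n ` T'). dev n T ` b = dev n T' ` b'"
      by (rule bexI[OF bexI[OF _ b'(1)] b(1)]) (simp add: b b')
  next
    assume "\<exists>b \<in> tile_faces (g n ` T). \<exists>b' \<in> tile_faces (g n ` T'). dev n T ` b = dev n T' ` b'"
    then obtain b b' where b: "b \<in> tile_faces (g n ` T)" "b' \<in> tile_faces (g n ` T')" "dev n T ` b = dev n T' ` b'" by blast
    obtain k where k: "d = Suc k" using b(1) unfolding tile_faces_def by blast
    have "dev n T ` b \<in> cells (Z n) k" "dev n T ` b \<subseteq> closed_cell (Z n) T \<inter> closed_cell (Z n) T'"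
      using dev_face[OF T(1) b(1) k] dev_face[OF T(2) b(2) k] b(3) by simp_all
    then show "meet_in_codim_1 d (Z n) T T'" unfolding meet_in_codim_1_def using k by blast
  qed
qed

lemma tile_system:
  assumes val: "bounded_valence d R X f"
  shows "tile_system (nonideal_tiles d R X f) (\<lambda>n T. g n ` T) (cells S d) tile_faces (\<lambda>n T b. dev n T ` b)
    nonideal_children (\<lambda>n T e. T \<inter> g n -` e) ((`) \<phi>) face_position"
proof
  show "finite (cells S d)"
    by (rule finite_subset[of _ "all_cells S"]) (use S_finite in \<open>auto simp: finite_complex_def all_cells_def\<close>)
  show "finite (tile_faces t)" if "t \<in> cells S d" for t by (rule finite_tile_faces[OF that])
  show "finite (nonideal_children t)" for t
    by (rule finite_subset[of _ "all_cells S'"])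
      (use S'_finite in \<open>auto simp: finite_complex_def all_cells_def nonideal_children_def\<close>)
  show "g n ` T \<in> cells S d" if "T \<in> nonideal_tiles d R X f n" for n T by (rule nonideal_type[OF that])
  show "T \<inter> g n -` e \<in> nonideal_tiles d R X f (Suc n)" "g (Suc n) ` (T \<inter> g n -` e) = \<phi> ` e"
    if "T \<in> nonideal_tiles d R X f n" "e \<in> nonideal_children (g n ` T)" for n T e
    by (rule tile_child[OF that])+
  show "T = T' \<and> e = e'"
    if "T \<in> nonideal_tiles d R X f n" "e \<in> nonideal_children (g n ` T)"
      "T' \<in> nonideal_tiles d R X f n" "e' \<in> nonideal_children (g n ` T')" "T \<inter> g n -` e = T' \<inter> g n -` e'"
    for n T e T' e'
    by (rule tile_child_inj[OF that])
  show "\<exists>T \<in> nonideal_tiles d R X f n. \<exists>e \<in> nonideal_children (g n ` T). U = T \<inter> g n -` e"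
    if U: "U \<in> nonideal_tiles d R X f (Suc n)" for n U
    by (rule tile_childE[OF U]) blast
  show "dev (Suc n) (T \<inter> g n -` e) ` \<beta> = dev (Suc n) (T' \<inter> g n -` e') ` \<beta>' \<longleftrightarrow>
      compatible_faces (T = T')
        {(b, b'). b \<in> tile_faces (g n ` T) \<and> b' \<in> tile_faces (g n ` T') \<and> dev n T ` b = dev n T' ` b'}
        (face_position (g n ` T) e \<beta>) (face_position (g n ` T') e' \<beta>')"
    if "T \<in> nonideal_tiles d R X f n" "e \<in> nonideal_children (g n ` T)"
      "T' \<in> nonideal_tiles d R X f n" "e' \<in> nonideal_children (g n ` T')"
      "\<beta> \<in> tile_faces (\<phi> ` e)" "\<beta>' \<in> tile_faces (\<phi> ` e')" for n T e T' e' \<beta> \<beta>'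
    by (rule dev_child_face_eq) (use that in \<open>simp_all add: nonideal_iff nonideal_children_def\<close>)
  show "e = e' \<and> \<beta> = \<beta>'"
    if "t \<in> cells S d" "e \<in> nonideal_children t" "e' \<in> nonideal_children t"
      "\<beta> \<in> tile_faces (\<phi> ` e)" "\<beta>' \<in> tile_faces (\<phi> ` e')"
      "fst (face_position t e \<beta>) \<noteq> None" "face_position t e \<beta> = face_position t e' \<beta>'" for t e e' \<beta> \<beta>'
    by (rule face_position_inj[OF that(1) _ _ _ _ that(4-7)]) (use that in \<open>simp_all add: nonideal_children_def\<close>)
  show "\<exists>K. \<forall>c. finite {T \<in> nonideal_tiles d R X f 0. c \<in> (`) (dev 0 T) ` tile_faces (g 0 ` T)} \<and>
      card {T \<in> nonideal_tiles d R X f 0. c \<in> (`) (dev 0 T) ` tile_faces (g 0 ` T)} \<le> K"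
  proof -
    obtain K where K: "\<And>k c. d = Suc k \<Longrightarrow> c \<in> cells X k \<Longrightarrow>
        finite {T \<in> nonideal_tiles d R X f 0. c \<subseteq> closed_cell X T} \<and>
        card {T \<in> nonideal_tiles d R X f 0. c \<subseteq> closed_cell X T} \<le> K"
      using val unfolding bounded_valence_def by blast
    \<comment> \<open>The valence bound concerns cells of \<open>X\<close>; a set \<open>c\<close>
      that is a face of no tile gives an empty collection.\<close>
    have "finite A \<and> card A \<le> K"
      if A: "A = {T \<in> nonideal_tiles d R X f 0. c \<in> (`) (dev 0 T) ` tile_faces (g 0 ` T)}" for c A
    proof (cases "A = {}")
      case False
      then obtain T b where T: "T \<in> nonideal_tiles d R X f 0" "b \<in> tile_faces (g 0 ` T)" "c = dev 0 T ` b"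
        using A by blast
      obtain k where k: "d = Suc k" using T(2) unfolding tile_faces_def by blast
      have "c \<in> cells (Z 0) k" unfolding T(3) using dev_face(1)[OF _ T(2) k] T(1) by (simp add: nonideal_iff)
      then have c: "c \<in> cells X k" by simp
      have sub: "A \<subseteq> {T \<in> nonideal_tiles d R X f 0. c \<subseteq> closed_cell X T}"
      proof
        fix T assume "T \<in> A"
        then obtain b where T: "T \<in> nonideal_tiles d R X f 0" "b \<in> tile_faces (g 0 ` T)" "c = dev 0 T ` b"
          using A by blast
        have "c \<subseteq> closed_cell (Z 0) T" unfolding T(3) using dev_face(2)[OF _ T(2) k] T(1) by (simp add: nonideal_iff)
        then show "T \<in> {T \<in> nonideal_tiles d R X f 0. c \<subseteq> closed_cell X T}" using T(1) by simp
      qed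
      show ?thesis
        using K[OF k c] finite_subset[OF sub] card_mono[OF _ sub] by linarith
    qed simp
    then show ?thesis by blast
  qed
qed

lemma history_graph_combinatorial:
  assumes val: "bounded_valence d R X f"
  shows "\<exists>(vl :: 'x history_vertex \<Rightarrow> nat) (el :: 'x history_vertex set \<Rightarrow> nat)
            (\<Xi> :: nat \<Rightarrow> 'x history_vertex graph).
           combinatorial_subdivision_rule (with_labels (history_graph d R X f) vl el) \<Xi>"
proof -
  interpret TS: tile_system "nonideal_tiles d R X f" "\<lambda>n T. g n ` T" "cells S d" tile_faces "\<lambda>n T b. dev n T ` b"
    nonideal_children "\<lambda>n T e. T \<inter> g n -` e" "(`) \<phi>" face_position
    by (rule tile_system[OF val])
  have gluing: "TS.gluing n T T' \<noteq> {} \<longleftrightarrow>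
      (\<exists>b \<in> tile_faces (g n ` T). \<exists>b' \<in> tile_faces (g n ` T'). dev n T ` b = dev n T' ` b')" for n T T'
    unfolding TS.gluing_def by blast
  have adj: "TS.adj n T T' \<longleftrightarrow> T \<in> nonideal_tiles d R X f n \<and> T' \<in> nonideal_tiles d R X f n \<and> T \<noteq> T' \<and>
      meet_in_codim_1 d (Z n) T T'" for n T T'
    using meet_iff[of T n T'] unfolding TS.adj_def gluing by blast
  have hor: "edges (dual_graph d R X f n) = {{Tile n T, Tile n T'} | T T'. TS.adj n T T'}" for n
    unfolding dual_graph_def adj by simp
  \<comment> \<open>Containment of tiles, which defines the vertical edges, agrees with the parent
    relation because tiles of one level are disjoint.\<close>
  have par: "T' \<subseteq> T \<longleftrightarrow> T = TS.parent n T'"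
    if T: "T \<in> nonideal_tiles d R X f n" and T': "T' \<in> nonideal_tiles d R X f (Suc n)" for n T T'
  proof -
    note P = TS.parent_index[OF T']
    have sub: "T' \<subseteq> TS.parent n T'" using P(3) by blast
    show ?thesis
    proof
      assume "T' \<subseteq> T"
      moreover obtain x where "x \<in> T'" using child_nonempty[OF T'] by blast
      ultimately have "x \<in> T" "x \<in> TS.parent n T'" using sub by blast+
      then show "T = TS.parent n T'"
        using Z_disjoint[of T n d "TS.parent n T'" d x] T P(1) unfolding nonideal_iff by simp
    qed (use sub in simp)
  qed
  \<comment> \<open>The edges at the origin are the case \<open>n = 0\<close> of the edges from
    \<open>up n T\<close> to \<open>Tile n T\<close>.\<close>
  have ver: "{{Tile n T, Tile (Suc n) T'} | n T T'. T \<in> nonideal_tiles d R X f n \<and>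
        T' \<in> nonideal_tiles d R X f (Suc n) \<and> T' \<subseteq> T} \<union>
      {{Origin, v} | v. v \<in> verts (dual_graph d R X f 0)} =
      {{TS.up n T, Tile n T} | n T. T \<in> nonideal_tiles d R X f n}" (is "?A \<union> ?B = ?C")
  proof
    show "?A \<union> ?B \<subseteq> ?C"
    proof (rule Un_least; rule subsetI)
      fix E assume "E \<in> ?A"
      then obtain n T T' where E: "E = {Tile n T, Tile (Suc n) T'}" "T \<in> nonideal_tiles d R X f n"
        "T' \<in> nonideal_tiles d R X f (Suc n)" "T' \<subseteq> T" by blast
      then have "E = {TS.up (Suc n) T', Tile (Suc n) T'}" using par[OF E(2,3)] by (simp add: TS.up_def)
      then show "E \<in> ?C" using E(3) by blast
    next
      fix E assume "E \<in> ?B"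
      then obtain T where "T \<in> nonideal_tiles d R X f 0" "E = {Origin, Tile 0 T}" by (auto simp: dual_graph_def)
      then have "E = {TS.up 0 T, Tile 0 T}" "T \<in> nonideal_tiles d R X f 0" by (simp_all add: TS.up_def)
      then show "E \<in> ?C" by blast
    qed
    show "?C \<subseteq> ?A \<union> ?B"
    proof
      fix E assume "E \<in> ?C"
      then obtain n T where E: "E = {TS.up n T, Tile n T}" "T \<in> nonideal_tiles d R X f n" by blast
      show "E \<in> ?A \<union> ?B"
      proof (cases n)
        case 0
        then have "E = {Origin, Tile 0 T}" "Tile 0 T \<in> verts (dual_graph d R X f 0)"
          using E by (simp_all add: TS.up_def dual_graph_def)
        then show ?thesis by blast
      next
        case (Suc m)
        then have T: "T \<in> nonideal_tiles d R X f (Suc m)" using E by simp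
        have "E = {Tile m (TS.parent m T), Tile (Suc m) T}" using E Suc by (simp add: TS.up_def)
        moreover have "T \<subseteq> TS.parent m T" using par[OF TS.parent_index(1)[OF T] T] by simp
        ultimately show ?thesis using TS.parent_index(1)[OF T] T by blast
      qed
    qed
  qed
  have "history_graph d R X f = TS.tile_graph"
  proof -
    have "insert Origin (\<Union>n. verts (dual_graph d R X f n)) = insert Origin {Tile n T | n T. T \<in> nonideal_tiles d R X f n}"
      by (auto simp: dual_graph_def)
    moreover have "(\<Union>n. edges (dual_graph d R X f n)) = {{Tile n T, Tile n T'} | n T T'. TS.adj n T T'}"
      unfolding hor by blast
    ultimately show ?thesis
      unfolding history_graph_def TS.tile_graph_def Un_assoc ver by simp
  qed
  then show ?thesis using TS.tile_graph_combinatorial by simp blast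
qed

end

theorem theorem2:
  fixes R :: "'s subdivision_rule" and X :: "'x cell_complex" and f :: "'x \<Rightarrow> 's" and d :: nat
  assumes "finite_subdivision_rule d R"
    and "R_complex d R X f"
    and "bounded_valence d R X f"
  shows "\<exists>(vl :: 'x history_vertex \<Rightarrow> nat) (el :: 'x history_vertex set \<Rightarrow> nat)
            (\<Xi> :: nat \<Rightarrow> 'x history_vertex graph).
           combinatorial_subdivision_rule (with_labels (history_graph d R X f) vl el) \<Xi>"
proof -
  interpret subdivision_pair d R X f
    using assms(1,2) by unfold_locales
  show ?thesis by (rule history_graph_combinatorial[OF assms(3)])
qed

end
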